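(* Let $p,q\in(0,1)$. For each $n$ and each $i=1,\dots,n$, let $i$ be contained in $\Omega_n$ independently with probability $1-q$ and, also independently, let $i$ be included in $T_n$ with probability $1-p$. Then, as $n\to\infty$, the empirical distributions of the $\min(|T_n|,|\Omega_n|)$ largest eigenvalues of $F_{\Omega_nT_n}F_{\Omega_nT_n}^*$ and of $\mathcal{U}_{\Omega_nT_n}\mathcal{U}_{\Omega_nT_n}^*$ each converge almost surely to $$f_{p,q}(x)=\frac{\sqrt{\left(1-\frac{r_-}{x}\right)\left(\frac{r_+}{x}-1\right)}}{2\pi(1-x)(1-\max(p,q))}\cdot I_{(r_-,r_+)}(x)+\frac{\max(0,1-(p+q))}{1-\max(p,q)}\cdot\delta(x-1),$$ where $$r_-=\left(\sqrt{p(1-q)}-\sqrt{q(1-p)}\right)^2\quad\text{and}\quad r_+=\left(\sqrt{p(1-q)}+\sqrt{q(1-p)}\right)^2.$$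
   Context: $F_n$ is the $n\times n$ discrete Fourier transform (DFT) matrix, with entries $F_{jk}=\frac{1}{\sqrt n}e^{-2\pi i(j-1)(k-1)/n}$, $1\le j,k\le n$; it is unitary. $\mathcal{U}_n$ is a random $n\times n$ unitary matrix with Haar distribution, independent of $\Omega_n$ and $T_n$. For subsets $\Omega,T\subset\{1,\dots,n\}$, $F_{\Omega T}$ (respectively $\mathcal{U}_{\Omega T}$) is the matrix obtained from $F_n$ (respectively $\mathcal{U}_n$) by removing the rows with indices not in $\Omega$ and the columns with indices not in $T$; the notation $F_{\Omega_nT_n}$, $\mathcal{U}_{\Omega_nT_n}$ makes the original dimension $n$ explicit. A superscript $*$ denotes conjugate transpose. The empirical distribution of real numbers $\lambda_1,\dots,\lambda_k$ is the probability measure $\frac1k\sum_{i=1}^k\delta_{\lambda_i}$ (eigenvalues are counted with multiplicity). $I_{(a,b)}$ is the indicator function of $(a,b)$ and $\delta(x-1)$ is the unit point mass at $1$; $f_{p,q}$ is identified with the probability measure it describes (absolutely continuous part plus point mass). Almost sure convergence means that, with all random objects for all $n$ defined on a common probability space, the random empirical measures converge weakly to the limit measure with probability one. *)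

theory Defs
  imports
    "HOL-Probability.Probability"
    "Jordan_Normal_Form.Schur_Decomposition"
    "Jordan_Normal_Form.DL_Submatrix"
begin

(* Rows and columns of Jordan_Normal_Form matrices are numbered from 0, so the index set
   {1..n} is {..<n} here, and the shifts j-1, k-1 in the entries of the DFT matrix disappear. *)
definition dft_matrix :: "nat \<Rightarrow> complex mat" where
  "dft_matrix n = Matrix.mat n n
     (\<lambda>(j, k). 1 / of_real (sqrt (real n)) *
        exp (- 2 * of_real pi * \<i> * of_nat j * of_nat k / of_nat n))"

definition unitary_group :: "nat \<Rightarrow> complex mat set" where
  "unitary_group n =
     {A \<in> carrier_mat n n. A * mat_adjoint A = 1\<^sub>m n \<and> mat_adjoint A * A = 1\<^sub>m n}"

(* The sigma-algebra generated by the matrix entries, i.e. the Borel sigma-algebra of U(n)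
   as a subspace of n x n complex matrices; only the space and the sets matter. *)
definition unitary_space :: "nat \<Rightarrow> complex mat measure" where
  "unitary_space n = vimage_algebra (unitary_group n)
     (\<lambda>A. \<lambda>(i, j) \<in> {..<n} \<times> {..<n}. A $$ (i, j))
     (Pi\<^sub>M ({..<n} \<times> {..<n}) (\<lambda>_. borel))"

definition haar_measure :: "nat \<Rightarrow> complex mat measure \<Rightarrow> bool" where
  "haar_measure n \<mu> \<longleftrightarrow>
     prob_space \<mu> \<and> sets \<mu> = sets (unitary_space n) \<and>
     (\<forall>V \<in> unitary_group n. distr \<mu> (unitary_space n) (\<lambda>A. V * A) = \<mu>)"

context prob_space
begin

(* The events {i \<in> \<Omega>} and {i \<in> T}, for all i < n, are mutually independent. *)
definition random_index_sets ::
  "nat \<Rightarrow> real \<Rightarrow> real \<Rightarrow> ('a \<Rightarrow> nat set) \<Rightarrow> ('a \<Rightarrow> nat set) \<Rightarrow> bool" where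
  "random_index_sets n a b \<Omega> T \<longleftrightarrow>
     (\<forall>\<omega> \<in> space M. \<Omega> \<omega> \<subseteq> {..<n} \<and> T \<omega> \<subseteq> {..<n}) \<and>
     indep_events (case_sum (\<lambda>i. {\<omega> \<in> space M. i \<in> \<Omega> \<omega>}) (\<lambda>i. {\<omega> \<in> space M. i \<in> T \<omega>}))
       ({..<n} <+> {..<n}) \<and>
     (\<forall>i < n. prob {\<omega> \<in> space M. i \<in> \<Omega> \<omega>} = a \<and> prob {\<omega> \<in> space M. i \<in> T \<omega>} = b)"

definition haar_unitary :: "nat \<Rightarrow> ('a \<Rightarrow> complex mat) \<Rightarrow> bool" where
  "haar_unitary n U \<longleftrightarrow>
     random_variable (unitary_space n) U \<and> haar_measure n (distr M (unitary_space n) U)"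

(* The library's indep_var requires both random variables to have the same type. *)
definition indep_of :: "'b measure \<Rightarrow> ('a \<Rightarrow> 'b) \<Rightarrow> 'c measure \<Rightarrow> ('a \<Rightarrow> 'c) \<Rightarrow> bool" where
  "indep_of N X L Y \<longleftrightarrow>
     random_variable N X \<and> random_variable L Y \<and>
     indep_set {X -` A \<inter> space M | A. A \<in> sets N} {Y -` B \<inter> space M | B. B \<in> sets L}"

end

(* Used for Hermitian matrices only, so Re discards nothing. *)
definition largest_eigenvalues :: "nat \<Rightarrow> complex mat \<Rightarrow> real list" where
  "largest_eigenvalues k A =
     take k (rev (sorted_list_of_multiset (image_mset Re (proots (char_poly A)))))"

(* Unspecified for the empty list. In the application this happens, almost surely, only for
   finitely many n, so it does not affect the limit. *)
definition empirical_distribution :: "real list \<Rightarrow> real measure" where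
  "empirical_distribution xs = distr (measure_pmf (pmf_of_multiset (mset xs))) borel (\<lambda>x. x)"

definition restriction_law :: "complex mat \<Rightarrow> nat set \<Rightarrow> nat set \<Rightarrow> real measure" where
  "restriction_law A \<Omega> T = empirical_distribution
     (largest_eigenvalues (min (card T) (card \<Omega>))
        (submatrix A \<Omega> T * mat_adjoint (submatrix A \<Omega> T)))"

definition r_minus :: "real \<Rightarrow> real \<Rightarrow> real" where
  "r_minus p q = (sqrt (p * (1 - q)) - sqrt (q * (1 - p)))\<^sup>2"

definition r_plus :: "real \<Rightarrow> real \<Rightarrow> real" where
  "r_plus p q = (sqrt (p * (1 - q)) + sqrt (q * (1 - p)))\<^sup>2"

definition limit_density :: "real \<Rightarrow> real \<Rightarrow> real \<Rightarrow> real" where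
  "limit_density p q x =
     sqrt ((1 - r_minus p q / x) * (r_plus p q / x - 1)) /
       (2 * pi * (1 - x) * (1 - max p q)) * indicator {r_minus p q<..<r_plus p q} x"

definition limit_law :: "real \<Rightarrow> real \<Rightarrow> real measure" where
  "limit_law p q = measure_of UNIV (sets borel)
     (\<lambda>A. (\<integral>\<^sup>+x\<in>A. ennreal (limit_density p q x) \<partial>lborel) +
          ennreal (max 0 (1 - (p + q)) / (1 - max p q)) * indicator A 1)"

(* The set function above is countably additive, so measure_of does not collapse it to 0. *)
lemma emeasure_limit_law:
  assumes "A \<in> sets borel"
  shows "emeasure (limit_law p q) A =
    (\<integral>\<^sup>+x\<in>A. ennreal (limit_density p q x) \<partial>lborel) +
    ennreal (max 0 (1 - (p + q)) / (1 - max p q)) * indicator A 1"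
proof -
  let ?c = "ennreal (max 0 (1 - (p + q)) / (1 - max p q))"
  let ?D = "density lborel (\<lambda>x. ennreal (limit_density p q x))"
  let ?P = "density (return borel (1::real)) (\<lambda>_. ?c)"
  have [measurable]: "limit_density p q \<in> borel_measurable borel"
    unfolding limit_density_def by measurable
  have D: "emeasure ?D B = (\<integral>\<^sup>+x\<in>B. ennreal (limit_density p q x) \<partial>lborel)"
    if "B \<in> sets borel" for B
    using that by (subst emeasure_density) auto
  have P: "emeasure ?P B = ?c * indicator B 1" if "B \<in> sets borel" for B
    using that by (subst emeasure_density) (auto simp: nn_integral_return)
  let ?f = "\<lambda>B. (\<integral>\<^sup>+x\<in>B. ennreal (limit_density p q x) \<partial>lborel) + ?c * indicator B 1"
  have "countably_additive (sets borel) ?f"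
  proof (rule countably_additiveI)
    fix B :: "nat \<Rightarrow> real set"
    assume B: "range B \<subseteq> sets borel" "disjoint_family B" "(\<Union>i. B i) \<in> sets borel"
    have B': "B i \<in> sets borel" for i using B by auto
    have "(\<Sum>i. ?f (B i)) = (\<Sum>i. emeasure ?D (B i) + emeasure ?P (B i))"
      using D[OF B'] P[OF B'] by simp
    also have "\<dots> = (\<Sum>i. emeasure ?D (B i)) + (\<Sum>i. emeasure ?P (B i))"
      by (rule suminf_add[symmetric]) auto
    also have "\<dots> = emeasure ?D (\<Union>i. B i) + emeasure ?P (\<Union>i. B i)"
      using B by (subst (1 2) suminf_emeasure) auto
    also have "\<dots> = ?f (\<Union>i. B i)" using D[OF B(3)] P[OF B(3)] by simp
    finally show "(\<Sum>i. ?f (B i)) = ?f (\<Union>i. B i)" .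
  qed
  moreover have "positive (sets borel) ?f" by (auto simp: positive_def)
  ultimately show ?thesis
    unfolding limit_law_def using assms
    by (intro emeasure_measure_of_sigma) (auto simp: sets.sigma_algebra_axioms[of borel, simplified])
qed

end

theory Submission
  imports Defs
begin

text \<open>
  Put \<open>a = 1 - q\<close>, \<open>b = 1 - p\<close>, let \<open>P\<close> and \<open>Q\<close> be the coordinate projections onto \<open>\<Omega>\<close> and \<open>T\<close>, and let
  \<open>G = A Q A\<^sup>*\<close> for the unitary matrix \<open>A\<close> (DFT or Haar).

  Expand \<open>tr (((P - a) (G - b))\<^sup>k)\<close> over closed walks. In its second absolute moment only those pairs of
  walks survive that visit every row index and every column index at least twice; there are
  \<open>O(n\<^bsup>2k\<^esup>)\<close> of them, and each contributes a product of \<open>4k\<close> entries of \<open>A\<close>, of size \<open>O(n\<^bsup>-2k\<^esup>)\<close>. So the second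
  moment is bounded, and as \<open>n\<^bsup>-2\<^esup>\<close> is summable, the trace divided by \<open>n\<close> tends to \<open>0\<close> almost surely for all \<open>k \<ge> 1\<close>. For the
  DFT the entries have modulus \<open>n\<^bsup>-1/2\<^esup>\<close>; for Haar matrices the moments of the entries are bounded by
  Khintchine's inequality, since the law is invariant under multiplication by the DFT matrix with signs.

  On a two-dimensional block of the pair \<open>P\<close>, \<open>G\<close> with eigenvalue \<open>x\<close> of \<open>P G P\<close>, the matrix \<open>(P - a) (G - b)\<close> has
  determinant \<open>D = a (1 - a) b (1 - b)\<close> and trace \<open>x - c\<close>, \<open>c = a + b - 2 a b\<close>. Hence the traces above determine
  the averages over the eigenvalues of the Chebyshev polynomials for the interval with endpoints
  \<open>c \<plusminus> 2 \<surd>D\<close>, which are \<open>r\<^sub>-\<close> and \<open>r\<^sub>+\<close>. Under \<open>x = c - 2 \<surd>D cos \<phi>\<close> the limit density becomes a sum of two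
  multiples of \<open>sin\<^sup>2 \<phi>\<close> times a Poisson kernel, whose Fourier coefficients are the limits
  of these averages. All measures live on \<open>[0, 1]\<close>, so convergence of moments suffices.
\<close>

section \<open>Second moments of sums over closed walks\<close>

text \<open>The DFT matrix is deterministic, so the asymptotic freeness provided by a Haar rotation
  is not at hand; the randomness of the two index sets has to suffice. Centring makes this possible:
  the expectation of a product of centred indicators vanishes as soon as one index occurs only once,
  and for the surviving pairs of walks absolute values of entries are good enough. Unitarity and a
  moment bound for single entries are then all that is asked of \<open>A\<close>, so both matrices
  share one argument. The price is that traces of centred words must be read as statistics of
  eigenvalues. No block decomposition is carried out for this: \<open>C = (P + G - 1)^2\<close>
  commutes with both projections and acts as the scalar \<open>x\<close> on a block, and
  Cayley-Hamilton for the blocks becomes one polynomial identity between \<open>M\<close> and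
  \<open>C\<close>. Common eigenvectors of the projections enter through ranks only; the limits of
  these ranks, divided by \<open>n\<close>, are the reason why the Chebyshev averages have nonzero
  limits.\<close>

definition no_singleton_fibre :: "'x set \<Rightarrow> ('x \<Rightarrow> 'i) \<Rightarrow> bool" where
  "no_singleton_fibre X f \<longleftrightarrow> (\<forall>x\<in>X. \<exists>y\<in>X. y \<noteq> x \<and> f y = f x)"

lemma card_image_no_singleton_fibre:
  assumes "finite X" "no_singleton_fibre X f"
  shows "2 * card (f ` X) \<le> card X"
proof -
  have "2 \<le> card {x\<in>X. f x = y}" if "y \<in> f ` X" for y
  proof -
    from that obtain x where x: "x \<in> X" "f x = y" by auto
    with assms(2) obtain x' where x': "x' \<in> X" "x' \<noteq> x" "f x' = y"
      unfolding no_singleton_fibre_def by force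
    have "card {x, x'} \<le> card {x\<in>X. f x = y}"
      using x x' assms(1) by (intro card_mono) auto
    then show ?thesis using x' by simp
  qed
  then have "(\<Sum>y\<in>f ` X. 2) \<le> (\<Sum>y\<in>f ` X. card {x\<in>X. f x = y})"
    by (intro sum_mono) auto
  also have "\<dots> = card X"
    using sum.image_gen[OF assms(1), of "\<lambda>_. 1::nat" f] by simp
  finally show ?thesis by simp
qed

text \<open>With at most \<open>k\<close> values, \<open>f\<close> factors as a labelling
  \<open>h\<close> of the positions by \<open>k\<close> labels followed by a choice \<open>g\<close>
  of a value for each label. Counting the pairs \<open>(g, h)\<close> overcounts, but only by a
  factor bounded independently of \<open>n\<close>.\<close>

lemma card_no_singleton_fibre:
  assumes X: "finite X" "card X = 2 * k"
  shows "card {f \<in> X \<rightarrow>\<^sub>E {..<n::nat}. no_singleton_fibre X f} \<le> n ^ k * k ^ (2 * k)"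
proof -
  let ?G = "({..<k} \<rightarrow>\<^sub>E {..<n}) \<times> (X \<rightarrow>\<^sub>E {..<k})"
  let ?c = "\<lambda>(g, h). restrict (\<lambda>x. g (h x)) X"
  have fin: "finite ?G" using X by (auto intro!: finite_PiE)
  have "{f \<in> X \<rightarrow>\<^sub>E {..<n}. no_singleton_fibre X f} \<subseteq> ?c ` ?G"
  proof
    fix f assume "f \<in> {f \<in> X \<rightarrow>\<^sub>E {..<n}. no_singleton_fibre X f}"
    then have f: "f \<in> X \<rightarrow>\<^sub>E {..<n}" "no_singleton_fibre X f" by auto
    have le: "card (f ` X) \<le> k" using card_image_no_singleton_fibre[OF X(1) f(2)] X by simp
    obtain e where e: "bij_betw e {..<card (f ` X)} (f ` X)"
      using ex_bij_betw_nat_finite[of "f ` X"] X(1) by (auto simp: atLeast0LessThan)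
    \<comment> \<open>Labels that \<open>h\<close> never takes still need a value below
      \<open>n\<close>; \<open>e 0\<close> serves, since the image of \<open>f\<close> is nonempty
      as soon as there is a label at all.\<close>
    define g where "g = restrict (\<lambda>i. if i < card (f ` X) then e i else e 0) {..<k}"
    define h where "h = restrict (\<lambda>x. inv_into {..<card (f ` X)} e (f x)) X"
    have surj: "e ` {..<card (f ` X)} = f ` X" using e by (simp add: bij_betw_def)
    have hx: "h x < card (f ` X)" "e (h x) = f x" if "x \<in> X" for x
      using that surj inv_into_into[of "f x" e "{..<card (f ` X)}"]
        f_inv_into_f[of "f x" e "{..<card (f ` X)}"] by (auto simp: h_def)
    have "e i \<in> {..<n}" if "i < card (f ` X)" for i
      using surj that f(1) by (metis (no_types, lifting) PiE_mem imageE imageI lessThan_iff)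
    moreover have "0 < card (f ` X)" if "0 < k"
      using that X by (auto simp: card_gt_0_iff)
    ultimately have "g \<in> {..<k} \<rightarrow>\<^sub>E {..<n}" by (auto simp: g_def)
    moreover have "h \<in> X \<rightarrow>\<^sub>E {..<k}" using hx le by (fastforce simp: h_def)
    moreover have "f = ?c (g, h)"
    proof
      fix x show "f x = ?c (g, h) x"
      proof (cases "x \<in> X")
        case True
        have "g (h x) = e (h x)" using hx(1)[OF True] le by (simp add: g_def)
        then show ?thesis using hx(2)[OF True] True by simp
      next
        case False
        then show ?thesis using PiE_arb[OF f(1)] by simp
      qed
    qed
    ultimately show "f \<in> ?c ` ?G" by blast
  qed
  then have "card {f \<in> X \<rightarrow>\<^sub>E {..<n}. no_singleton_fibre X f} \<le> card ?G"
    using card_mono[OF finite_imageI[OF fin]] card_image_le[OF fin, of ?c] le_trans by blast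
  also have "\<dots> = n ^ k * k ^ (2 * k)"
    using X by (simp add: card_cartesian_product card_PiE)
  finally show ?thesis .
qed

context prob_space
begin

text \<open>\<open>indep_events\<close> speaks of intersections only. Expanding the product over
  subsets of \<open>I\<close> reduces the claim to these, because a product of indicators is the
  indicator of an intersection.\<close>

lemma expectation_prod_affine_indicator:
  fixes a b :: "'i \<Rightarrow> real"
  assumes I: "finite I" and indep: "indep_events A I"
  shows "expectation (\<lambda>\<omega>. \<Prod>i\<in>I. a i + b i * indicator (A i) \<omega>) = (\<Prod>i\<in>I. a i + b i * prob (A i))"
proof -
  have ev: "A i \<in> events" if "i \<in> I" for i using indep that by (auto simp: indep_events_def)
  have key: "expectation (\<lambda>\<omega>. \<Prod>i\<in>S. indicator (A i) \<omega> :: real) = (\<Prod>i\<in>S. prob (A i))"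
    if "S \<subseteq> I" for S
  proof (cases "S = {}")
    case True then show ?thesis by (simp add: prob_space)
  next
    case False
    have fin: "finite S" using that I finite_subset by blast
    have "(\<lambda>\<omega>. \<Prod>i\<in>S. indicator (A i) \<omega> :: real) = indicator (\<Inter>i\<in>S. A i)"
      using fin by (induction S) (auto simp: fun_eq_iff indicator_def)
    moreover have "(\<Inter>i\<in>S. A i) \<in> events" using False fin ev that by (intro sets.finite_INT) auto
    ultimately have "expectation (\<lambda>\<omega>. \<Prod>i\<in>S. indicator (A i) \<omega> :: real) = prob (\<Inter>i\<in>S. A i)"
      by simp
    also have "\<dots> = (\<Prod>i\<in>S. prob (A i))"
      using indep False fin that by (auto simp: indep_events_def)
    finally show ?thesis .
  qed
  have int: "integrable M (\<lambda>\<omega>. \<Prod>i\<in>S. indicator (A i) \<omega> :: real)" if "S \<subseteq> I" for S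
  proof (rule integrable_const_bound[where B = 1])
    have "\<bar>\<Prod>i\<in>S. indicator (A i) \<omega> :: real\<bar> \<le> 1" for \<omega>
      by (auto simp: abs_prod intro!: prod_le_1)
    then show "AE \<omega> in M. norm (\<Prod>i\<in>S. indicator (A i) \<omega> :: real) \<le> 1" by simp
    show "(\<lambda>\<omega>. \<Prod>i\<in>S. indicator (A i) \<omega> :: real) \<in> borel_measurable M"
      using ev that by (intro borel_measurable_prod borel_measurable_indicator) auto
  qed
  have "(\<lambda>\<omega>. \<Prod>i\<in>I. a i + b i * indicator (A i) \<omega>) =
    (\<lambda>\<omega>. \<Sum>S\<in>Pow I. (prod a S * prod b (I - S)) * (\<Prod>i\<in>I - S. indicator (A i) \<omega>))"
    using I by (simp add: prod_add prod.distrib mult.assoc)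
  then have "expectation (\<lambda>\<omega>. \<Prod>i\<in>I. a i + b i * indicator (A i) \<omega>) =
    (\<Sum>S\<in>Pow I. (prod a S * prod b (I - S)) * (\<Prod>i\<in>I - S. prob (A i)))"
    using int by (simp add: key)
  also have "\<dots> = (\<Prod>i\<in>I. a i + b i * prob (A i))"
    using I by (simp add: prod_add prod.distrib mult.assoc)
  finally show ?thesis .
qed

text \<open>Equal indices give dependent factors, so positions are first grouped by their index. On
  the values \<open>0\<close> and \<open>1\<close> a power \<open>(t - p) ^ c\<close> agrees with an
  affine function of \<open>t\<close>, which yields \<open>a\<close> and \<open>b\<close>; a group
  of size one has mean \<open>0\<close>.\<close>

lemma expectation_prod_centred_indicator_eq_0:
  assumes I: "finite I" "indep_events A I" and X: "finite X" "f \<in> X \<rightarrow> I"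
    and sing: "\<not> no_singleton_fibre X f"
  shows "expectation (\<lambda>\<omega>. \<Prod>x\<in>X. indicator (A (f x)) \<omega> - prob (A (f x))) = 0"
proof -
  define c where "c i = card {x\<in>X. f x = i}" for i
  define a where "a i = (- prob (A i)) ^ c i" for i
  define b where "b i = (1 - prob (A i)) ^ c i - (- prob (A i)) ^ c i" for i
  have "(\<Prod>x\<in>X. indicator (A (f x)) \<omega> - prob (A (f x))) = (\<Prod>i\<in>I. a i + b i * indicator (A i) \<omega>)"
    for \<omega>
  proof -
    have "(\<Prod>x\<in>X. indicator (A (f x)) \<omega> - prob (A (f x))) =
        (\<Prod>i\<in>I. \<Prod>x\<in>{x\<in>X. f x = i}. indicator (A (f x)) \<omega> - prob (A (f x)))"
      using X I by (intro prod.group[symmetric]) auto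
    also have "\<dots> = (\<Prod>i\<in>I. (indicator (A i) \<omega> - prob (A i)) ^ c i)"
      by (intro prod.cong) (auto simp: c_def)
    also have "\<dots> = (\<Prod>i\<in>I. a i + b i * indicator (A i) \<omega>)"
      by (intro prod.cong) (auto simp: a_def b_def indicator_def)
    finally show ?thesis .
  qed
  then have "expectation (\<lambda>\<omega>. \<Prod>x\<in>X. indicator (A (f x)) \<omega> - prob (A (f x))) =
      (\<Prod>i\<in>I. a i + b i * prob (A i))"
    by (simp add: expectation_prod_affine_indicator[OF I])
  also have "\<dots> = 0"
  proof -
    from sing obtain x where x: "x \<in> X" "\<And>y. y \<in> X \<Longrightarrow> f y = f x \<Longrightarrow> y = x"
      unfolding no_singleton_fibre_def by blast
    then have "{y\<in>X. f y = f x} = {x}" by auto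
    then have "c (f x) = 1" by (simp add: c_def)
    then have "a (f x) + b (f x) * prob (A (f x)) = 0" by (simp add: a_def b_def)
    moreover have "f x \<in> I" using x X by auto
    ultimately show ?thesis using I(1) by (auto intro!: prod_zero)
  qed
  finally show ?thesis .
qed

text \<open>The two composites take values in one type, so \<open>indep_var\<close> applies to them.
  By \<open>pull\<close>, the sigma-algebra generated by a composite consists of preimages under the
  inner variable, and for these independence is assumed.\<close>

lemma indep_of_expectation_mult:
  fixes f :: "'b \<Rightarrow> complex" and g :: "'c \<Rightarrow> complex"
  assumes ind: "indep_of N X L Y"
    and f: "f \<in> borel_measurable N" and g: "g \<in> borel_measurable L"
    and int: "integrable M (\<lambda>\<omega>. f (X \<omega>))" "integrable M (\<lambda>\<omega>. g (Y \<omega>))"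
  shows "expectation (\<lambda>\<omega>. f (X \<omega>) * g (Y \<omega>)) = expectation (\<lambda>\<omega>. f (X \<omega>)) * expectation (\<lambda>\<omega>. g (Y \<omega>))"
proof (rule indep_var_lebesgue_integral[OF _ int])
  have X: "X \<in> measurable M N" and Y: "Y \<in> measurable M L"
    and XY: "indep_set {X -` A \<inter> space M | A. A \<in> sets N} {Y -` B \<inter> space M | B. B \<in> sets L}"
    using ind by (auto simp: indep_of_def)
  have fX: "(\<lambda>\<omega>. f (X \<omega>)) \<in> borel_measurable M" using measurable_compose[OF X f] .
  have gY: "(\<lambda>\<omega>. g (Y \<omega>)) \<in> borel_measurable M" using measurable_compose[OF Y g] .
  have pull: "sigma_sets (space M) {(\<lambda>\<omega>. h (Z \<omega>)) -` A \<inter> space M |A. A \<in> sets borel}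
      \<subseteq> {Z -` A \<inter> space M | A. A \<in> sets K}"
    if Z: "Z \<in> measurable M K" and h: "h \<in> borel_measurable K"
    for Z :: "'a \<Rightarrow> 'z" and K and h :: "'z \<Rightarrow> complex"
  proof -
    have "{(\<lambda>\<omega>. h (Z \<omega>)) -` A \<inter> space M |A. A \<in> sets borel} \<subseteq> sets (vimage_algebra (space M) Z K)"
    proof clarify
      fix A :: "complex set" assume A: "A \<in> sets borel"
      have "(\<lambda>\<omega>. h (Z \<omega>)) -` A \<inter> space M = Z -` (h -` A \<inter> space K) \<inter> space M"
        using measurable_space[OF Z] by auto
      then show "(\<lambda>\<omega>. h (Z \<omega>)) -` A \<inter> space M \<in> sets (vimage_algebra (space M) Z K)"
        using in_vimage_algebra[OF measurable_sets[OF h A], of Z "space M"] by simp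
    qed
    then have "sigma_sets (space M) {(\<lambda>\<omega>. h (Z \<omega>)) -` A \<inter> space M |A. A \<in> sets borel}
        \<subseteq> sets (vimage_algebra (space M) Z K)"
      using sets.sigma_sets_subset[of _ "vimage_algebra (space M) Z K"] by simp
    also have "\<dots> = {Z -` A \<inter> space M | A. A \<in> sets K}"
      using measurable_space[OF Z] by (intro sets_vimage_algebra2) auto
    finally show ?thesis .
  qed
  show "indep_var borel (\<lambda>\<omega>. f (X \<omega>)) borel (\<lambda>\<omega>. g (Y \<omega>))"
    unfolding indep_var_eq
  proof (intro conjI fX gY)
    show "indep_set (sigma_sets (space M) {(\<lambda>\<omega>. f (X \<omega>)) -` A \<inter> space M |A. A \<in> sets borel})
       (sigma_sets (space M) {(\<lambda>\<omega>. g (Y \<omega>)) -` A \<inter> space M |A. A \<in> sets borel})"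
      unfolding indep_set_def using pull[OF X f] pull[OF Y g]
      by (intro indep_sets_mono_sets[OF XY[unfolded indep_set_def]]) (auto split: bool.split)
  qed
qed

text \<open>The squared sum expands into pairs. Independence splits off the expectation of the two
  weights, which vanishes for pairs that are not \<open>good\<close> and has modulus at most
  \<open>1\<close> otherwise. The mixed moment of the coefficients is brought back to
  \<open>K\<close> by the inequality of geometric and arithmetic mean, so no decorrelation of the
  coefficients enters.\<close>

lemma second_moment_bound:
  fixes B :: "'z \<Rightarrow> 'b \<Rightarrow> real" and a :: "'z \<Rightarrow> 'c \<Rightarrow> complex"
  assumes ind: "indep_of N X L Y" and Z: "finite Z"
    and B[measurable]: "\<And>z. z \<in> Z \<Longrightarrow> B z \<in> borel_measurable N"
    and a[measurable]: "\<And>z. z \<in> Z \<Longrightarrow> a z \<in> borel_measurable L"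
    and B1: "\<And>z \<omega>. z \<in> Z \<Longrightarrow> \<omega> \<in> space M \<Longrightarrow> \<bar>B z (X \<omega>)\<bar> \<le> 1"
    and a1: "\<And>z \<omega>. z \<in> Z \<Longrightarrow> \<omega> \<in> space M \<Longrightarrow> norm (a z (Y \<omega>)) \<le> 1"
    and K: "\<And>z. z \<in> Z \<Longrightarrow> expectation (\<lambda>\<omega>. (norm (a z (Y \<omega>)))\<^sup>2) \<le> K"
    and bad: "\<And>z z'. z \<in> Z \<Longrightarrow> z' \<in> Z \<Longrightarrow> \<not> good z z' \<Longrightarrow>
       expectation (\<lambda>\<omega>. B z (X \<omega>) * B z' (X \<omega>)) = 0"
  shows "integrable M (\<lambda>\<omega>. (norm (\<Sum>z\<in>Z. of_real (B z (X \<omega>)) * a z (Y \<omega>)))\<^sup>2) \<and>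
    expectation (\<lambda>\<omega>. (norm (\<Sum>z\<in>Z. of_real (B z (X \<omega>)) * a z (Y \<omega>)))\<^sup>2)
     \<le> real (card {(z, z') \<in> Z \<times> Z. good z z'}) * K"
proof -
  let ?S = "\<lambda>\<omega>. (norm (\<Sum>z\<in>Z. of_real (B z (X \<omega>)) * a z (Y \<omega>)))\<^sup>2"
  have X[measurable]: "X \<in> measurable M N" and Y[measurable]: "Y \<in> measurable M L"
    using ind by (auto simp: indep_of_def)
  let ?B = "\<lambda>z z' \<omega>. B z (X \<omega>) * B z' (X \<omega>)"
  let ?a = "\<lambda>z z' \<omega>. a z (Y \<omega>) * cnj (a z' (Y \<omega>))"
  have cnj_meas[measurable]: "cnj \<in> borel_measurable borel"
    by (intro borel_measurable_continuous_onI continuous_intros)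
  have Bint: "integrable M (\<lambda>\<omega>. complex_of_real (?B z z' \<omega>))" "integrable M (?B z z')"
    and aint: "integrable M (?a z z')" and nint: "integrable M (\<lambda>\<omega>. (norm (a z (Y \<omega>)))\<^sup>2)"
    and Ble: "\<bar>?B z z' \<omega>\<bar> \<le> 1" if "z \<in> Z" "z' \<in> Z" "\<omega> \<in> space M" for z z' \<omega>
  proof -
    note [measurable] = B[OF that(1)] B[OF that(2)] a[OF that(1)] a[OF that(2)]
    have Ble: "\<bar>?B z z' \<omega>\<bar> \<le> 1" if "\<omega> \<in> space M" for \<omega>
      using that \<open>z \<in> Z\<close> \<open>z' \<in> Z\<close> by (auto simp: abs_mult intro!: mult_le_one B1)
    then show "\<bar>?B z z' \<omega>\<bar> \<le> 1" using that by blast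
    show "integrable M (?B z z')" "integrable M (\<lambda>\<omega>. complex_of_real (?B z z' \<omega>))"
      by (rule integrable_const_bound[where B = 1], use Ble in \<open>auto simp: norm_mult abs_mult\<close>)+
    show "integrable M (?a z z')"
      by (rule integrable_const_bound[where B = 1])
        (auto simp: norm_mult that a1 intro!: mult_le_one AE_I2)
    show "integrable M (\<lambda>\<omega>. (norm (a z (Y \<omega>)))\<^sup>2)"
      by (rule integrable_const_bound[where B = 1])
        (auto simp: that a1 intro!: power_le_one AE_I2)
  qed
  have fac: "expectation (\<lambda>\<omega>. complex_of_real (?B z z' \<omega>) * ?a z z' \<omega>) =
     complex_of_real (expectation (?B z z')) * expectation (?a z z')" and
    pint: "integrable M (\<lambda>\<omega>. complex_of_real (?B z z' \<omega>) * ?a z z' \<omega>)"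
    if z: "z \<in> Z" "z' \<in> Z" for z z'
  proof -
    note [measurable] = B[OF that(1)] B[OF that(2)] a[OF that(1)] a[OF that(2)]
    \<comment> \<open>The integrability facts above are stated jointly with a pointwise bound, so
      they ask for a point of the sample space.\<close>
    obtain \<omega>0 where \<omega>0: "\<omega>0 \<in> space M" using not_empty by auto
    have "expectation (\<lambda>\<omega>. (\<lambda>x. complex_of_real (B z x * B z' x)) (X \<omega>) * (\<lambda>y. a z y * cnj (a z' y)) (Y \<omega>)) =
       expectation (\<lambda>\<omega>. (\<lambda>x. complex_of_real (B z x * B z' x)) (X \<omega>)) *
       expectation (\<lambda>\<omega>. (\<lambda>y. a z y * cnj (a z' y)) (Y \<omega>))"
      by (rule indep_of_expectation_mult[OF ind]) (use Bint aint z \<omega>0 in auto)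
    then show "expectation (\<lambda>\<omega>. complex_of_real (?B z z' \<omega>) * ?a z z' \<omega>) =
     complex_of_real (expectation (?B z z')) * expectation (?a z z')"
      by (simp del: of_real_mult)
    show "integrable M (\<lambda>\<omega>. complex_of_real (?B z z' \<omega>) * ?a z z' \<omega>)"
    proof (rule integrable_const_bound[where B = 1])
      have "norm (complex_of_real (?B z z' \<omega>) * ?a z z' \<omega>) \<le> 1" if "\<omega> \<in> space M" for \<omega>
      proof -
        have "\<bar>?B z z' \<omega>\<bar> * (norm (a z (Y \<omega>)) * norm (a z' (Y \<omega>))) \<le> 1"
          using Ble[OF z that] a1[OF z(1) that] a1[OF z(2) that] by (intro mult_le_one) auto
        then show ?thesis by (simp add: norm_mult abs_mult mult_ac)
      qed
      then show "AE \<omega> in M. norm (complex_of_real (?B z z' \<omega>) * ?a z z' \<omega>) \<le> 1" by auto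
    qed measurable
  qed
  have ale: "norm (expectation (?a z z')) \<le> K" if z: "z \<in> Z" "z' \<in> Z" for z z'
  proof -
    obtain \<omega>0 where \<omega>0: "\<omega>0 \<in> space M" using not_empty by auto
    have "norm (expectation (?a z z')) \<le> expectation (\<lambda>\<omega>. norm (?a z z' \<omega>))"
      by (rule integral_norm_bound)
    also have "\<dots> \<le> expectation (\<lambda>\<omega>. ((norm (a z (Y \<omega>)))\<^sup>2 + (norm (a z' (Y \<omega>)))\<^sup>2) / 2)"
    proof (rule integral_mono)
      fix \<omega> show "norm (?a z z' \<omega>) \<le> ((norm (a z (Y \<omega>)))\<^sup>2 + (norm (a z' (Y \<omega>)))\<^sup>2) / 2"
        using sum_squares_bound[of "norm (a z (Y \<omega>))" "norm (a z' (Y \<omega>))"] by (simp add: norm_mult)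
    qed (use aint nint z \<omega>0 in auto)
    also have "\<dots> = (expectation (\<lambda>\<omega>. (norm (a z (Y \<omega>)))\<^sup>2) + expectation (\<lambda>\<omega>. (norm (a z' (Y \<omega>)))\<^sup>2)) / 2"
      using nint z \<omega>0 by simp
    also have "\<dots> \<le> K" using K[OF z(1)] K[OF z(2)] by simp
    finally show ?thesis .
  qed
  have Ele: "\<bar>expectation (?B z z')\<bar> \<le> 1" if z: "z \<in> Z" "z' \<in> Z" for z z'
  proof -
    obtain \<omega>0 where \<omega>0: "\<omega>0 \<in> space M" using not_empty by auto
    have "\<bar>expectation (?B z z')\<bar> \<le> expectation (\<lambda>\<omega>. \<bar>?B z z' \<omega>\<bar>)"
      using integral_norm_bound[of M "?B z z'"] by simp
    also have "\<dots> \<le> expectation (\<lambda>\<omega>. 1)"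
      using Ble Bint z \<omega>0 by (intro integral_mono) auto
    finally show ?thesis by (simp add: prob_space)
  qed
  have sq: "complex_of_real (?S \<omega>) =
    (\<Sum>(z, z')\<in>Z \<times> Z. complex_of_real (?B z z' \<omega>) * ?a z z' \<omega>)" for \<omega>
    unfolding complex_norm_square
    by (simp add: sum_product sum.cartesian_product mult_ac)
  have "complex_integrable M (\<lambda>\<omega>. complex_of_real (?S \<omega>))"
    unfolding sq case_prod_beta by (intro Bochner_Integration.integrable_sum) (auto intro: pint simp del: of_real_mult)
  then have "integrable M ?S"
    unfolding complex_of_real_integrable_eq .
  note int = this
  have "complex_of_real (expectation ?S) =
    expectation (\<lambda>\<omega>. \<Sum>(z, z')\<in>Z \<times> Z. complex_of_real (?B z z' \<omega>) * ?a z z' \<omega>)"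
    unfolding sq[symmetric] by (rule integral_complex_of_real[symmetric])
  also have "\<dots> = (\<Sum>(z, z')\<in>Z \<times> Z. complex_of_real (expectation (?B z z')) * expectation (?a z z'))"
    unfolding case_prod_beta using pint
    by (subst Bochner_Integration.integral_sum)
      (auto intro!: sum.cong simp del: of_real_mult simp: fac)
  finally have "expectation ?S =
    Re (\<Sum>(z, z')\<in>Z \<times> Z. complex_of_real (expectation (?B z z')) * expectation (?a z z'))"
    by (metis Re_complex_of_real)
  also have "\<dots> \<le> (\<Sum>(z, z')\<in>Z \<times> Z. norm (complex_of_real (expectation (?B z z')) * expectation (?a z z')))"
    by (rule order_trans[OF complex_Re_le_cmod]) (simp add: case_prod_beta sum_norm_le)
  also have "\<dots> \<le> (\<Sum>(z, z')\<in>Z \<times> Z. if good z z' then K else 0)"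
  proof (intro sum_mono, clarify)
    fix z z' assume z: "z \<in> Z" "z' \<in> Z"
    have "\<bar>expectation (?B z z')\<bar> * norm (expectation (?a z z')) \<le> 1 * K"
      using Ele[OF z] ale[OF z] by (intro mult_mono) auto
    then show "norm (complex_of_real (expectation (?B z z')) * expectation (?a z z')) \<le> (if good z z' then K else 0)"
      using bad[OF z] by (auto simp: norm_mult)
  qed
  also have "\<dots> = real (card ((Z \<times> Z) \<inter> {p. good (fst p) (snd p)})) * K"
    using Z by (simp add: case_prod_beta sum.If_cases)
  also have "(Z \<times> Z) \<inter> {p. good (fst p) (snd p)} = {(z, z') \<in> Z \<times> Z. good z z'}" by auto
  finally show ?thesis using int by blast
qed

end

section \<open>Unitary matrices and the measurability of their entries\<close>

lemma mat_adjoint_dim [simp]: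
  "dim_row (mat_adjoint A) = dim_col A" "dim_col (mat_adjoint A) = dim_row A"
  by (simp_all add: mat_adjoint_def)

lemma mat_adjoint_carrier [simp]: "A \<in> carrier_mat n m \<Longrightarrow> mat_adjoint A \<in> carrier_mat m n"
  by (metis carrier_matD carrier_matI mat_adjoint_dim)

lemma mat_adjoint_index [simp]:
  "i < dim_col A \<Longrightarrow> j < dim_row A \<Longrightarrow> mat_adjoint A $$ (i, j) = conjugate (A $$ (j, i))"
  by (simp add: mat_adjoint_def mat_of_rows_index)

lemma index_mult_mat_sum:
  assumes "A \<in> carrier_mat n m" "B \<in> carrier_mat m l" "i < n" "j < l"
  shows "(A * B) $$ (i, j) = (\<Sum>k<m. A $$ (i, k) * B $$ (k, j))"
  using assms by (simp add: scalar_prod_def atLeast0LessThan)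

lemma unitary_group_carrier: "A \<in> unitary_group n \<Longrightarrow> A \<in> carrier_mat n n"
  by (simp add: unitary_group_def)

lemma unitary_group_row:
  assumes "A \<in> unitary_group n" "i < n" "i' < n"
  shows "(\<Sum>j<n. A $$ (i, j) * cnj (A $$ (i', j))) = (if i = i' then 1 else 0)"
proof -
  have A: "A \<in> carrier_mat n n" "A * mat_adjoint A = 1\<^sub>m n"
    using assms by (auto simp: unitary_group_def)
  have "(\<Sum>j<n. A $$ (i, j) * cnj (A $$ (i', j))) = (A * mat_adjoint A) $$ (i, i')"
    using A assms index_mult_mat_sum[OF A(1) mat_adjoint_carrier[OF A(1)], of i i'] by simp
  then show ?thesis using A assms by simp
qed

lemma unitary_group_col:
  assumes "A \<in> unitary_group n" "j < n" "j' < n"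
  shows "(\<Sum>i<n. cnj (A $$ (i, j)) * A $$ (i, j')) = (if j = j' then 1 else 0)"
proof -
  have A: "A \<in> carrier_mat n n" "mat_adjoint A * A = 1\<^sub>m n"
    using assms by (auto simp: unitary_group_def)
  have "(\<Sum>i<n. cnj (A $$ (i, j)) * A $$ (i, j')) = (mat_adjoint A * A) $$ (j, j')"
    using A assms index_mult_mat_sum[OF mat_adjoint_carrier[OF A(1)] A(1), of j j'] by simp
  then show ?thesis using A assms by simp
qed

lemma unitary_group_col_norm:
  assumes "A \<in> unitary_group n" "j < n"
  shows "(\<Sum>i<n. (norm (A $$ (i, j)))\<^sup>2) = 1"
proof -
  have "complex_of_real (\<Sum>i<n. (norm (A $$ (i, j)))\<^sup>2) = (\<Sum>i<n. A $$ (i, j) * cnj (A $$ (i, j)))"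
    by (simp only: of_real_sum complex_norm_square)
  also have "\<dots> = 1"
    using unitary_group_col[OF assms(1,2,2)] by (simp add: mult.commute)
  finally have "complex_of_real (\<Sum>i<n. (norm (A $$ (i, j)))\<^sup>2) = 1" .
  then show ?thesis by (metis of_real_eq_1_iff)
qed

lemma unitary_group_norm_le_1:
  assumes "A \<in> unitary_group n" "i < n" "j < n"
  shows "norm (A $$ (i, j)) \<le> 1"
proof -
  have "(norm (A $$ (i, j)))\<^sup>2 \<le> (\<Sum>i<n. (norm (A $$ (i, j)))\<^sup>2)"
    using assms by (intro member_le_sum) auto
  then have "(norm (A $$ (i, j)))\<^sup>2 \<le> 1" using unitary_group_col_norm[OF assms(1,3)] by simp
  then show ?thesis by (simp add: power_le_one_iff)
qed

lemma space_unitary_space [simp]: "space (unitary_space n) = unitary_group n"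
  by (simp add: unitary_space_def)

lemma measurable_unitary_entry [measurable]:
  assumes "i < n" "j < n"
  shows "(\<lambda>A. A $$ (i, j)) \<in> borel_measurable (unitary_space n)"
proof -
  let ?g = "\<lambda>A. \<lambda>(i, j) \<in> {..<n} \<times> {..<n}. A $$ (i, j)"
  have "?g \<in> measurable (unitary_space n) (Pi\<^sub>M ({..<n} \<times> {..<n}) (\<lambda>_. borel :: complex measure))"
    unfolding unitary_space_def by (rule measurable_vimage_algebra1) (auto simp: space_PiM)
  moreover have "(\<lambda>f. f (i, j)) \<in> borel_measurable (Pi\<^sub>M ({..<n} \<times> {..<n}) (\<lambda>_. borel :: complex measure))"
    using assms by (intro measurable_component_singleton) auto
  ultimately have "(\<lambda>A. ?g A (i, j)) \<in> borel_measurable (unitary_space n)"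
    by (rule measurable_compose)
  then show ?thesis using assms by simp
qed

text \<open>Every factor is at most the largest one, whose power is a term of the sum. This is the
  substitute for Hoelder's inequality that reduces mixed moments of entries to moments of single
  entries.\<close>

lemma prod_le_sum_power:
  fixes x :: "'i \<Rightarrow> real"
  assumes "finite E" "E \<noteq> {}" "\<And>e. e \<in> E \<Longrightarrow> 0 \<le> x e"
  shows "(\<Prod>e\<in>E. x e) \<le> (\<Sum>e\<in>E. x e ^ card E)"
proof -
  obtain m where m: "m \<in> E" "\<And>e. e \<in> E \<Longrightarrow> x e \<le> x m"
    using obtains_MAX[OF assms(1,2), of x] assms(1) by (metis Max_ge finite_imageI imageI)
  have "(\<Prod>e\<in>E. x e) \<le> (\<Prod>e\<in>E. x m)" using assms m by (intro prod_mono) auto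
  also have "\<dots> = x m ^ card E" by simp
  also have "\<dots> \<le> (\<Sum>e\<in>E. x e ^ card E)"
    using assms m by (intro member_le_sum[of m E "\<lambda>e. x e ^ card E"]) auto
  finally show ?thesis .
qed

text \<open>The walk \<open>w 0, t 0, w 1, t 1, \<dots>, w (k - 1), t (k - 1)\<close> is closed up by returning to \<open>w 0\<close>.\<close>

definition cyc_next :: "nat \<Rightarrow> (nat \<Rightarrow> nat) \<Rightarrow> nat \<Rightarrow> nat" where
  "cyc_next k w r = (w(k := w 0)) (Suc r)"

definition walk_coef :: "nat \<Rightarrow> complex mat \<Rightarrow> (nat \<Rightarrow> nat) \<Rightarrow> (nat \<Rightarrow> nat) \<Rightarrow> complex" where
  "walk_coef k A w t = (\<Prod>r<k. A $$ (w r, t r) * cnj (A $$ (cyc_next k w r, t r)))"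

definition walk_weight ::
  "nat \<Rightarrow> real \<Rightarrow> real \<Rightarrow> nat set \<Rightarrow> nat set \<Rightarrow> (nat \<Rightarrow> nat) \<Rightarrow> (nat \<Rightarrow> nat) \<Rightarrow> real" where
  "walk_weight k a b S T w t = (\<Prod>r<k. indicator S (w r) - a) * (\<Prod>r<k. indicator T (t r) - b)"

definition walk_sum ::
  "nat \<Rightarrow> nat \<Rightarrow> real \<Rightarrow> real \<Rightarrow> complex mat \<Rightarrow> nat set \<Rightarrow> nat set \<Rightarrow> complex" where
  "walk_sum n k a b A S T =
     (\<Sum>(w, t)\<in>({..<k} \<rightarrow>\<^sub>E {..<n}) \<times> ({..<k} \<rightarrow>\<^sub>E {..<n}). of_real (walk_weight k a b S T w t) * walk_coef k A w t)"

lemma cyc_next_less: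
  assumes "w \<in> {..<k} \<rightarrow>\<^sub>E {..<n}" "r < k" shows "cyc_next k w r < n"
proof (cases "Suc r = k")
  case True then show ?thesis using PiE_mem[OF assms(1), of 0] assms(2) by (simp add: cyc_next_def)
next
  case False
  then have "Suc r < k" using assms by simp
  then show ?thesis using PiE_mem[OF assms(1), of "Suc r"] False by (simp add: cyc_next_def)
qed

text \<open>\<open>walk_coef\<close> is a product of \<open>2 * k\<close> entries, so its square has
  degree \<open>4 * k\<close>. Entries of a Haar matrix are dependent; the domination by powers of
  single entries of the same degree avoids all joint moments.\<close>

lemma norm_walk_coef_square_le:
  assumes "k \<ge> 1"
  shows "(norm (walk_coef k A w t))\<^sup>2 \<le>
    (\<Sum>r<k. norm (A $$ (w r, t r)) ^ (4 * k)) + (\<Sum>r<k. norm (A $$ (cyc_next k w r, t r)) ^ (4 * k))"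
proof -
  let ?x = "\<lambda>r. (norm (A $$ (w r, t r)))\<^sup>2" and ?y = "\<lambda>r. (norm (A $$ (cyc_next k w r, t r)))\<^sup>2"
  have le: "(\<Prod>r<k. z r)\<^sup>2 \<le> (\<Sum>r<k. z r ^ (2 * k))" if "\<And>r. 0 \<le> z r" for z :: "nat \<Rightarrow> real"
  proof -
    have "(\<Prod>r<k. z r)\<^sup>2 = (\<Prod>r<k. (z r)\<^sup>2)" by (simp add: prod_power_distrib)
    also have "\<dots> \<le> (\<Sum>r<k. (z r)\<^sup>2 ^ card {..<k})"
      using assms by (intro prod_le_sum_power) (auto simp: lessThan_empty_iff)
    finally show ?thesis by (simp add: power_mult)
  qed
  have four: "u ^ (4 * k) = (u\<^sup>2) ^ (2 * k)" for u :: real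
    by (simp flip: power_mult)
  have "(norm (walk_coef k A w t))\<^sup>2 = (\<Prod>r<k. ?x r) * (\<Prod>r<k. ?y r)"
    by (simp add: walk_coef_def norm_mult power_mult_distrib prod.distrib flip: prod_norm prod_power_distrib)
  also have "\<dots> \<le> (\<Prod>r<k. ?x r)\<^sup>2 + (\<Prod>r<k. ?y r)\<^sup>2"
    using sum_squares_bound[of "\<Prod>r<k. ?x r" "\<Prod>r<k. ?y r"]
      zero_le_power2[of "\<Prod>r<k. ?x r"] zero_le_power2[of "\<Prod>r<k. ?y r"]
      mult_nonneg_nonneg[OF prod_nonneg prod_nonneg, of "{..<k}" ?x "{..<k}" ?y]
    by simp
  also have "\<dots> \<le> (\<Sum>r<k. ?x r ^ (2 * k)) + (\<Sum>r<k. ?y r ^ (2 * k))"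
    by (intro add_mono le) auto
  finally show ?thesis unfolding four .
qed

lemma norm_walk_coef_le_1:
  assumes "A \<in> unitary_group n" "w \<in> {..<k} \<rightarrow>\<^sub>E {..<n}" "t \<in> {..<k} \<rightarrow>\<^sub>E {..<n}"
  shows "norm (walk_coef k A w t) \<le> 1"
proof -
  have "norm (A $$ (w r, t r) * cnj (A $$ (cyc_next k w r, t r))) \<le> 1" if "r < k" for r
    unfolding norm_mult using assms that cyc_next_less[OF assms(2) that]
    by (intro mult_le_one) (auto intro!: unitary_group_norm_le_1)
  then show ?thesis
    unfolding walk_coef_def prod_norm[symmetric] by (intro prod_le_1 conjI norm_ge_zero) blast
qed

lemma abs_walk_weight_le_1:
  assumes "0 \<le> a" "a \<le> 1" "0 \<le> b" "b \<le> 1"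
  shows "\<bar>walk_weight k a b S T w t\<bar> \<le> 1"
  unfolding walk_weight_def abs_mult abs_prod
  using assms by (intro mult_le_one prod_le_1 prod_nonneg) (auto simp: indicator_def)

text \<open>Row and column indices live in different summands, so the partner of a row position is
  again a row position, and likewise for columns.\<close>

lemma no_singleton_fibre_PlusD:
  assumes "no_singleton_fibre (X <+> Y) (case_sum (Inl \<circ> f) (Inr \<circ> g))"
  shows "no_singleton_fibre X f" "no_singleton_fibre Y g"
proof -
  have *: "\<exists>y\<in>X <+> Y. y \<noteq> x \<and> case_sum (Inl \<circ> f) (Inr \<circ> g) y = case_sum (Inl \<circ> f) (Inr \<circ> g) x"
    if "x \<in> X <+> Y" for x using assms that by (simp add: no_singleton_fibre_def)
  show "no_singleton_fibre X f"
    unfolding no_singleton_fibre_def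
  proof
    fix x assume "x \<in> X"
    then obtain z where z: "z \<in> X <+> Y" "z \<noteq> Inl x"
      "case_sum (Inl \<circ> f) (Inr \<circ> g) z = case_sum (Inl \<circ> f) (Inr \<circ> g) (Inl x)"
      using *[of "Inl x"] by blast
    then show "\<exists>y\<in>X. y \<noteq> x \<and> f y = f x" by (cases z) auto
  qed
  show "no_singleton_fibre Y g"
    unfolding no_singleton_fibre_def
  proof
    fix x assume "x \<in> Y"
    then obtain z where z: "z \<in> X <+> Y" "z \<noteq> Inr x"
      "case_sum (Inl \<circ> f) (Inr \<circ> g) z = case_sum (Inl \<circ> f) (Inr \<circ> g) (Inr x)"
      using *[of "Inr x"] by blast
    then show "\<exists>y\<in>Y. y \<noteq> x \<and> g y = g x" by (cases z) auto
  qed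
qed

text \<open>Glued along the sum type, the two row sequences form one map on \<open>2 * k\<close>
  positions, and so do the two column sequences. Each map is counted by
  \<open>card_no_singleton_fibre\<close>, hence the square.\<close>

lemma card_good_walk_pairs:
  fixes n k :: nat
  defines "W \<equiv> {..<k} \<rightarrow>\<^sub>E {..<n}"
  shows "card {((w, t), (w', t')) \<in> (W \<times> W) \<times> (W \<times> W).
     no_singleton_fibre ({..<k} <+> {..<k}) (case_sum w w') \<and>
     no_singleton_fibre ({..<k} <+> {..<k}) (case_sum t t')} \<le> (n ^ k * k ^ (2 * k))\<^sup>2"
    (is "card ?P \<le> _")
proof -
  let ?X = "{..<k} <+> {..<k}"
  let ?F = "{f \<in> ?X \<rightarrow>\<^sub>E {..<n}. no_singleton_fibre ?X f}"
  let ?e = "\<lambda>((w, t), (w', t')). (case_sum w w' :: nat + nat \<Rightarrow> nat, case_sum t t' :: nat + nat \<Rightarrow> nat)"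
  have "card ?P \<le> card (?F \<times> ?F)"
  proof (rule card_inj_on_le)
    show "inj_on ?e ?P"
    proof (rule inj_onI)
      fix p q assume e: "?e p = ?e q"
      obtain w t w' t' where p: "p = ((w, t), (w', t'))" by (metis prod.exhaust)
      obtain v s v' s' where q: "q = ((v, s), (v', s'))" by (metis prod.exhaust)
      have "(case_sum w w' :: nat + nat \<Rightarrow> nat) = case_sum v v'" "(case_sum t t' :: nat + nat \<Rightarrow> nat) = case_sum s s'"
        using e by (simp_all add: p q)
      then have "w = v" "w' = v'" "t = s" "t' = s'"
        by (metis case_sum_o_inj)+
      then show "p = q" by (simp add: p q)
    qed
    have "case_sum u u' \<in> ?X \<rightarrow>\<^sub>E {..<n}" if "u \<in> W" "u' \<in> W" for u u'
      using that unfolding W_def by (auto simp: PiE_iff extensional_def split: sum.splits)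
    then show "?e ` ?P \<subseteq> ?F \<times> ?F" by auto
    have "finite ?F" by (rule finite_subset[of _ "?X \<rightarrow>\<^sub>E {..<n}"]) (auto intro!: finite_PiE)
    then show "finite (?F \<times> ?F)" by simp
  qed
  also have "\<dots> = (card ?F)\<^sup>2" by (simp add: card_cartesian_product power2_eq_square)
  also have "card ?F \<le> n ^ k * k ^ (2 * k)"
    by (rule card_no_singleton_fibre) (auto simp: card_Plus)
  finally show ?thesis by (simp add: power_mono)
qed

context prob_space
begin

text \<open>The four products of centred indicators merge into a single one over
  \<open>4 * k\<close> positions, mapped by \<open>f\<close> into the index set of the joint family
  of events. A lonely row or column position is then a singleton fibre of \<open>f\<close>.\<close>

lemma expectation_walk_weight_mult_eq_0:
  assumes ris: "random_index_sets n a b \<Omega> T"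
    and w: "w \<in> {..<k} \<rightarrow>\<^sub>E {..<n}" "w' \<in> {..<k} \<rightarrow>\<^sub>E {..<n}" "t \<in> {..<k} \<rightarrow>\<^sub>E {..<n}" "t' \<in> {..<k} \<rightarrow>\<^sub>E {..<n}"
    and bad: "\<not> (no_singleton_fibre ({..<k} <+> {..<k}) (case_sum w w') \<and>
       no_singleton_fibre ({..<k} <+> {..<k}) (case_sum t t'))"
  shows "expectation (\<lambda>\<omega>. walk_weight k a b (\<Omega> \<omega>) (T \<omega>) w t * walk_weight k a b (\<Omega> \<omega>) (T \<omega>) w' t') = 0"
proof -
  let ?A = "case_sum (\<lambda>i. {\<omega> \<in> space M. i \<in> \<Omega> \<omega>}) (\<lambda>i. {\<omega> \<in> space M. i \<in> T \<omega>})"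
  let ?X = "({..<k} <+> {..<k}) :: (nat + nat) set"
  define f where "f = case_sum (Inl \<circ> case_sum w w') (Inr \<circ> case_sum t t')"
  have ind: "indep_events ?A ({..<n} <+> {..<n})"
    and P: "\<And>i. i < n \<Longrightarrow> prob {\<omega> \<in> space M. i \<in> \<Omega> \<omega>} = a" "\<And>i. i < n \<Longrightarrow> prob {\<omega> \<in> space M. i \<in> T \<omega>} = b"
    using ris by (auto simp: random_index_sets_def)
  have wn: "w r < n" "w' r < n" "t r < n" "t' r < n" if "r < k" for r
    using w that by (auto simp: PiE_iff)
  have "\<not> no_singleton_fibre (?X <+> ?X) f"
    using bad no_singleton_fibre_PlusD[of ?X ?X "case_sum w w'" "case_sum t t'"] by (auto simp: f_def)
  moreover have "f \<in> (?X <+> ?X) \<rightarrow> {..<n} <+> {..<n}"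
    using wn by (auto simp: f_def)
  ultimately have 0: "expectation (\<lambda>\<omega>. \<Prod>x\<in>?X <+> ?X. indicator (?A (f x)) \<omega> - prob (?A (f x))) = 0"
    by (intro expectation_prod_centred_indicator_eq_0[OF _ ind]) auto
  have "walk_weight k a b (\<Omega> \<omega>) (T \<omega>) w t * walk_weight k a b (\<Omega> \<omega>) (T \<omega>) w' t' =
    (\<Prod>x\<in>?X <+> ?X. indicator (?A (f x)) \<omega> - prob (?A (f x)))" if "\<omega> \<in> space M" for \<omega>
  proof -
    have "(\<Prod>x\<in>?X <+> ?X. indicator (?A (f x)) \<omega> - prob (?A (f x))) =
      ((\<Prod>r<k. indicator {\<omega> \<in> space M. w r \<in> \<Omega> \<omega>} \<omega> - prob {\<omega> \<in> space M. w r \<in> \<Omega> \<omega>}) *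
       (\<Prod>r<k. indicator {\<omega> \<in> space M. w' r \<in> \<Omega> \<omega>} \<omega> - prob {\<omega> \<in> space M. w' r \<in> \<Omega> \<omega>})) *
      ((\<Prod>r<k. indicator {\<omega> \<in> space M. t r \<in> T \<omega>} \<omega> - prob {\<omega> \<in> space M. t r \<in> T \<omega>}) *
       (\<Prod>r<k. indicator {\<omega> \<in> space M. t' r \<in> T \<omega>} \<omega> - prob {\<omega> \<in> space M. t' r \<in> T \<omega>}))"
      by (simp add: prod.Plus f_def)
    also have "\<dots> = ((\<Prod>r<k. indicator (\<Omega> \<omega>) (w r) - a) * (\<Prod>r<k. indicator (\<Omega> \<omega>) (w' r) - a)) *
      ((\<Prod>r<k. indicator (T \<omega>) (t r) - b) * (\<Prod>r<k. indicator (T \<omega>) (t' r) - b))"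
      using that wn by (intro arg_cong2[where f = "(*)"] prod.cong) (auto simp: P indicator_def)
    finally show ?thesis by (simp add: walk_weight_def mult_ac)
  qed
  then show ?thesis using 0 by (simp cong: Bochner_Integration.integral_cong)
qed

text \<open>The powers of \<open>n\<close> cancel exactly: the count of surviving pairs is of order
  \<open>n ^ (2 * k)\<close>, and the moment bound for the \<open>4 * k\<close> entries contributes
  the inverse of this.\<close>

theorem walk_sum_second_moment:
  assumes k: "k \<ge> 1" and n: "n \<ge> 1" and ab: "0 \<le> a" "a \<le> 1" "0 \<le> b" "b \<le> 1"
    and ris: "random_index_sets n a b \<Omega> T"
    and ind: "indep_of (count_space (Pow {..<n} \<times> Pow {..<n})) (\<lambda>\<omega>. (\<Omega> \<omega>, T \<omega>)) (unitary_space n) U"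
    and C: "\<And>i j. i < n \<Longrightarrow> j < n \<Longrightarrow> expectation (\<lambda>\<omega>. norm (U \<omega> $$ (i, j)) ^ (4 * k)) \<le> C / real n ^ (2 * k)"
  shows "integrable M (\<lambda>\<omega>. (norm (walk_sum n k a b (U \<omega>) (\<Omega> \<omega>) (T \<omega>)))\<^sup>2)" (is ?int)
    and "expectation (\<lambda>\<omega>. (norm (walk_sum n k a b (U \<omega>) (\<Omega> \<omega>) (T \<omega>)))\<^sup>2) \<le> real k ^ (4 * k) * (2 * real k * C)" (is ?bound)
proof -
  let ?W = "{..<k} \<rightarrow>\<^sub>E {..<n}"
  let ?N = "count_space (Pow {..<n} \<times> Pow {..<n})"
  let ?good = "\<lambda>(w, t) (w', t'). no_singleton_fibre ({..<k} <+> {..<k}) (case_sum w w') \<and>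
     no_singleton_fibre ({..<k} <+> {..<k}) (case_sum t t')"
  define B where "B = (\<lambda>(w, t) (S, T). walk_weight k a b S T w t)"
  define c where "c = (\<lambda>(w, t) A. walk_coef k A w t)"
  have U[measurable]: "U \<in> measurable M (unitary_space n)" using ind by (simp add: indep_of_def)
  have U': "U \<omega> \<in> unitary_group n" if "\<omega> \<in> space M" for \<omega> using measurable_space[OF U that] by simp
  have fin: "finite (?W \<times> ?W)" by (auto intro!: finite_PiE)
  have meas: "c z \<in> borel_measurable (unitary_space n)" if "z \<in> ?W \<times> ?W" for z
  proof -
    obtain w t where z: "z = (w, t)" by (cases z)
    have w: "w \<in> ?W" and t: "t \<in> ?W" using that unfolding z mem_Sigma_iff by blast+
    have cnj: "cnj \<in> borel_measurable borel"
      by (intro borel_measurable_continuous_onI continuous_intros)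
    have lt: "w r < n" "t r < n" "cyc_next k w r < n" if "r < k" for r
      using w t that cyc_next_less[OF w that] by (auto simp: PiE_iff)
    have "(\<lambda>A. A $$ (w r, t r) * cnj (A $$ (cyc_next k w r, t r))) \<in> borel_measurable (unitary_space n)"
      if "r \<in> {..<k}" for r
      using that by (intro borel_measurable_times measurable_unitary_entry lt
          measurable_compose[OF measurable_unitary_entry[OF lt(3,2)] cnj]) auto
    then show ?thesis unfolding z c_def walk_coef_def prod.case by (intro borel_measurable_prod) auto
  qed
  have int: "integrable M (\<lambda>\<omega>. norm (U \<omega> $$ (i, j)) ^ (4 * k))" if ij: "i < n" "j < n" for i j
  proof (rule integrable_const_bound[where B = 1])
    show "AE \<omega> in M. norm (norm (U \<omega> $$ (i, j)) ^ (4 * k)) \<le> 1"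
      using ij U' by (intro AE_I2) (auto intro!: power_le_one unitary_group_norm_le_1)
    show "(\<lambda>\<omega>. norm (U \<omega> $$ (i, j)) ^ (4 * k)) \<in> borel_measurable M"
      using measurable_compose[OF U measurable_unitary_entry[OF ij]] by measurable
  qed
  have "integrable M (\<lambda>\<omega>. (norm (\<Sum>z\<in>?W \<times> ?W. of_real (B z (\<Omega> \<omega>, T \<omega>)) * c z (U \<omega>)))\<^sup>2) \<and>
    expectation (\<lambda>\<omega>. (norm (\<Sum>z\<in>?W \<times> ?W. of_real (B z (\<Omega> \<omega>, T \<omega>)) * c z (U \<omega>)))\<^sup>2)
     \<le> real (card {(z, z') \<in> (?W \<times> ?W) \<times> (?W \<times> ?W). ?good z z'}) * (2 * real k * C / real n ^ (2 * k))"
  proof (rule second_moment_bound[OF ind fin])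
    fix z assume z: "z \<in> ?W \<times> ?W"
    obtain w t where zwt: "z = (w, t)" by (cases z)
    have w: "w \<in> ?W" and t: "t \<in> ?W" using z unfolding zwt mem_Sigma_iff by blast+
    show "B z \<in> borel_measurable ?N" by simp
    show "c z \<in> borel_measurable (unitary_space n)" using meas[OF z] .
    show "\<bar>B z (\<Omega> \<omega>, T \<omega>)\<bar> \<le> 1" for \<omega>
      using ab by (simp add: B_def zwt abs_walk_weight_le_1)
    show "norm (c z (U \<omega>)) \<le> 1" if "\<omega> \<in> space M" for \<omega>
      using norm_walk_coef_le_1[OF U'[OF that] w t] by (simp add: c_def zwt)
    have lt: "w r < n" "t r < n" "cyc_next k w r < n" if "r < k" for r
      using w t that cyc_next_less[OF w that] by (auto simp: PiE_iff)
    have "expectation (\<lambda>\<omega>. (norm (c z (U \<omega>)))\<^sup>2) \<le>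
      expectation (\<lambda>\<omega>. (\<Sum>r<k. norm (U \<omega> $$ (w r, t r)) ^ (4 * k)) +
        (\<Sum>r<k. norm (U \<omega> $$ (cyc_next k w r, t r)) ^ (4 * k)))"
    proof (rule integral_mono)
      have "(\<lambda>\<omega>. c z (U \<omega>)) \<in> borel_measurable M" using measurable_compose[OF U meas[OF z]] .
      then show "integrable M (\<lambda>\<omega>. (norm (c z (U \<omega>)))\<^sup>2)"
        using norm_walk_coef_le_1[OF U' w t]
        by (intro integrable_const_bound[where B = 1]) (auto simp: c_def zwt intro!: power_le_one)
      show "integrable M (\<lambda>\<omega>. (\<Sum>r<k. norm (U \<omega> $$ (w r, t r)) ^ (4 * k)) +
        (\<Sum>r<k. norm (U \<omega> $$ (cyc_next k w r, t r)) ^ (4 * k)))"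
        using lt by (intro Bochner_Integration.integrable_add Bochner_Integration.integrable_sum int) auto
      show "(norm (c z (U \<omega>)))\<^sup>2 \<le> (\<Sum>r<k. norm (U \<omega> $$ (w r, t r)) ^ (4 * k)) +
        (\<Sum>r<k. norm (U \<omega> $$ (cyc_next k w r, t r)) ^ (4 * k))" for \<omega>
        using norm_walk_coef_square_le[OF k] by (simp add: c_def zwt)
    qed
    also have "\<dots> = (\<Sum>r<k. expectation (\<lambda>\<omega>. norm (U \<omega> $$ (w r, t r)) ^ (4 * k))) +
        (\<Sum>r<k. expectation (\<lambda>\<omega>. norm (U \<omega> $$ (cyc_next k w r, t r)) ^ (4 * k)))"
      by (subst Bochner_Integration.integral_add)
        (auto intro!: Bochner_Integration.integrable_sum Bochner_Integration.integral_sum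
          arg_cong2[where f = "(+)"] int lt)
    also have "\<dots> \<le> (\<Sum>r<k. C / real n ^ (2 * k)) + (\<Sum>r<k. C / real n ^ (2 * k))"
      using lt C by (intro add_mono sum_mono) auto
    also have "\<dots> = 2 * real k * C / real n ^ (2 * k)" by simp
    finally show "expectation (\<lambda>\<omega>. (norm (c z (U \<omega>)))\<^sup>2) \<le> 2 * real k * C / real n ^ (2 * k)" .
  next
    fix z z' assume z: "z \<in> ?W \<times> ?W" "z' \<in> ?W \<times> ?W" and "\<not> ?good z z'"
    then show "expectation (\<lambda>\<omega>. B z (\<Omega> \<omega>, T \<omega>) * B z' (\<Omega> \<omega>, T \<omega>)) = 0"
      using expectation_walk_weight_mult_eq_0[OF ris] by (cases z; cases z') (simp add: B_def)
  qed
  note * = this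
  from * show ?int by (simp add: walk_sum_def B_def c_def case_prod_beta)
  have "expectation (\<lambda>\<omega>. (norm (\<Sum>z\<in>?W \<times> ?W. of_real (B z (\<Omega> \<omega>, T \<omega>)) * c z (U \<omega>)))\<^sup>2)
     \<le> real (card {(z, z') \<in> (?W \<times> ?W) \<times> (?W \<times> ?W). ?good z z'}) * (2 * real k * C / real n ^ (2 * k))"
    using * by blast
  also have "\<dots> \<le> real ((n ^ k * k ^ (2 * k))\<^sup>2) * (2 * real k * C / real n ^ (2 * k))"
  proof (intro mult_right_mono)
    have "{(z, z') \<in> (?W \<times> ?W) \<times> (?W \<times> ?W). ?good z z'} = {((w, t), (w', t')) \<in> (?W \<times> ?W) \<times> (?W \<times> ?W).
     no_singleton_fibre ({..<k} <+> {..<k}) (case_sum w w') \<and>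
     no_singleton_fibre ({..<k} <+> {..<k}) (case_sum t t')}" by auto
    then show "real (card {(z, z') \<in> (?W \<times> ?W) \<times> (?W \<times> ?W). ?good z z'}) \<le> real ((n ^ k * k ^ (2 * k))\<^sup>2)"
      using card_good_walk_pairs[of k n] by (simp only: of_nat_le_iff)
    \<comment> \<open>The sign of \<open>C\<close> is read off from the moment bound at the entry
      \<open>(0, 0)\<close>, which exists because \<open>n \<ge> 1\<close>.\<close>
    have "0 \<le> expectation (\<lambda>\<omega>. norm (U \<omega> $$ (0, 0)) ^ (4 * k))" by simp
    also have "\<dots> \<le> C / real n ^ (2 * k)" using C n by simp
    finally have nonneg: "0 \<le> C / real n ^ (2 * k)" .
    have "0 < real n ^ (2 * k)" using n by simp
    then have "0 \<le> C" using nonneg divide_neg_pos[of C "real n ^ (2 * k)"] by linarith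
    then show "0 \<le> 2 * real k * C / real n ^ (2 * k)" by simp
  qed
  also have "\<dots> = real k ^ (4 * k) * (2 * real k * C)"
    using n by (simp add: power_mult_distrib field_simps flip: power_mult)
  finally show ?bound by (simp add: walk_sum_def B_def c_def case_prod_beta)
qed

text \<open>The second moment would give the rate \<open>1 / n\<close> for the squared mean
  deviation, which is not summable; the fourth gives \<open>n ^ 2 / n ^ 4\<close>. The constant is
  \<open>2 ^ (2 * 2)\<close> from the count of maps on four positions.\<close>

lemma fourth_moment_centred_sum:
  assumes ind: "indep_events A {..<n}"
  shows "expectation (\<lambda>\<omega>. (\<Sum>i<n. indicator (A i) \<omega> - prob (A i)) ^ 4) \<le> 16 * real n ^ 2"
proof -
  let ?W = "{..<4::nat} \<rightarrow>\<^sub>E {..<n}"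
  let ?g = "\<lambda>f \<omega>. \<Prod>r<4::nat. indicator (A (f r)) \<omega> - prob (A (f r))"
  have ev: "A i \<in> events" if "i < n" for i using ind that by (auto simp: indep_events_def)
  have fin: "finite ?W" by (auto intro!: finite_PiE)
  have g1: "\<bar>?g f \<omega>\<bar> \<le> 1" for f \<omega>
    unfolding abs_prod by (intro prod_le_1) (auto simp: indicator_def)
  have int: "integrable M (?g f)" if "f \<in> ?W" for f
  proof (rule integrable_const_bound[where B = 1])
    show "AE \<omega> in M. norm (?g f \<omega>) \<le> 1" using g1 by simp
    have [measurable]: "A (f r) \<in> events" if "r < 4" for r using \<open>f \<in> ?W\<close> that by (auto intro!: ev)
    show "?g f \<in> borel_measurable M" by (intro borel_measurable_prod) auto
  qed
  have "expectation (\<lambda>\<omega>. (\<Sum>i<n. indicator (A i) \<omega> - prob (A i)) ^ 4) = expectation (\<lambda>\<omega>. \<Sum>f\<in>?W. ?g f \<omega>)"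
  proof (rule Bochner_Integration.integral_cong[OF refl])
    fix \<omega>
    have "(\<Sum>i<n. indicator (A i) \<omega> - prob (A i)) ^ 4 = (\<Prod>r<(4::nat). \<Sum>i<n. indicator (A i) \<omega> - prob (A i))"
      by simp
    also have "\<dots> = (\<Sum>f\<in>?W. ?g f \<omega>)" by (rule prod_sum_PiE) auto
    finally show "(\<Sum>i<n. indicator (A i) \<omega> - prob (A i)) ^ 4 = (\<Sum>f\<in>?W. ?g f \<omega>)" .
  qed
  also have "\<dots> = (\<Sum>f\<in>?W. expectation (?g f))"
    using int by simp
  also have "\<dots> \<le> (\<Sum>f\<in>?W. if no_singleton_fibre {..<4} f then 1 else 0)"
  proof (rule sum_mono)
    fix f assume f: "f \<in> ?W"
    have "expectation (?g f) \<le> expectation (\<lambda>_. 1)"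
      by (rule integral_mono[OF int[OF f]]) (auto intro: order_trans[OF abs_ge_self g1])
    then show "expectation (?g f) \<le> (if no_singleton_fibre {..<4} f then 1 else 0)"
      using expectation_prod_centred_indicator_eq_0[OF _ ind, of "{..<4}" f] PiE_mem[OF f]
      by (cases "no_singleton_fibre {..<4} f") (simp_all add: prob_space Pi_iff)
  qed
  also have "\<dots> = real (card {f \<in> ?W. no_singleton_fibre {..<4} f})"
    using fin by (simp add: sum.If_cases Int_def)
  also have "\<dots> \<le> real (n ^ 2 * 2 ^ (2 * 2))"
    unfolding of_nat_le_iff by (rule card_no_singleton_fibre) auto
  finally show ?thesis by simp
qed

end

section \<open>Entries of DFT and Haar matrices\<close>

text \<open>A vector of signs is encoded by the set of its positive coordinates, so averages over
  random signs become sums over \<open>Pow {..<n}\<close>.\<close>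

definition rsign :: "nat set \<Rightarrow> nat \<Rightarrow> real" where
  "rsign S l = (if l \<in> S then 1 else -1)"

lemma rsign_mult_self [simp]: "rsign S l * rsign S l = 1" "(rsign S l)\<^sup>2 = 1"
  by (auto simp: rsign_def)

text \<open>The left-hand side is, up to the factorial, one term of the series of
  \<open>exp \<bar>x\<bar>\<close>. Adding both exponentials removes the absolute value and leaves
  moment generating functions, which factor over independent signs.\<close>

lemma power_le_fact_exp:
  fixes x :: real
  shows "x ^ (2 * m) \<le> fact (2 * m) * (exp x + exp (- x))"
proof -
  have "\<bar>x\<bar> ^ (2 * m) / fact (2 * m) \<le> exp \<bar>x\<bar>"
  proof -
    have s: "(\<lambda>n. \<bar>x\<bar> ^ n /\<^sub>R fact n) sums exp \<bar>x\<bar>" by (rule exp_converges)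
    have "(\<Sum>n\<in>{2 * m}. \<bar>x\<bar> ^ n /\<^sub>R fact n) \<le> (\<Sum>n. \<bar>x\<bar> ^ n /\<^sub>R fact n)"
      using s by (intro sum_le_suminf) (auto simp: sums_iff)
    then show ?thesis using s by (simp add: sums_iff divide_inverse mult.commute)
  qed
  also have "\<dots> \<le> exp x + exp (- x)" by (cases "x \<ge> 0") (simp_all add: abs_if)
  finally have "\<bar>x\<bar> ^ (2 * m) \<le> fact (2 * m) * (exp x + exp (- x))"
    by (simp add: divide_le_eq mult.commute)
  then show ?thesis by (simp add: power_mult)
qed

text \<open>A crude form of \<open>cosh x \<le> exp (x^2 / 2)\<close>, the subgaussian bound for a
  random sign: on \<open>[0, 1]\<close> one has \<open>exp x \<le> 1 + x + x^2\<close> and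
  \<open>exp (- x) \<le> 1 / (1 + x) \<le> 1 - x + x^2\<close>, and the linear terms cancel.\<close>

lemma exp_plus_exp_minus_le:
  fixes x :: real
  assumes "\<bar>x\<bar> \<le> 1"
  shows "exp x + exp (- x) \<le> 2 * exp (x\<^sup>2)"
proof -
  have *: "exp x + exp (- x) \<le> 2 * (1 + x\<^sup>2)" if "0 \<le> x" "x \<le> 1" for x :: real
  proof -
    have "exp (- x) = 1 / exp x" by (simp add: exp_minus divide_inverse)
    also have "\<dots> \<le> 1 / (1 + x)"
      using that exp_ge_add_one_self[of x] by (intro divide_left_mono mult_pos_pos) (auto simp del: exp_ge_add_one_self)
    also have "\<dots> \<le> 1 - x + x\<^sup>2"
    proof -
      have "1 \<le> (1 - x + x\<^sup>2) * (1 + x)"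
        using that by (simp add: algebra_simps power2_eq_square)
      then show ?thesis using that by (simp add: divide_le_eq)
    qed
    finally show ?thesis using exp_bound[OF that] by simp
  qed
  have "exp x + exp (- x) \<le> 2 * (1 + x\<^sup>2)"
    using *[of x] *[of "- x"] assms by (cases "x \<ge> 0") auto
  also have "\<dots> \<le> 2 * exp (x\<^sup>2)" by (rule mult_left_mono[OF exp_ge_add_one_self]) simp
  finally show ?thesis .
qed

text \<open>The sum over all signs factors over the coordinates, and the subgaussian bounds of the
  factors multiply to \<open>exp\<close> of the sum of squares. The \<open>3\<close> is an upper
  bound for \<open>exp 1\<close>.\<close>

lemma sum_rsign_exp:
  fixes a :: "nat \<Rightarrow> real"
  assumes "(\<Sum>l<n. (a l)\<^sup>2) \<le> 1"
  shows "(\<Sum>S\<in>Pow {..<n}. exp (\<Sum>l<n. rsign S l * a l)) \<le> 3 * 2 ^ n"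
proof -
  have "\<bar>a l\<bar> \<le> 1" if "l < n" for l
  proof -
    have "(a l)\<^sup>2 \<le> (\<Sum>l<n. (a l)\<^sup>2)" using that by (intro member_le_sum) auto
    then have "(a l)\<^sup>2 \<le> 1" using assms by simp
    then show ?thesis by (simp add: abs_square_le_1)
  qed
  note a1 = this
  have "(\<Sum>S\<in>Pow {..<n}. exp (\<Sum>l<n. rsign S l * a l)) =
    (\<Sum>S\<in>Pow {..<n}. (\<Prod>l\<in>S. exp (a l)) * (\<Prod>l\<in>{..<n} - S. exp (- a l)))"
  proof (rule sum.cong[OF refl])
    fix S assume S: "S \<in> Pow {..<n}"
    have "(\<Sum>l<n. rsign S l * a l) = (\<Sum>l\<in>{..<n} - S. rsign S l * a l) + (\<Sum>l\<in>S. rsign S l * a l)"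
      using S by (intro sum.subset_diff) auto
    also have "\<dots> = (\<Sum>l\<in>{..<n} - S. - a l) + (\<Sum>l\<in>S. a l)"
      by (intro arg_cong2[where f = "(+)"] sum.cong) (auto simp: rsign_def)
    finally show "exp (\<Sum>l<n. rsign S l * a l) = (\<Prod>l\<in>S. exp (a l)) * (\<Prod>l\<in>{..<n} - S. exp (- a l))"
      using S finite_subset[of S "{..<n}"] by (simp add: exp_add exp_sum del: sum_negf)
  qed
  also have "\<dots> = (\<Prod>l<n. exp (a l) + exp (- a l))" by (rule prod_add[symmetric]) auto
  also have "\<dots> \<le> (\<Prod>l<n. 2 * exp ((a l)\<^sup>2))"
    using a1 by (intro prod_mono) (auto intro!: exp_plus_exp_minus_le add_nonneg_nonneg)
  also have "\<dots> = 2 ^ n * exp (\<Sum>l<n. (a l)\<^sup>2)" by (simp add: prod.distrib exp_sum)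
  also have "\<dots> \<le> 2 ^ n * exp 1" using assms by simp
  also have "\<dots> \<le> 2 ^ n * 3" using exp_le by simp
  finally show ?thesis by simp
qed

text \<open>The exponential estimate is tied to coefficients of norm at most one, hence the
  rescaling by \<open>sqrt s\<close>. Each of the two exponentials in
  \<open>power_le_fact_exp\<close> costs \<open>3 * 2 ^ n\<close>, which gives the
  \<open>6\<close>.\<close>

lemma Khintchine_real:
  fixes a :: "nat \<Rightarrow> real"
  assumes s: "0 < s" "(\<Sum>l<n. (a l)\<^sup>2) \<le> s"
  shows "(\<Sum>S\<in>Pow {..<n}. (\<Sum>l<n. rsign S l * a l) ^ (2 * m)) \<le> 2 ^ n * (6 * fact (2 * m) * s ^ m)"
proof -
  define b where "b l = a l / sqrt s" for l
  have b1: "(\<Sum>l<n. (b l)\<^sup>2) \<le> 1" "(\<Sum>l<n. (- b l)\<^sup>2) \<le> 1"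
    using s by (simp_all add: b_def power_divide flip: sum_divide_distrib)
  have "(\<Sum>S\<in>Pow {..<n}. (\<Sum>l<n. rsign S l * b l) ^ (2 * m)) \<le>
    (\<Sum>S\<in>Pow {..<n}. fact (2 * m) * (exp (\<Sum>l<n. rsign S l * b l) + exp (\<Sum>l<n. rsign S l * - b l)))"
    by (intro sum_mono order_trans[OF power_le_fact_exp]) (simp add: sum_negf)
  also have "\<dots> = fact (2 * m) * ((\<Sum>S\<in>Pow {..<n}. exp (\<Sum>l<n. rsign S l * b l)) +
     (\<Sum>S\<in>Pow {..<n}. exp (\<Sum>l<n. rsign S l * - b l)))"
    by (simp only: sum_distrib_left sum.distrib distrib_left)
  also have "\<dots> \<le> fact (2 * m) * (3 * 2 ^ n + 3 * 2 ^ n)"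
    by (intro mult_left_mono add_mono sum_rsign_exp b1) simp
  finally have *: "(\<Sum>S\<in>Pow {..<n}. (\<Sum>l<n. rsign S l * b l) ^ (2 * m)) \<le> 6 * 2 ^ n * fact (2 * m)"
    by (simp add: mult.commute)
  have "(\<Sum>l<n. rsign S l * a l) ^ (2 * m) = s ^ m * (\<Sum>l<n. rsign S l * b l) ^ (2 * m)" for S
  proof -
    have "(\<Sum>l<n. rsign S l * a l) = sqrt s * (\<Sum>l<n. rsign S l * b l)"
      using s by (simp add: b_def sum_distrib_left)
    then show ?thesis using s by (simp add: power_mult_distrib power_mult)
  qed
  then have "(\<Sum>S\<in>Pow {..<n}. (\<Sum>l<n. rsign S l * a l) ^ (2 * m)) =
    s ^ m * (\<Sum>S\<in>Pow {..<n}. (\<Sum>l<n. rsign S l * b l) ^ (2 * m))"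
    by (simp add: sum_distrib_left)
  also have "\<dots> \<le> s ^ m * (6 * 2 ^ n * fact (2 * m))" using * s by (intro mult_left_mono) auto
  finally show ?thesis by (simp add: mult_ac)
qed

text \<open>\<open>2 ^ m\<close> bounds a power of \<open>norm z\<close> by powers of
  \<open>Re z\<close> and \<open>Im z\<close>, and \<open>12\<close> is twice the constant
  \<open>6\<close> of the real case.\<close>

definition khintchine_const :: "nat \<Rightarrow> real" where
  "khintchine_const m = 2 ^ m * (12 * fact (2 * m))"

lemma Khintchine_complex:
  fixes c :: "nat \<Rightarrow> complex"
  assumes s: "0 < s" "(\<Sum>l<n. (norm (c l))\<^sup>2) \<le> s"
  shows "(\<Sum>S\<in>Pow {..<n}. norm (\<Sum>l<n. of_real (rsign S l) * c l) ^ (2 * m)) \<le> 2 ^ n * (khintchine_const m * s ^ m)"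
proof -
  have le: "(\<Sum>l<n. (Re (c l))\<^sup>2) \<le> s" "(\<Sum>l<n. (Im (c l))\<^sup>2) \<le> s"
    by (rule order_trans[OF sum_mono s(2)], simp add: cmod_power2)+
  have z: "norm z ^ (2 * m) \<le> 2 ^ m * (Re z ^ (2 * m) + Im z ^ (2 * m))" for z :: complex
  proof -
    have "norm z ^ (2 * m) = ((Re z)\<^sup>2 + (Im z)\<^sup>2) ^ m" by (simp add: power_mult cmod_power2)
    also have "\<dots> \<le> (2 * max ((Re z)\<^sup>2) ((Im z)\<^sup>2)) ^ m" by (intro power_mono) auto
    also have "\<dots> = 2 ^ m * max ((Re z)\<^sup>2) ((Im z)\<^sup>2) ^ m" by (simp add: power_mult_distrib)
    also have "\<dots> \<le> 2 ^ m * (((Re z)\<^sup>2) ^ m + ((Im z)\<^sup>2) ^ m)"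
      by (intro mult_left_mono) (auto simp: max_def)
    finally show ?thesis by (simp add: power_mult)
  qed
  have "(\<Sum>S\<in>Pow {..<n}. norm (\<Sum>l<n. of_real (rsign S l) * c l) ^ (2 * m)) \<le>
    (\<Sum>S\<in>Pow {..<n}. 2 ^ m * ((\<Sum>l<n. rsign S l * Re (c l)) ^ (2 * m) + (\<Sum>l<n. rsign S l * Im (c l)) ^ (2 * m)))"
    by (intro sum_mono order_trans[OF z]) simp
  also have "\<dots> = 2 ^ m * ((\<Sum>S\<in>Pow {..<n}. (\<Sum>l<n. rsign S l * Re (c l)) ^ (2 * m)) +
    (\<Sum>S\<in>Pow {..<n}. (\<Sum>l<n. rsign S l * Im (c l)) ^ (2 * m)))"
    by (simp add: sum_distrib_left sum.distrib distrib_left)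
  also have "\<dots> \<le> 2 ^ m * (2 ^ n * (6 * fact (2 * m) * s ^ m) + 2 ^ n * (6 * fact (2 * m) * s ^ m))"
    by (intro mult_left_mono add_mono Khintchine_real s le) simp
  finally show ?thesis by (simp add: khintchine_const_def mult_ac)
qed

lemma dft_matrix_index:
  assumes "j < n" "k < n"
  shows "dft_matrix n $$ (j, k) = cis (- 2 * pi * real j * real k / real n) / sqrt (real n)"
  using assms by (simp add: dft_matrix_def cis_conv_exp mult_ac)

lemma norm_dft_matrix:
  assumes "j < n" "k < n"
  shows "norm (dft_matrix n $$ (j, k)) = 1 / sqrt (real n)"
  using assms by (simp add: dft_matrix_index norm_divide)

lemma dft_matrix_orthogonal:
  assumes "j < n" "k < n"
  shows "(\<Sum>l<n. dft_matrix n $$ (j, l) * cnj (dft_matrix n $$ (k, l))) = (if j = k then 1 else 0)"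
proof -
  define x where "x = cis (2 * pi * (real k - real j) / real n)"
  have n: "0 < n" using assms by simp
  have "dft_matrix n $$ (j, l) * cnj (dft_matrix n $$ (k, l)) = x ^ l / of_nat n" if "l < n" for l
  proof -
    have "dft_matrix n $$ (j, l) * cnj (dft_matrix n $$ (k, l)) =
      cis (- 2 * pi * real j * real l / real n) * cis (2 * pi * real k * real l / real n) / (of_real (sqrt (real n)) * of_real (sqrt (real n)))"
      using assms that by (simp add: dft_matrix_index cis_cnj)
    also have "complex_of_real (sqrt (real n)) * of_real (sqrt (real n)) = of_nat n"
      by (simp flip: of_real_mult)
    also have "cis (- 2 * pi * real j * real l / real n) * cis (2 * pi * real k * real l / real n) =
      cis (real l * (2 * pi * (real k - real j) / real n))"
      unfolding cis_mult using n by (simp add: field_simps)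
    finally show ?thesis unfolding x_def Complex.DeMoivre .
  qed
  then have eq: "(\<Sum>l<n. dft_matrix n $$ (j, l) * cnj (dft_matrix n $$ (k, l))) = (\<Sum>l<n. x ^ l) / of_nat n"
    by (simp add: sum_divide_distrib)
  show ?thesis
  proof (cases "j = k")
    case True then show ?thesis unfolding eq using n by (simp add: x_def)
  next
    case False
    \<comment> \<open>Otherwise \<open>n\<close> would divide \<open>k - j\<close>, a nonzero number
      of absolute value below \<open>n\<close>.\<close>
    have "x \<noteq> 1"
    proof
      assume "x = 1"
      then have "exp (\<i> * of_real (2 * pi * (real k - real j) / real n)) = 1" by (simp add: x_def cis_conv_exp)
      then obtain m :: int where "2 * pi * (real k - real j) / real n = of_int (2 * m) * pi"
        unfolding exp_eq_1 by auto
      then have "(2 * pi) * (real k - real j) = (2 * pi) * (of_int m * real n)" using n by (simp add: field_simps)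
      then have "real k - real j = of_int m * real n" unfolding mult_left_cancel[OF pi_neq_zero] by simp
      then have "real_of_int (int k - int j) = real_of_int (m * int n)" by simp
      then have "int k - int j = m * int n" by linarith
      moreover have "\<bar>int k - int j\<bar> < int n" using assms by auto
      ultimately have "\<bar>m\<bar> * int n < 1 * int n" by (simp add: abs_mult)
      then have "m = 0" using n by (simp only: mult_less_cancel_right) auto
      then show False using \<open>int k - int j = m * int n\<close> False by simp
    qed
    moreover have "x ^ n = 1"
    proof -
      have "x ^ n = cis (2 * pi * of_int (int k - int j))" using n by (simp add: x_def Complex.DeMoivre)
      then show ?thesis by (simp only: cis_multiple_2pi Ints_of_int)
    qed
    ultimately show ?thesis unfolding eq using False by (simp add: sum_gp_strict)
  qed
qed

lemma dft_matrix_sym: "j < n \<Longrightarrow> k < n \<Longrightarrow> dft_matrix n $$ (j, k) = dft_matrix n $$ (k, j)"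
  by (simp add: dft_matrix_index mult_ac)

text \<open>The DFT matrix times a diagonal of signs: unitary for every choice of signs, and flat.
  An entry of \<open>signed_dft n S * A\<close> is a signed sum whose coefficients have squares
  adding up to \<open>1 / n\<close> when \<open>A\<close> is unitary.\<close>

definition signed_dft :: "nat \<Rightarrow> nat set \<Rightarrow> complex mat" where
  "signed_dft n S = Matrix.mat n n (\<lambda>(i, l). dft_matrix n $$ (i, l) * of_real (rsign S l))"

lemma signed_dft_unitary: "signed_dft n S \<in> unitary_group n"
proof -
  have c: "signed_dft n S \<in> carrier_mat n n" by (simp add: signed_dft_def)
  have "signed_dft n S * mat_adjoint (signed_dft n S) = 1\<^sub>m n"
  proof (rule eq_matI)
    fix i j assume "i < dim_row (1\<^sub>m n)" "j < dim_col (1\<^sub>m n)"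
    then have ij: "i < n" "j < n" by auto
    have "(signed_dft n S * mat_adjoint (signed_dft n S)) $$ (i, j) =
      (\<Sum>k<n. signed_dft n S $$ (i, k) * mat_adjoint (signed_dft n S) $$ (k, j))"
      using c ij by (intro index_mult_mat_sum) auto
    also have "\<dots> = (\<Sum>k<n. dft_matrix n $$ (i, k) * cnj (dft_matrix n $$ (j, k)))"
      using ij by (intro sum.cong) (auto simp: signed_dft_def rsign_def)
    finally show "(signed_dft n S * mat_adjoint (signed_dft n S)) $$ (i, j) = 1\<^sub>m n $$ (i, j)"
      using ij by (simp add: dft_matrix_orthogonal)
  qed (simp_all add: signed_dft_def)
  moreover have "mat_adjoint (signed_dft n S) * signed_dft n S = 1\<^sub>m n"
  proof (rule eq_matI)
    fix i j assume "i < dim_row (1\<^sub>m n)" "j < dim_col (1\<^sub>m n)"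
    then have ij: "i < n" "j < n" by auto
    have "(mat_adjoint (signed_dft n S) * signed_dft n S) $$ (i, j) =
      (\<Sum>k<n. mat_adjoint (signed_dft n S) $$ (i, k) * signed_dft n S $$ (k, j))"
      using c ij by (intro index_mult_mat_sum) auto
    also have "\<dots> = of_real (rsign S i * rsign S j) * (\<Sum>k<n. dft_matrix n $$ (j, k) * cnj (dft_matrix n $$ (i, k)))"
      using ij unfolding sum_distrib_left
      by (intro sum.cong) (auto simp: signed_dft_def dft_matrix_sym[of _ n i] dft_matrix_sym[of _ n j] mult_ac)
    finally show "(mat_adjoint (signed_dft n S) * signed_dft n S) $$ (i, j) = 1\<^sub>m n $$ (i, j)"
      using ij by (simp add: dft_matrix_orthogonal flip: of_real_mult)
  qed (simp_all add: signed_dft_def)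
  ultimately show ?thesis using c by (simp add: unitary_group_def)
qed

lemma dft_matrix_unitary: "dft_matrix n \<in> unitary_group n"
proof -
  have "dft_matrix n = signed_dft n {..<n}"
    by (rule eq_matI) (auto simp: signed_dft_def rsign_def dft_matrix_def)
  then show ?thesis using signed_dft_unitary by simp
qed

lemma mat_adjoint_mult:
  fixes A B :: "complex mat"
  assumes "A \<in> carrier_mat n m" "B \<in> carrier_mat m l"
  shows "mat_adjoint (A * B) = mat_adjoint B * mat_adjoint A"
proof (rule eq_matI)
  fix i j assume "i < dim_row (mat_adjoint B * mat_adjoint A)" "j < dim_col (mat_adjoint B * mat_adjoint A)"
  then have ij: "i < l" "j < n" using assms by auto
  have "mat_adjoint (A * B) $$ (i, j) = cnj ((A * B) $$ (j, i))"
    using assms ij by simp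
  also have "\<dots> = (\<Sum>k<m. cnj (A $$ (j, k)) * cnj (B $$ (k, i)))"
    using index_mult_mat_sum[OF assms ij(2,1)] by simp
  also have "\<dots> = (mat_adjoint B * mat_adjoint A) $$ (i, j)"
    using index_mult_mat_sum[OF mat_adjoint_carrier[OF assms(2)] mat_adjoint_carrier[OF assms(1)] ij] assms ij
    by (simp add: mult.commute)
  finally show "mat_adjoint (A * B) $$ (i, j) = (mat_adjoint B * mat_adjoint A) $$ (i, j)" .
qed (use assms in auto)

lemma unitary_group_mult:
  assumes "A \<in> unitary_group n" "B \<in> unitary_group n"
  shows "A * B \<in> unitary_group n"
proof -
  have A: "A \<in> carrier_mat n n" "A * mat_adjoint A = 1\<^sub>m n" "mat_adjoint A * A = 1\<^sub>m n"
    and B: "B \<in> carrier_mat n n" "B * mat_adjoint B = 1\<^sub>m n" "mat_adjoint B * B = 1\<^sub>m n"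
    using assms by (auto simp: unitary_group_def)
  note AA = mat_adjoint_carrier[OF A(1)] and BB = mat_adjoint_carrier[OF B(1)]
  have "A * B * (mat_adjoint B * mat_adjoint A) = A * (B * mat_adjoint B) * mat_adjoint A"
    using A(1) B(1) AA BB by (simp add: assoc_mult_mat[of _ n n _ n _ n] mult_carrier_mat[of _ n n])
  also have "\<dots> = 1\<^sub>m n" using A B by simp
  finally have 1: "A * B * (mat_adjoint B * mat_adjoint A) = 1\<^sub>m n" .
  have "mat_adjoint B * mat_adjoint A * (A * B) = mat_adjoint B * (mat_adjoint A * A) * B"
    using A(1) B(1) AA BB by (simp add: assoc_mult_mat[of _ n n _ n _ n] mult_carrier_mat[of _ n n])
  also have "\<dots> = 1\<^sub>m n" using A B BB by simp
  finally have 2: "mat_adjoint B * mat_adjoint A * (A * B) = 1\<^sub>m n" .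
  show ?thesis
    using 1 2 A(1) B(1) by (simp add: unitary_group_def mat_adjoint_mult)
qed

lemma measurable_unitary_left_mult:
  assumes V: "V \<in> unitary_group n"
  shows "(\<lambda>A. V * A) \<in> measurable (unitary_space n) (unitary_space n)"
proof -
  let ?P = "Pi\<^sub>M ({..<n} \<times> {..<n}) (\<lambda>_. borel :: complex measure)"
  have "(\<lambda>A. \<lambda>(i, j) \<in> {..<n} \<times> {..<n}. (V * A) $$ (i, j)) \<in> measurable (unitary_space n) ?P"
  proof (rule measurable_restrict)
    fix p assume p: "p \<in> {..<n} \<times> {..<n}"
    obtain i j where ij: "p = (i, j)" "i < n" "j < n" using p by auto
    have "(\<lambda>A. \<Sum>k<n. V $$ (i, k) * A $$ (k, j)) \<in> borel_measurable (unitary_space n)"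
      using ij by (intro borel_measurable_sum borel_measurable_times measurable_unitary_entry) auto
    then show "(\<lambda>A. case p of (i, j) \<Rightarrow> (V * A) $$ (i, j)) \<in> borel_measurable (unitary_space n)"
      using unitary_group_carrier ij V
      by (subst measurable_cong[where g = "\<lambda>A. \<Sum>k<n. V $$ (i, k) * A $$ (k, j)"])
        (auto simp: index_mult_mat_sum[of _ n n _ n])
  qed
  then have "(\<lambda>A. V * A) \<in> measurable (unitary_space n)
     (vimage_algebra (unitary_group n) (\<lambda>A. \<lambda>(i, j) \<in> {..<n} \<times> {..<n}. A $$ (i, j)) ?P)"
    using V by (intro measurable_vimage_algebra2) (auto intro: unitary_group_mult)
  then show ?thesis by (simp add: unitary_space_def)
qed

text \<open>Left invariance allows to replace the entry by a signed sum over a column, with signs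
  averaged out by Khintchine's inequality.\<close>

lemma haar_measure_entry_moment:
  assumes haar: "haar_measure n \<mu>" and ij: "i < n" "j < n"
  shows "(\<integral>A. norm (A $$ (i, j)) ^ (2 * m) \<partial>\<mu>) \<le> khintchine_const m / real n ^ m"
proof -
  interpret \<mu>: prob_space \<mu> using haar by (simp add: haar_measure_def)
  have sets [measurable_cong]: "sets \<mu> = sets (unitary_space n)" using haar by (simp add: haar_measure_def)
  have space: "space \<mu> = unitary_group n" using sets_eq_imp_space_eq[OF sets] by simp
  define f where "f A = norm (A $$ (i, j)) ^ (2 * m)" for A :: "complex mat"
  have f[measurable]: "f \<in> borel_measurable (unitary_space n)"
    unfolding f_def using measurable_unitary_entry[OF ij] by measurable
  have f1: "0 \<le> f A" "A \<in> unitary_group n \<Longrightarrow> f A \<le> 1" for A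
    unfolding f_def using ij by (auto intro!: power_le_one unitary_group_norm_le_1)
  have inv: "(\<integral>A. f A \<partial>\<mu>) = (\<integral>A. f (V * A) \<partial>\<mu>)" "integrable \<mu> (\<lambda>A. f (V * A))"
    if V: "V \<in> unitary_group n" for V
  proof -
    have VA[measurable]: "(\<lambda>A. V * A) \<in> measurable \<mu> (unitary_space n)"
      using measurable_unitary_left_mult[OF V] by (simp add: measurable_cong_sets[OF sets refl])
    have "distr \<mu> (unitary_space n) (\<lambda>A. V * A) = \<mu>" using haar V by (simp add: haar_measure_def)
    then have "(\<integral>A. f A \<partial>\<mu>) = (\<integral>A. f A \<partial>distr \<mu> (unitary_space n) (\<lambda>A. V * A))" by simp
    also have "\<dots> = (\<integral>A. f (V * A) \<partial>\<mu>)" by (rule integral_distr[OF VA f])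
    finally show "(\<integral>A. f A \<partial>\<mu>) = (\<integral>A. f (V * A) \<partial>\<mu>)" .
    show "integrable \<mu> (\<lambda>A. f (V * A))"
      using V by (intro \<mu>.integrable_const_bound[where B = 1])
        (auto simp: space f1 unitary_group_mult)
  qed
  let ?K = "2 ^ n * (khintchine_const m * (1 / real n) ^ m)"
  have n: "0 < n" using ij by simp
  have "2 ^ n * (\<integral>A. f A \<partial>\<mu>) = (\<Sum>S\<in>Pow {..<n}. \<integral>A. f A \<partial>\<mu>)" by (simp add: card_Pow)
  also have "\<dots> = (\<Sum>S\<in>Pow {..<n}. \<integral>A. f (signed_dft n S * A) \<partial>\<mu>)"
    using inv(1)[OF signed_dft_unitary] by (rule sum.cong[OF refl])
  also have "\<dots> = (\<integral>A. (\<Sum>S\<in>Pow {..<n}. f (signed_dft n S * A)) \<partial>\<mu>)"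
    using inv(2)[OF signed_dft_unitary] by (intro Bochner_Integration.integral_sum[symmetric])
  also have "\<dots> \<le> (\<integral>A. ?K \<partial>\<mu>)"
  proof (rule integral_mono)
    show "integrable \<mu> (\<lambda>A. \<Sum>S\<in>Pow {..<n}. f (signed_dft n S * A))"
      using inv(2)[OF signed_dft_unitary] by (intro Bochner_Integration.integrable_sum)
    fix A assume "A \<in> space \<mu>"
    then have A: "A \<in> unitary_group n" by (simp add: space)
    have "f (signed_dft n S * A) =
      norm (\<Sum>l<n. of_real (rsign S l) * (dft_matrix n $$ (i, l) * A $$ (l, j))) ^ (2 * m)" for S
    proof -
      have "(signed_dft n S * A) $$ (i, j) = (\<Sum>l<n. signed_dft n S $$ (i, l) * A $$ (l, j))"
        by (rule index_mult_mat_sum[OF unitary_group_carrier[OF signed_dft_unitary] unitary_group_carrier[OF A] ij])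
      also have "\<dots> = (\<Sum>l<n. of_real (rsign S l) * (dft_matrix n $$ (i, l) * A $$ (l, j)))"
        using ij by (intro sum.cong) (auto simp: signed_dft_def mult_ac)
      finally show ?thesis by (simp add: f_def)
    qed
    moreover have "(\<Sum>l<n. (norm (dft_matrix n $$ (i, l) * A $$ (l, j)))\<^sup>2) = 1 / real n"
      using ij unitary_group_col_norm[OF A ij(2)]
      by (simp add: norm_mult power_mult_distrib norm_dft_matrix power_divide flip: sum_divide_distrib)
    ultimately show "(\<Sum>S\<in>Pow {..<n}. f (signed_dft n S * A)) \<le> ?K"
      using Khintchine_complex[where s = "1 / real n" and c = "\<lambda>l. dft_matrix n $$ (i, l) * A $$ (l, j)"] n by simp
  qed simp
  also have "\<dots> = ?K" by (simp add: \<mu>.prob_space)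
  finally have "(\<integral>A. f A \<partial>\<mu>) \<le> khintchine_const m * (1 / real n) ^ m" by simp
  then show ?thesis by (simp add: f_def power_one_over)
qed

section \<open>Almost sure convergence from summable moments\<close>

context prob_space
begin

text \<open>A nonnegative series with finite expected sum converges almost surely, so its terms tend
  to \<open>0\<close>; nothing has to be known about the joint law for different \<open>n\<close>.
  The index is shifted because the hypotheses start at \<open>1\<close>.\<close>

lemma AE_tendsto_0_if_expectation_le:
  fixes X :: "nat \<Rightarrow> 'a \<Rightarrow> real"
  assumes int: "\<And>n. n \<ge> 1 \<Longrightarrow> integrable M (X n)"
    and nonneg: "\<And>n \<omega>. 0 \<le> X n \<omega>"
    and le: "\<And>n. n \<ge> 1 \<Longrightarrow> expectation (X n) \<le> C / real n ^ 2"
  shows "AE \<omega> in M. (\<lambda>n. X n \<omega>) \<longlonglongrightarrow> 0"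
proof -
  have [measurable]: "X (Suc n) \<in> borel_measurable M" for n using int[of "Suc n"] by auto
  have "0 \<le> expectation (X 1)" using nonneg by (simp add: integral_nonneg_AE)
  then have C: "0 \<le> C" using le[of 1] by simp
  have sum: "summable (\<lambda>n. C / real (Suc n) ^ 2)"
    using summable_mult[OF inverse_power_summable[of 2, where 'a = real], of C]
    by (subst summable_Suc_iff[where f = "\<lambda>n. C / real n ^ 2"]) (simp add: divide_inverse)
  have "(\<integral>\<^sup>+\<omega>. (\<Sum>n. ennreal (X (Suc n) \<omega>)) \<partial>M) = (\<Sum>n. \<integral>\<^sup>+\<omega>. ennreal (X (Suc n) \<omega>) \<partial>M)"
    by (intro nn_integral_suminf) measurable
  also have "\<dots> = (\<Sum>n. ennreal (expectation (X (Suc n))))"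
    using int nonneg by (intro suminf_cong nn_integral_eq_integral) auto
  also have "\<dots> \<le> (\<Sum>n. ennreal (C / real (Suc n) ^ 2))"
    by (intro suminf_le ennreal_leI le) auto
  also have "\<dots> = ennreal (\<Sum>n. C / real (Suc n) ^ 2)"
    using C sum by (intro suminf_ennreal2) auto
  also have "\<dots> < \<infinity>" by simp
  finally have "AE \<omega> in M. (\<Sum>n. ennreal (X (Suc n) \<omega>)) \<noteq> \<infinity>"
    by (intro nn_integral_noteq_infinite) auto
  then show ?thesis
  proof eventually_elim
    case (elim \<omega>)
    then have "summable (\<lambda>n. X (Suc n) \<omega>)" using nonneg by (intro summable_suminf_not_top) auto
    then have "(\<lambda>n. X (Suc n) \<omega>) \<longlonglongrightarrow> 0" by (rule summable_LIMSEQ_zero)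
    then show "(\<lambda>n. X n \<omega>) \<longlonglongrightarrow> 0" by (rule LIMSEQ_imp_Suc)
  qed
qed

text \<open>Index sets for different \<open>n\<close> may be related in any way, so this is a law of
  large numbers for a triangular array; the fourth moment supplies the summable rate.\<close>

lemma AE_card_tendsto:
  fixes S :: "nat \<Rightarrow> 'a \<Rightarrow> nat set"
  assumes sub: "\<And>n \<omega>. n \<ge> 1 \<Longrightarrow> \<omega> \<in> space M \<Longrightarrow> S n \<omega> \<subseteq> {..<n}"
    and ind: "\<And>n. n \<ge> 1 \<Longrightarrow> indep_events (\<lambda>i. {\<omega> \<in> space M. i \<in> S n \<omega>}) {..<n}"
    and a: "\<And>n i. n \<ge> 1 \<Longrightarrow> i < n \<Longrightarrow> prob {\<omega> \<in> space M. i \<in> S n \<omega>} = a"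
  shows "AE \<omega> in M. (\<lambda>n. real (card (S n \<omega>)) / real n) \<longlonglongrightarrow> a"
proof -
  let ?A = "\<lambda>n i. {\<omega> \<in> space M. i \<in> S n \<omega>}"
  let ?s = "\<lambda>n \<omega>. \<Sum>i<n. indicator (?A n i) \<omega> - prob (?A n i)"
  have "AE \<omega> in M. (\<lambda>n. ?s n \<omega> ^ 4 / real n ^ 4) \<longlonglongrightarrow> 0"
  proof (rule AE_tendsto_0_if_expectation_le)
    fix n :: nat assume n: "n \<ge> 1"
    have ev: "?A n i \<in> events" if "i < n" for i using ind[OF n] that by (auto simp: indep_events_def)
    have meas: "?s n \<in> borel_measurable M"
      using ev by (intro borel_measurable_sum borel_measurable_diff borel_measurable_indicator) auto
    have "\<bar>?s n \<omega>\<bar> \<le> (\<Sum>i<n. 1)" for \<omega>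
      by (rule order_trans[OF sum_abs sum_mono]) (auto simp: indicator_def)
    then have "\<bar>?s n \<omega>\<bar> ^ 4 \<le> real n ^ 4" for \<omega> by (intro power_mono) auto
    then show "integrable M (\<lambda>\<omega>. ?s n \<omega> ^ 4 / real n ^ 4)"
      using n by (intro integrable_const_bound[where B = 1] AE_I2 borel_measurable_divide borel_measurable_power meas)
        (auto simp: power_abs)
    have "expectation (\<lambda>\<omega>. ?s n \<omega> ^ 4 / real n ^ 4) = expectation (\<lambda>\<omega>. ?s n \<omega> ^ 4) / real n ^ 4" by simp
    also have "\<dots> \<le> 16 * real n ^ 2 / real n ^ 4"
      by (intro divide_right_mono fourth_moment_centred_sum ind n) simp
    also have "\<dots> = 16 / real n ^ 2" using n by (simp add: field_simps power2_eq_square power4_eq_xxxx)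
    finally show "expectation (\<lambda>\<omega>. ?s n \<omega> ^ 4 / real n ^ 4) \<le> 16 / real n ^ 2" .
  qed simp
  then show ?thesis
  proof (rule AE_mp, intro AE_I2 impI)
    fix \<omega> assume \<omega>: "\<omega> \<in> space M" and lim: "(\<lambda>n. ?s n \<omega> ^ 4 / real n ^ 4) \<longlonglongrightarrow> 0"
    have "(\<lambda>n. root 4 (?s n \<omega> ^ 4 / real n ^ 4)) \<longlonglongrightarrow> root 4 0"
      by (intro tendsto_intros lim)
    moreover have "root 4 (?s n \<omega> ^ 4 / real n ^ 4) = \<bar>?s n \<omega> / real n\<bar>" for n
    proof -
      have "?s n \<omega> ^ 4 / real n ^ 4 = \<bar>?s n \<omega> / real n\<bar> ^ 4"
        by (simp add: power_divide power_even_abs)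
      then show ?thesis by (simp add: real_root_power_cancel)
    qed
    ultimately have "(\<lambda>n. \<bar>?s n \<omega> / real n\<bar>) \<longlonglongrightarrow> 0"
      by (simp only: real_root_zero)
    then have "(\<lambda>n. ?s n \<omega> / real n) \<longlonglongrightarrow> 0"
      by (simp only: tendsto_rabs_zero_iff)
    then have "(\<lambda>n. a + ?s n \<omega> / real n) \<longlonglongrightarrow> a + 0" by (intro tendsto_intros)
    moreover have "eventually (\<lambda>n. a + ?s n \<omega> / real n = real (card (S n \<omega>)) / real n) sequentially"
      using eventually_ge_at_top[of 1]
    proof eventually_elim
      case (elim n)
      have "?s n \<omega> = (\<Sum>i<n. indicator (S n \<omega>) i) - real n * a"
        using a[OF elim] \<omega> by (simp add: sum_subtractf indicator_def)
      also have "(\<Sum>i<n. indicator (S n \<omega>) i :: real) = real (card (S n \<omega>))"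
        using sub[OF elim \<omega>] by (simp add: indicator_def sum.If_cases Int_absorb1 inf.absorb2)
      finally show ?case using elim by (simp add: field_simps)
    qed
    ultimately show "(\<lambda>n. real (card (S n \<omega>)) / real n) \<longlonglongrightarrow> a"
      using Lim_transform_eventually by fastforce
  qed
qed

lemma random_index_sets_AE_card:
  assumes ris: "\<And>n. n \<ge> 1 \<Longrightarrow> random_index_sets n a b (\<Omega> n) (T n)"
  shows "AE \<omega> in M. (\<lambda>n. real (card (\<Omega> n \<omega>)) / real n) \<longlonglongrightarrow> a"
    and "AE \<omega> in M. (\<lambda>n. real (card (T n \<omega>)) / real n) \<longlonglongrightarrow> b"
proof -
  have inj: "indep_events (\<lambda>i. A (g i)) I"
    if "indep_events A J" "inj_on g I" "g ` I \<subseteq> J" for A :: "'j \<Rightarrow> 'a set" and g :: "'i \<Rightarrow> 'j" and I J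
    unfolding indep_events_def
  proof (intro conjI allI impI)
    show "(\<lambda>i. A (g i)) ` I \<subseteq> events" using that by (auto simp: indep_events_def)
    fix K assume K: "K \<subseteq> I" "K \<noteq> {}" "finite K"
    have "\<forall>K\<subseteq>J. K \<noteq> {} \<longrightarrow> finite K \<longrightarrow> prob (\<Inter>(A ` K)) = (\<Prod>j\<in>K. prob (A j))"
      using that(1) by (simp add: indep_events_def)
    moreover have "g ` K \<subseteq> J" "g ` K \<noteq> {}" "finite (g ` K)" using K that(3) by auto
    ultimately have "prob (\<Inter>(A ` (g ` K))) = (\<Prod>j\<in>g ` K. prob (A j))" by blast
    then show "prob (\<Inter>i\<in>K. A (g i)) = (\<Prod>i\<in>K. prob (A (g i)))"
      using inj_on_subset[OF that(2) K(1)] by (simp add: prod.reindex image_image)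
  qed
  have ind: "indep_events (\<lambda>i. {\<omega> \<in> space M. i \<in> \<Omega> n \<omega>}) {..<n}" "indep_events (\<lambda>i. {\<omega> \<in> space M. i \<in> T n \<omega>}) {..<n}"
    if "n \<ge> 1" for n
  proof -
    have *: "indep_events (case_sum (\<lambda>i. {\<omega> \<in> space M. i \<in> \<Omega> n \<omega>}) (\<lambda>i. {\<omega> \<in> space M. i \<in> T n \<omega>}))
       ({..<n} <+> {..<n})" using ris[OF that] by (simp add: random_index_sets_def)
    from inj[OF *, of Inl "{..<n}"] show "indep_events (\<lambda>i. {\<omega> \<in> space M. i \<in> \<Omega> n \<omega>}) {..<n}" by auto
    from inj[OF *, of Inr "{..<n}"] show "indep_events (\<lambda>i. {\<omega> \<in> space M. i \<in> T n \<omega>}) {..<n}" by auto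
  qed
  show "AE \<omega> in M. (\<lambda>n. real (card (\<Omega> n \<omega>)) / real n) \<longlonglongrightarrow> a"
    using ris ind by (intro AE_card_tendsto) (auto simp: random_index_sets_def)
  show "AE \<omega> in M. (\<lambda>n. real (card (T n \<omega>)) / real n) \<longlonglongrightarrow> b"
    using ris ind by (intro AE_card_tendsto) (auto simp: random_index_sets_def)
qed

text \<open>The second moment bound does not depend on \<open>n\<close>, so division by
  \<open>n ^ 2\<close> gives a summable rate. Only countably many \<open>k\<close> occur, hence one
  null set serves all of them.\<close>

lemma AE_walk_sum_tendsto_0:
  assumes ab: "0 \<le> a" "a \<le> 1" "0 \<le> b" "b \<le> 1"
    and ris: "\<And>n. n \<ge> 1 \<Longrightarrow> random_index_sets n a b (\<Omega> n) (T n)"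
    and ind: "\<And>n. n \<ge> 1 \<Longrightarrow> indep_of (count_space (Pow {..<n} \<times> Pow {..<n}))
       (\<lambda>\<omega>. (\<Omega> n \<omega>, T n \<omega>)) (unitary_space n) (U n)"
    and C: "\<And>m. \<exists>C. \<forall>n i j. i < n \<longrightarrow> j < n \<longrightarrow>
       expectation (\<lambda>\<omega>. norm (U n \<omega> $$ (i, j)) ^ (2 * m)) \<le> C / real n ^ m"
  shows "AE \<omega> in M. \<forall>k\<ge>1. (\<lambda>n. walk_sum n k a b (U n \<omega>) (\<Omega> n \<omega>) (T n \<omega>) / of_nat n) \<longlonglongrightarrow> 0"
proof -
  have "AE \<omega> in M. k \<ge> 1 \<longrightarrow> (\<lambda>n. walk_sum n k a b (U n \<omega>) (\<Omega> n \<omega>) (T n \<omega>) / of_nat n) \<longlonglongrightarrow> 0" for k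
  proof (cases "k \<ge> 1")
    case k: True
    obtain C where C: "\<And>n i j. i < n \<Longrightarrow> j < n \<Longrightarrow>
       expectation (\<lambda>\<omega>. norm (U n \<omega> $$ (i, j)) ^ (4 * k)) \<le> C / real n ^ (2 * k)"
      using C[of "2 * k"] by (auto simp: mult.assoc[symmetric])
    let ?X = "\<lambda>n \<omega>. walk_sum n k a b (U n \<omega>) (\<Omega> n \<omega>) (T n \<omega>)"
    have "AE \<omega> in M. (\<lambda>n. (norm (?X n \<omega>))\<^sup>2 / real n ^ 2) \<longlonglongrightarrow> 0"
    proof (rule AE_tendsto_0_if_expectation_le)
      fix n :: nat assume n: "n \<ge> 1"
      note X = walk_sum_second_moment[OF k n ab ris[OF n] ind[OF n] C]
      show "integrable M (\<lambda>\<omega>. (norm (?X n \<omega>))\<^sup>2 / real n ^ 2)" using X(1) by simp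
      show "expectation (\<lambda>\<omega>. (norm (?X n \<omega>))\<^sup>2 / real n ^ 2) \<le> real k ^ (4 * k) * (2 * real k * C) / real n ^ 2"
        using X(2) by (simp add: divide_right_mono)
    qed simp
    then show ?thesis
    proof (rule AE_mp, intro AE_I2 impI)
      fix \<omega> assume "(\<lambda>n. (norm (?X n \<omega>))\<^sup>2 / real n ^ 2) \<longlonglongrightarrow> 0"
      then have "(\<lambda>n. sqrt ((norm (?X n \<omega>))\<^sup>2 / real n ^ 2)) \<longlonglongrightarrow> sqrt 0" by (intro tendsto_intros)
      then have "(\<lambda>n. norm (?X n \<omega> / of_nat n)) \<longlonglongrightarrow> 0" by (simp add: real_sqrt_divide norm_divide)
      then show "(\<lambda>n. ?X n \<omega> / of_nat n) \<longlonglongrightarrow> 0" by (simp add: tendsto_norm_zero_iff)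
    qed
  qed simp
  then show ?thesis by (simp add: AE_all_countable)
qed

lemma haar_unitary_entry_moment:
  assumes haar: "haar_unitary n U" and ij: "i < n" "j < n"
  shows "expectation (\<lambda>\<omega>. norm (U \<omega> $$ (i, j)) ^ (2 * m)) \<le> khintchine_const m / real n ^ m"
proof -
  have U: "U \<in> measurable M (unitary_space n)" and H: "haar_measure n (distr M (unitary_space n) U)"
    using haar by (auto simp: haar_unitary_def)
  have "(\<lambda>A. norm (A $$ (i, j)) ^ (2 * m)) \<in> borel_measurable (unitary_space n)"
    using measurable_unitary_entry[OF ij] by measurable
  from integral_distr[OF U this] show ?thesis
    using haar_measure_entry_moment[OF H ij, of m] by simp
qed

text \<open>Lets the deterministic DFT matrix pass through the same probabilistic argument as the
  Haar matrix.\<close>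

lemma indep_of_const:
  assumes X: "X \<in> measurable M N" and c: "c \<in> space L"
  shows "indep_of N X L (\<lambda>_. c)"
  unfolding indep_of_def
proof (intro conjI X measurable_const c)
  have "(\<lambda>_. c) -` B \<inter> space M = (if c \<in> B then space M else {})" for B by auto
  moreover have "prob (E \<inter> (if c \<in> B then space M else {})) = prob E * prob (if c \<in> B then space M else {})"
    if "E \<in> events" for E B using sets.sets_into_space[OF that] by (auto simp: prob_space Int_absorb2)
  ultimately show "indep_set {X -` A \<inter> space M |A. A \<in> sets N} {(\<lambda>_. c) -` B \<inter> space M |B. B \<in> sets L}"
    unfolding indep_sets2_eq using measurable_sets[OF X] by (auto simp: prob_space)
qed

end

section \<open>Traces of products of two centred projections\<close>

definition mat_trace :: "'a :: comm_monoid_add mat \<Rightarrow> 'a" where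
  "mat_trace A = (\<Sum>i<dim_row A. A $$ (i, i))"

lemma mat_trace_add:
  "A \<in> carrier_mat n n \<Longrightarrow> B \<in> carrier_mat n n \<Longrightarrow> mat_trace (A + B) = mat_trace A + mat_trace B"
  by (simp add: mat_trace_def sum.distrib)

lemma mat_trace_smult:
  fixes c :: "'a :: semiring_0"
  shows "A \<in> carrier_mat n n \<Longrightarrow> mat_trace (c \<cdot>\<^sub>m A) = c * mat_trace A"
  by (simp add: mat_trace_def sum_distrib_left)

lemma mat_trace_one: "mat_trace (1\<^sub>m n :: 'a :: semiring_1 mat) = of_nat n"
  by (simp add: mat_trace_def)

lemma mat_trace_mult_commute:
  fixes A B :: "'a :: comm_semiring_0 mat"
  assumes "A \<in> carrier_mat n m" "B \<in> carrier_mat m n"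
  shows "mat_trace (A * B) = mat_trace (B * A)"
proof -
  have "mat_trace (A * B) = (\<Sum>i<n. \<Sum>k<m. A $$ (i, k) * B $$ (k, i))"
    using assms by (simp add: mat_trace_def index_mult_mat_sum[OF assms] del: index_mult_mat(1))
  also have "\<dots> = (\<Sum>k<m. \<Sum>i<n. B $$ (k, i) * A $$ (i, k))"
    by (subst sum.swap) (simp add: mult.commute)
  also have "\<dots> = mat_trace (B * A)"
    using assms by (simp add: mat_trace_def index_mult_mat_sum[OF assms(2,1)] del: index_mult_mat(1))
  finally show ?thesis .
qed

lemma pow_mat_Suc_left:
  assumes "(A :: 'a :: semiring_1 mat) \<in> carrier_mat n n"
  shows "A ^\<^sub>m Suc k = A * A ^\<^sub>m k"
proof (induction k)
  case (Suc k)
  have "A ^\<^sub>m Suc (Suc k) = A * A ^\<^sub>m k * A" using Suc by simp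
  also have "\<dots> = A * (A ^\<^sub>m k * A)" using assms by (intro assoc_mult_mat) auto
  finally show ?case by simp
qed (use assms in simp)

lemma sum_PiE_lessThan_Suc:
  fixes f :: "(nat \<Rightarrow> 'b) \<Rightarrow> 'c :: comm_monoid_add"
  shows "(\<Sum>w\<in>{..<Suc k} \<rightarrow>\<^sub>E S. f w) = (\<Sum>w\<in>{..<k} \<rightarrow>\<^sub>E S. \<Sum>y\<in>S. f (w(k := y)))"
proof -
  have "(\<Sum>w\<in>{..<Suc k} \<rightarrow>\<^sub>E S. f w) = (\<Sum>w\<in>(\<lambda>(y, g). g(k := y)) ` (S \<times> ({..<k} \<rightarrow>\<^sub>E S)). f w)"
    by (simp add: lessThan_Suc PiE_insert_eq)
  also have "\<dots> = (\<Sum>(y, w)\<in>S \<times> ({..<k} \<rightarrow>\<^sub>E S). f (w(k := y)))"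
    by (subst sum.reindex[OF inj_combinator]) (auto simp: case_prod_unfold)
  also have "\<dots> = (\<Sum>y\<in>S. \<Sum>w\<in>{..<k} \<rightarrow>\<^sub>E S. f (w(k := y)))"
    by (rule sum.cartesian_product[symmetric])
  also have "\<dots> = (\<Sum>w\<in>{..<k} \<rightarrow>\<^sub>E S. \<Sum>y\<in>S. f (w(k := y)))"
    by (rule sum.swap)
  finally show ?thesis .
qed

text \<open>The endpoints are imposed by a conditional and not by a smaller domain, so that each
  induction step adds exactly one free coordinate, through
  \<open>sum_PiE_lessThan_Suc\<close>.\<close>

lemma pow_mat_index_walk:
  fixes M :: "'a :: comm_semiring_1 mat"
  assumes M: "M \<in> carrier_mat n n" and ij: "i < n" "j < n"
  shows "(M ^\<^sub>m k) $$ (i, j) =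
    (\<Sum>w\<in>{..<Suc k} \<rightarrow>\<^sub>E {..<n}. if w 0 = i \<and> w k = j then \<Prod>r<k. M $$ (w r, w (Suc r)) else 0)"
  using ij(2)
proof (induction k arbitrary: j)
  case 0
  show ?case using M ij 0
    by (subst sum_PiE_lessThan_Suc) (auto simp: sum.delta)
next
  case (Suc k)
  let ?p = "\<lambda>w. \<Prod>r<k. M $$ (w r, w (Suc r))"
  have "(M ^\<^sub>m Suc k) $$ (i, j) = (\<Sum>l<n. (M ^\<^sub>m k) $$ (i, l) * M $$ (l, j))"
    using index_mult_mat_sum[OF pow_carrier_mat[OF M] M ij(1) Suc.prems] by simp
  also have "\<dots> = (\<Sum>l<n. \<Sum>w\<in>{..<Suc k} \<rightarrow>\<^sub>E {..<n}. if l = w k then (if w 0 = i then ?p w * M $$ (w k, j) else 0) else 0)"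
  proof (rule sum.cong[OF refl])
    fix l assume "l \<in> {..<n}"
    then have l: "l < n" by simp
    show "(M ^\<^sub>m k) $$ (i, l) * M $$ (l, j) =
      (\<Sum>w\<in>{..<Suc k} \<rightarrow>\<^sub>E {..<n}. if l = w k then (if w 0 = i then ?p w * M $$ (w k, j) else 0) else 0)"
      unfolding Suc.IH[OF l] sum_distrib_right by (rule sum.cong[OF refl]) simp
  qed
  also have "\<dots> = (\<Sum>w\<in>{..<Suc k} \<rightarrow>\<^sub>E {..<n}. \<Sum>l<n. if l = w k then (if w 0 = i then ?p w * M $$ (w k, j) else 0) else 0)"
    by (rule sum.swap)
  also have "\<dots> = (\<Sum>w\<in>{..<Suc k} \<rightarrow>\<^sub>E {..<n}. if w 0 = i then ?p w * M $$ (w k, j) else 0)"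
  proof (rule sum.cong[OF refl])
    fix w assume w: "w \<in> {..<Suc k} \<rightarrow>\<^sub>E {..<n}"
    have "w k < n" using PiE_mem[OF w, of k] by simp
    then show "(\<Sum>l<n. if l = w k then (if w 0 = i then ?p w * M $$ (w k, j) else 0) else 0) =
       (if w 0 = i then ?p w * M $$ (w k, j) else 0)"
      by (simp add: sum.delta)
  qed
  also have "\<dots> = (\<Sum>w\<in>{..<Suc k} \<rightarrow>\<^sub>E {..<n}. \<Sum>y<n. if (w(Suc k := y)) 0 = i \<and> (w(Suc k := y)) (Suc k) = j
      then \<Prod>r<Suc k. M $$ ((w(Suc k := y)) r, (w(Suc k := y)) (Suc r)) else 0)"
  proof (rule sum.cong[OF refl])
    fix w :: "nat \<Rightarrow> nat"
    have "(\<Sum>y<n. if (w(Suc k := y)) 0 = i \<and> (w(Suc k := y)) (Suc k) = j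
      then \<Prod>r<Suc k. M $$ ((w(Suc k := y)) r, (w(Suc k := y)) (Suc r)) else 0) =
      (\<Sum>y<n. if y = j then (if w 0 = i then ?p w * M $$ (w k, j) else 0) else 0)"
      by (intro sum.cong[OF refl]) (auto intro!: prod.cong)
    then show "(if w 0 = i then ?p w * M $$ (w k, j) else 0) = (\<Sum>y<n. if (w(Suc k := y)) 0 = i \<and> (w(Suc k := y)) (Suc k) = j
      then \<Prod>r<Suc k. M $$ ((w(Suc k := y)) r, (w(Suc k := y)) (Suc r)) else 0)"
      using Suc.prems by (simp add: sum.delta)
  qed
  also have "\<dots> = (\<Sum>w\<in>{..<Suc (Suc k)} \<rightarrow>\<^sub>E {..<n}. if w 0 = i \<and> w (Suc k) = j
      then \<Prod>r<Suc k. M $$ (w r, w (Suc r)) else 0)"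
    by (rule sum_PiE_lessThan_Suc[symmetric])
  finally show ?case .
qed

lemma mat_trace_pow_walk:
  fixes M :: "'a :: comm_semiring_1 mat"
  assumes M: "M \<in> carrier_mat n n" and k: "k \<ge> 1"
  shows "mat_trace (M ^\<^sub>m k) = (\<Sum>w\<in>{..<k} \<rightarrow>\<^sub>E {..<n}. \<Prod>r<k. M $$ (w r, cyc_next k w r))"
proof -
  have "mat_trace (M ^\<^sub>m k) = (\<Sum>i<n. \<Sum>w\<in>{..<k} \<rightarrow>\<^sub>E {..<n}. \<Sum>y<n.
     if (w(k := y)) 0 = i \<and> (w(k := y)) k = i then \<Prod>r<k. M $$ ((w(k := y)) r, (w(k := y)) (Suc r)) else 0)"
    using M by (simp add: mat_trace_def pow_mat_index_walk[OF M] sum_PiE_lessThan_Suc)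
  also have "\<dots> = (\<Sum>w\<in>{..<k} \<rightarrow>\<^sub>E {..<n}. \<Sum>i<n. \<Sum>y<n.
     if (w(k := y)) 0 = i \<and> (w(k := y)) k = i then \<Prod>r<k. M $$ ((w(k := y)) r, (w(k := y)) (Suc r)) else 0)"
    by (rule sum.swap)
  also have "\<dots> = (\<Sum>w\<in>{..<k} \<rightarrow>\<^sub>E {..<n}. \<Prod>r<k. M $$ (w r, cyc_next k w r))"
  proof (rule sum.cong[OF refl])
    fix w assume w: "w \<in> {..<k} \<rightarrow>\<^sub>E {..<n}"
    have w0: "w 0 < n" using PiE_mem[OF w, of 0] k by simp
    have "(\<Sum>i<n. \<Sum>y<n.
       if (w(k := y)) 0 = i \<and> (w(k := y)) k = i then \<Prod>r<k. M $$ ((w(k := y)) r, (w(k := y)) (Suc r)) else 0) =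
      (\<Sum>i<n. \<Sum>y<n. if y = i then (if i = w 0 then \<Prod>r<k. M $$ (w r, cyc_next k w r) else 0) else 0)"
      using k by (intro sum.cong[OF refl]) (auto simp: cyc_next_def intro!: prod.cong)
    then show "(\<Sum>i<n. \<Sum>y<n.
       if (w(k := y)) 0 = i \<and> (w(k := y)) k = i then \<Prod>r<k. M $$ ((w(k := y)) r, (w(k := y)) (Suc r)) else 0) =
       (\<Prod>r<k. M $$ (w r, cyc_next k w r))"
      using w0 by (simp add: sum.delta)
  qed
  finally show ?thesis .
qed

section \<open>Coordinate projections and their rotations\<close>

definition coord_proj :: "nat \<Rightarrow> nat set \<Rightarrow> complex mat" where
  "coord_proj n S = Matrix.mat n n (\<lambda>(i, j). if i = j \<and> i \<in> S then 1 else 0)"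

definition rot_proj :: "nat \<Rightarrow> complex mat \<Rightarrow> nat set \<Rightarrow> complex mat" where
  "rot_proj n A T = A * coord_proj n T * mat_adjoint A"

lemma coord_proj_carrier [simp]: "coord_proj n S \<in> carrier_mat n n"
  by (simp add: coord_proj_def)

lemma rot_proj_carrier [simp]: "A \<in> carrier_mat n n \<Longrightarrow> rot_proj n A T \<in> carrier_mat n n"
  by (simp add: rot_proj_def mult_carrier_mat[of _ n n])

lemma coord_proj_mult_index:
  assumes "B \<in> carrier_mat n m" "i < n" "j < m"
  shows "(coord_proj n S * B) $$ (i, j) = indicator S i * B $$ (i, j)"
proof -
  have "(coord_proj n S * B) $$ (i, j) = (\<Sum>k<n. if k = i then indicator S i * B $$ (i, j) else 0)"
    unfolding index_mult_mat_sum[OF coord_proj_carrier assms]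
    using assms by (intro sum.cong) (auto simp: coord_proj_def indicator_def)
  then show ?thesis using assms by simp
qed

lemma coord_proj_idem: "coord_proj n S * coord_proj n S = coord_proj n S"
proof (rule eq_matI)
  fix i j assume "i < dim_row (coord_proj n S)" "j < dim_col (coord_proj n S)"
  then have ij: "i < n" "j < n" by (simp_all add: coord_proj_def)
  show "(coord_proj n S * coord_proj n S) $$ (i, j) = coord_proj n S $$ (i, j)"
    unfolding coord_proj_mult_index[OF coord_proj_carrier ij]
    using ij by (auto simp: coord_proj_def)
qed (simp_all add: coord_proj_def)

lemma coord_proj_affine_mult_index:
  assumes B: "B \<in> carrier_mat n n" and ij: "i < n" "j < n"
  shows "((coord_proj n S + x \<cdot>\<^sub>m 1\<^sub>m n) * B) $$ (i, j) = (indicator S i + x) * B $$ (i, j)"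
proof -
  have "(coord_proj n S + x \<cdot>\<^sub>m 1\<^sub>m n) * B = coord_proj n S * B + x \<cdot>\<^sub>m B"
    using B by (subst add_mult_distrib_mat[of _ n n _ _ n])
      (auto simp: mult_smult_assoc_mat[of _ n n _ n] left_mult_one_mat[of _ n n])
  then show ?thesis
    using B ij by (simp add: coord_proj_mult_index[OF B ij] algebra_simps del: index_mult_mat(1))
qed

lemma rot_proj_idem:
  assumes A: "A \<in> unitary_group n"
  shows "rot_proj n A T * rot_proj n A T = rot_proj n A T"
proof -
  let ?Q = "coord_proj n T" and ?A = "mat_adjoint A"
  have c: "A \<in> carrier_mat n n" "?A \<in> carrier_mat n n" "?A * A = 1\<^sub>m n"
    using A by (auto simp: unitary_group_def)
  have "rot_proj n A T * rot_proj n A T = A * (?Q * (?A * A * (?Q * ?A)))"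
    unfolding rot_proj_def using c(1,2)
    by (simp add: assoc_mult_mat[of _ n n _ n _ n] mult_carrier_mat[of _ n n])
  also have "\<dots> = A * (?Q * ?Q * ?A)"
    using c by (simp add: assoc_mult_mat[of _ n n _ n _ n] mult_carrier_mat[of _ n n] left_mult_one_mat[of _ n n])
  also have "\<dots> = rot_proj n A T"
    unfolding rot_proj_def coord_proj_idem using c by (simp add: assoc_mult_mat[of _ n n _ n _ n])
  finally show ?thesis .
qed

lemma rot_proj_index:
  assumes A: "A \<in> carrier_mat n n" and ij: "i < n" "j < n"
  shows "rot_proj n A T $$ (i, j) = (\<Sum>t<n. A $$ (i, t) * indicator T t * cnj (A $$ (j, t)))"
proof -
  have "rot_proj n A T = A * (coord_proj n T * mat_adjoint A)"
    unfolding rot_proj_def using A by (intro assoc_mult_mat) auto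
  then have "rot_proj n A T $$ (i, j) = (\<Sum>t<n. A $$ (i, t) * (coord_proj n T * mat_adjoint A) $$ (t, j))"
    using A ij by (simp only: index_mult_mat_sum[of _ n n _ n] mult_carrier_mat[of _ n n] coord_proj_carrier mat_adjoint_carrier)
  also have "\<dots> = (\<Sum>t<n. A $$ (i, t) * indicator T t * cnj (A $$ (j, t)))"
    using A ij by (intro sum.cong[OF refl])
      (simp add: coord_proj_mult_index[of _ n n] mult.assoc del: index_mult_mat(1))
  finally show ?thesis .
qed

lemma mat_trace_coord_proj:
  assumes "S \<subseteq> {..<n}" shows "mat_trace (coord_proj n S) = of_nat (card S)"
proof -
  have "mat_trace (coord_proj n S) = (\<Sum>i<n. if i \<in> S then 1 else 0)"
    by (simp add: mat_trace_def coord_proj_def)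
  also have "\<dots> = of_nat (card S)" using assms by (simp add: sum.If_cases Int_absorb1)
  finally show ?thesis .
qed

lemma mat_trace_rot_proj:
  assumes A: "A \<in> unitary_group n" and "T \<subseteq> {..<n}"
  shows "mat_trace (rot_proj n A T) = of_nat (card T)"
proof -
  have c: "A \<in> carrier_mat n n" "mat_adjoint A \<in> carrier_mat n n" "mat_adjoint A * A = 1\<^sub>m n"
    using A by (auto simp: unitary_group_def)
  have "mat_trace (rot_proj n A T) = mat_trace (mat_adjoint A * (A * coord_proj n T))"
    unfolding rot_proj_def using c by (intro mat_trace_mult_commute[of _ n n]) (auto simp: mult_carrier_mat[of _ n n])
  also have "mat_adjoint A * (A * coord_proj n T) = mat_adjoint A * A * coord_proj n T"
    by (rule assoc_mult_mat[symmetric, of _ n n _ n _ n]) (use c in auto)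
  finally show ?thesis using c assms by (simp add: mat_trace_coord_proj left_mult_one_mat[of _ n n])
qed

definition centred_product :: "nat \<Rightarrow> complex \<Rightarrow> complex \<Rightarrow> complex mat \<Rightarrow> complex mat \<Rightarrow> complex mat" where
  "centred_product n a b P G = (P + (-a) \<cdot>\<^sub>m 1\<^sub>m n) * (G + (-b) \<cdot>\<^sub>m 1\<^sub>m n)"

lemma centred_product_carrier [simp]:
  "P \<in> carrier_mat n n \<Longrightarrow> G \<in> carrier_mat n n \<Longrightarrow> centred_product n a b P G \<in> carrier_mat n n"
  by (simp add: centred_product_def mult_carrier_mat[of _ n n])

text \<open>Row orthonormality of \<open>A\<close> writes \<open>b\<close> times the identity as a
  sum over columns. This moves the centring of the rotated projection into the weights of the column
  indices, where the randomness is.\<close>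

lemma centred_product_index:
  fixes a b :: real
  assumes A: "A \<in> unitary_group n" and ij: "i < n" "j < n"
  shows "centred_product n a b (coord_proj n S) (rot_proj n A T) $$ (i, j) =
    of_real (indicator S i - a) * (\<Sum>t<n. A $$ (i, t) * of_real (indicator T t - b) * cnj (A $$ (j, t)))"
proof -
  let ?P = "coord_proj n S + (-complex_of_real a) \<cdot>\<^sub>m 1\<^sub>m n" and ?G = "rot_proj n A T + (-complex_of_real b) \<cdot>\<^sub>m 1\<^sub>m n"
  have c: "A \<in> carrier_mat n n" using A by (rule unitary_group_carrier)
  have G: "?G \<in> carrier_mat n n" using c by simp
  have "centred_product n a b (coord_proj n S) (rot_proj n A T) $$ (i, j) = of_real (indicator S i - a) * ?G $$ (i, j)"
    unfolding centred_product_def coord_proj_affine_mult_index[OF G ij] by (simp add: indicator_def)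
  also have "?G $$ (i, j) = (\<Sum>t<n. A $$ (i, t) * indicator T t * cnj (A $$ (j, t))) - b * (\<Sum>t<n. A $$ (i, t) * cnj (A $$ (j, t)))"
    using c ij unitary_group_row[OF A ij] by (simp add: rot_proj_index)
  also have "\<dots> = (\<Sum>t<n. A $$ (i, t) * of_real (indicator T t - b) * cnj (A $$ (j, t)))"
    unfolding sum_distrib_left sum_subtractf[symmetric]
    by (intro sum.cong) (auto simp: algebra_simps indicator_def)
  finally show ?thesis .
qed

lemma mat_trace_centred_product_pow:
  fixes a b :: real
  assumes A: "A \<in> unitary_group n" and k: "k \<ge> 1"
  shows "mat_trace (centred_product n a b (coord_proj n S) (rot_proj n A T) ^\<^sub>m k) = walk_sum n k a b A S T"
proof -
  let ?M = "centred_product n a b (coord_proj n S) (rot_proj n A T)"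
  let ?W = "{..<k} \<rightarrow>\<^sub>E {..<n}"
  have M: "?M \<in> carrier_mat n n" using unitary_group_carrier[OF A] by simp
  have "mat_trace (?M ^\<^sub>m k) = (\<Sum>w\<in>?W. \<Prod>r<k. ?M $$ (w r, cyc_next k w r))"
    by (rule mat_trace_pow_walk[OF M k])
  also have "\<dots> = (\<Sum>w\<in>?W. \<Sum>t\<in>?W. of_real (walk_weight k a b S T w t) * walk_coef k A w t)"
  proof (rule sum.cong[OF refl])
    fix w assume w: "w \<in> ?W"
    have lt: "w r < n" "cyc_next k w r < n" if "r < k" for r
      using PiE_mem[OF w, of r] cyc_next_less[OF w that] that by auto
    have "(\<Prod>r<k. ?M $$ (w r, cyc_next k w r)) = (\<Prod>r<k. of_real (indicator S (w r) - a) *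
        (\<Sum>t<n. A $$ (w r, t) * of_real (indicator T t - b) * cnj (A $$ (cyc_next k w r, t))))"
      using lt by (intro prod.cong[OF refl] centred_product_index[OF A]) auto
    also have "\<dots> = (\<Prod>r<k. of_real (indicator S (w r) - a)) *
        (\<Prod>r<k. \<Sum>t<n. A $$ (w r, t) * of_real (indicator T t - b) * cnj (A $$ (cyc_next k w r, t)))"
      by (rule prod.distrib)
    also have "(\<Prod>r<k. \<Sum>t<n. A $$ (w r, t) * of_real (indicator T t - b) * cnj (A $$ (cyc_next k w r, t))) =
        (\<Sum>t\<in>?W. \<Prod>r<k. A $$ (w r, t r) * of_real (indicator T (t r) - b) * cnj (A $$ (cyc_next k w r, t r)))"
      by (rule prod_sum_PiE) auto
    also have "(\<Prod>r<k. complex_of_real (indicator S (w r) - a)) * \<dots> =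
        (\<Sum>t\<in>?W. of_real (walk_weight k a b S T w t) * walk_coef k A w t)"
      by (simp add: sum_distrib_left walk_weight_def walk_coef_def prod.distrib mult_ac)
    finally show "(\<Prod>r<k. ?M $$ (w r, cyc_next k w r)) =
        (\<Sum>t\<in>?W. of_real (walk_weight k a b S T w t) * walk_coef k A w t)" .
  qed
  also have "\<dots> = walk_sum n k a b A S T"
    unfolding walk_sum_def by (rule sum.cartesian_product)
  finally show ?thesis .
qed

text \<open>Up to the constant \<open>2 D\<^bsup>k/2\<^esup>\<close> and an affine substitution, the Chebyshev polynomials of the first kind.\<close>

fun cheb :: "'a :: comm_ring_1 \<Rightarrow> 'a \<Rightarrow> nat \<Rightarrow> 'a \<Rightarrow> 'a" where
  "cheb c D 0 x = 2"
| "cheb c D (Suc 0) x = x - c"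
| "cheb c D (Suc (Suc k)) x = (x - c) * cheb c D (Suc k) x - D * cheb c D k x"

section \<open>Algebra of a pair of projections\<close>

locale two_projections =
  fixes n :: nat and P G :: "complex mat" and a b :: complex
  assumes P: "P \<in> carrier_mat n n" and G: "G \<in> carrier_mat n n"
    and PP: "P * P = P" and GG: "G * G = G"
begin

definition "M = centred_product n a b P G"

text \<open>This is the square of \<open>P + G - 1\<close>. It commutes with \<open>P\<close> and
  \<open>G\<close>; on the range of \<open>P\<close> it is the compression of \<open>G\<close>, and
  on a two-dimensional block it is the scalar \<open>x\<close>. On common eigenvectors it is
  \<open>1\<close> if \<open>P\<close> and \<open>G\<close> have the same eigenvalue there and
  \<open>0\<close> otherwise.\<close>

definition "C = 1\<^sub>m n + (-1) \<cdot>\<^sub>m P + (-1) \<cdot>\<^sub>m G + P * G + G * P"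

definition "c = a + b - 2 * a * b"
definition "D = a * (1 - a) * b * (1 - b)"

lemma carriers [simp]:
  "P \<in> carrier_mat n n" "G \<in> carrier_mat n n" "M \<in> carrier_mat n n" "C \<in> carrier_mat n n"
  using P G by (auto simp: M_def C_def mult_carrier_mat[of _ n n])

lemma dims [simp]:
  "dim_row P = n" "dim_col P = n" "dim_row G = n" "dim_col G = n"
  "dim_row M = n" "dim_col M = n" "dim_row C = n" "dim_col C = n"
  by (rule carrier_matD[OF carriers(1)] carrier_matD[OF carriers(2)]
      carrier_matD[OF carriers(3)] carrier_matD[OF carriers(4)])+

lemmas ones = left_mult_one_mat[of _ n n] right_mult_one_mat[of _ n n]
lemmas assoc = assoc_mult_mat[of _ n n _ n _ n]
lemmas closed = mult_carrier_mat[of _ n n]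
lemmas distl = mult_add_distrib_mat[of _ n n _ n]
lemmas distr = add_mult_distrib_mat[of _ n n _ _ n]
lemmas smultl = mult_smult_assoc_mat[of _ n n _ n]
lemmas smultr = mult_smult_distrib[of _ n n _ n]

lemma PP': "X \<in> carrier_mat n n \<Longrightarrow> P * (P * X) = P * X"
  using assoc[of P P X] PP by simp

lemma GG': "X \<in> carrier_mat n n \<Longrightarrow> G * (G * X) = G * X"
  using assoc[of G G X] GG by simp

lemma affine_mult:
  fixes X Y :: "complex mat"
  assumes X: "X \<in> carrier_mat n n" and Y: "Y \<in> carrier_mat n n"
  shows "(X + x \<cdot>\<^sub>m 1\<^sub>m n) * (Y + y \<cdot>\<^sub>m 1\<^sub>m n) = X * Y + y \<cdot>\<^sub>m X + x \<cdot>\<^sub>m Y + (x * y) \<cdot>\<^sub>m 1\<^sub>m n"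
proof -
  have "(X + x \<cdot>\<^sub>m 1\<^sub>m n) * (Y + y \<cdot>\<^sub>m 1\<^sub>m n) = X * Y + y \<cdot>\<^sub>m X + (x \<cdot>\<^sub>m Y + (x * y) \<cdot>\<^sub>m 1\<^sub>m n)"
    using X Y by (simp add: distl distr smultl smultr closed ones)
      (rule eq_matI, auto simp: algebra_simps simp del: index_mult_mat(1))
  also have "\<dots> = X * Y + y \<cdot>\<^sub>m X + x \<cdot>\<^sub>m Y + (x * y) \<cdot>\<^sub>m 1\<^sub>m n"
    using X Y by (intro assoc_add_mat[symmetric, of _ n n]) (auto simp: closed)
  finally show ?thesis .
qed

text \<open>Cayley-Hamilton for all blocks at once: the product \<open>?G1 * ?P1\<close> plays the
  part of the adjugate of \<open>M\<close>, since its product with \<open>M\<close> is the scalar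
  \<open>D\<close> and its sum with \<open>M\<close> is \<open>C - c\<close>.\<close>

lemma M_square: "M * M + D \<cdot>\<^sub>m 1\<^sub>m n = M * C + (-c) \<cdot>\<^sub>m M"
proof -
  let ?P0 = "P + (-a) \<cdot>\<^sub>m 1\<^sub>m n" and ?P1 = "P + (-(1-a)) \<cdot>\<^sub>m 1\<^sub>m n"
  let ?G0 = "G + (-b) \<cdot>\<^sub>m 1\<^sub>m n" and ?G1 = "G + (-(1-b)) \<cdot>\<^sub>m 1\<^sub>m n"
  have "?P0 * ?P1 = (a * (1 - a)) \<cdot>\<^sub>m 1\<^sub>m n"
    unfolding affine_mult[OF P P] PP by (rule eq_matI) (auto simp: algebra_simps)
  moreover have GG1: "?G0 * ?G1 = (b * (1 - b)) \<cdot>\<^sub>m 1\<^sub>m n"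
    unfolding affine_mult[OF G G] GG by (rule eq_matI) (auto simp: algebra_simps)
  moreover have "M * (?G1 * ?P1) = ?P0 * (?G0 * ?G1 * ?P1)"
    by (simp add: M_def centred_product_def assoc closed)
  moreover have "?P0 * ((b * (1 - b)) \<cdot>\<^sub>m 1\<^sub>m n * ?P1) = (b * (1 - b)) \<cdot>\<^sub>m (?P0 * ?P1)"
    by (simp add: smultl smultr left_mult_one_mat[of _ n n])
  ultimately have ML1: "M * (?G1 * ?P1) = D \<cdot>\<^sub>m 1\<^sub>m n"
    by (simp only:) (rule eq_matI, auto simp: D_def)
  have sum: "M + ?G1 * ?P1 = C + (-c) \<cdot>\<^sub>m 1\<^sub>m n"
    unfolding M_def centred_product_def affine_mult[OF P G] affine_mult[OF G P] C_def c_def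
    by (rule eq_matI) (auto simp: algebra_simps simp del: index_mult_mat(1))
  have "M * M + D \<cdot>\<^sub>m 1\<^sub>m n = M * (M + ?G1 * ?P1)"
    unfolding ML1[symmetric] by (simp add: distl closed)
  also have "\<dots> = M * C + (-c) \<cdot>\<^sub>m M"
    unfolding sum by (simp add: distl smultr ones)
  finally show ?thesis .
qed

lemma PC: "P * C = P * G * P"
  unfolding C_def
  by (simp add: distl smultr closed assoc PP PP')
    (rule eq_matI, auto simp: algebra_simps closed simp del: index_mult_mat(1))

lemma GC: "G * C = G * P * G"
  unfolding C_def
  by (simp add: distl smultr closed assoc GG GG')
    (rule eq_matI, auto simp: algebra_simps closed simp del: index_mult_mat(1))

text \<open>A moment of the compression for positive \<open>j\<close> only: at \<open>0\<close> the
  value is \<open>n\<close> and not the rank of \<open>P\<close>, so all statements use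
  \<open>Suc j\<close>.\<close>

definition "y j = mat_trace ((P * G) ^\<^sub>m j)"

lemma P_C_pow: "P * C ^\<^sub>m j = (P * G) ^\<^sub>m j * P"
proof (induction j)
  case (Suc j)
  have "P * C ^\<^sub>m Suc j = (P * C ^\<^sub>m j) * C" by (simp add: assoc)
  also have "\<dots> = (P * G) ^\<^sub>m j * (P * C)" unfolding Suc by (simp add: assoc closed)
  also have "\<dots> = (P * G) ^\<^sub>m Suc j * P" unfolding PC by (simp add: assoc closed)
  finally show ?case .
qed (simp add: ones)

lemma G_C_pow: "G * C ^\<^sub>m j = (G * P) ^\<^sub>m j * G"
proof (induction j)
  case (Suc j)
  have "G * C ^\<^sub>m Suc j = (G * C ^\<^sub>m j) * C" by (simp add: assoc)
  also have "\<dots> = (G * P) ^\<^sub>m j * (G * C)" unfolding Suc by (simp add: assoc closed)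
  also have "\<dots> = (G * P) ^\<^sub>m Suc j * G" unfolding GC by (simp add: assoc closed)
  finally show ?case .
qed (simp add: ones)

lemma alternate_pow: "P * (G * P) ^\<^sub>m j = (P * G) ^\<^sub>m j * P"
proof (induction j)
  case (Suc j)
  have "P * (G * P) ^\<^sub>m Suc j = (P * (G * P) ^\<^sub>m j) * (G * P)" by (simp add: assoc closed)
  also have "\<dots> = (P * G) ^\<^sub>m Suc j * P" unfolding Suc by (simp add: assoc closed)
  finally show ?case .
qed (simp add: ones)

lemma PG_C_pow: "P * G * C ^\<^sub>m j = (P * G) ^\<^sub>m Suc j"
proof -
  have "P * G * C ^\<^sub>m j = P * (G * P) ^\<^sub>m j * G"
    by (simp add: assoc closed G_C_pow)
  also have "\<dots> = (P * G) ^\<^sub>m Suc j" unfolding alternate_pow by (simp add: assoc closed)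
  finally show ?thesis .
qed

lemma trace_PG_C_pow: "mat_trace (P * G * C ^\<^sub>m j) = y (Suc j)"
  by (simp only: PG_C_pow y_def)

lemma trace_P_C_pow: "mat_trace (P * C ^\<^sub>m Suc j) = y (Suc j)"
proof -
  have "mat_trace (P * C ^\<^sub>m Suc j) = mat_trace (P * (P * G) ^\<^sub>m Suc j)"
    unfolding P_C_pow by (rule mat_trace_mult_commute[of _ n n]) (auto simp: closed)
  also have "P * (P * G) ^\<^sub>m Suc j = (P * G) ^\<^sub>m Suc j"
    unfolding pow_mat_Suc_left[of "P * G" n, OF closed[OF carriers(1,2)]]
    by (simp add: assoc closed PP')
  finally show ?thesis by (simp only: y_def)
qed

lemma trace_GP_pow: "mat_trace ((G * P) ^\<^sub>m Suc j) = y (Suc j)"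
proof -
  have "mat_trace ((G * P) ^\<^sub>m Suc j) = mat_trace (G * (P * (G * P) ^\<^sub>m j))"
    unfolding pow_mat_Suc_left[of "G * P" n, OF closed[OF carriers(2,1)]] by (simp add: assoc closed)
  also have "\<dots> = mat_trace (P * (G * P) ^\<^sub>m j * G)"
    by (rule mat_trace_mult_commute[of _ n n]) (auto simp: closed)
  also have "P * (G * P) ^\<^sub>m j * G = (P * G) ^\<^sub>m Suc j"
    unfolding alternate_pow by (simp add: assoc closed)
  finally show ?thesis by (simp only: y_def)
qed

lemma trace_G_C_pow: "mat_trace (G * C ^\<^sub>m Suc j) = y (Suc j)"
proof -
  have "mat_trace (G * C ^\<^sub>m Suc j) = mat_trace (G * (G * P) ^\<^sub>m Suc j)"
    unfolding G_C_pow by (rule mat_trace_mult_commute[of _ n n]) (auto simp: closed)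
  also have "G * (G * P) ^\<^sub>m Suc j = (G * P) ^\<^sub>m Suc j"
    unfolding pow_mat_Suc_left[of "G * P" n, OF closed[OF carriers(2,1)]]
    by (simp add: assoc closed GG')
  finally show ?thesis by (simp only: trace_GP_pow)
qed

lemma trace_GP_C_pow: "mat_trace (G * P * C ^\<^sub>m j) = y (Suc j)"
proof -
  have "G * P * C ^\<^sub>m j = G * (P * (G * P) ^\<^sub>m j)"
    unfolding alternate_pow by (simp add: assoc closed P_C_pow)
  also have "\<dots> = (G * P) ^\<^sub>m Suc j"
    unfolding pow_mat_Suc_left[of "G * P" n, OF closed[OF carriers(2,1)]] by (simp add: assoc closed)
  finally show ?thesis by (simp only: trace_GP_pow)
qed

lemma trace_C_pow_Suc:
  "mat_trace (C ^\<^sub>m Suc j) = mat_trace (C ^\<^sub>m j) - mat_trace (P * C ^\<^sub>m j) - mat_trace (G * C ^\<^sub>m j) + 2 * y (Suc j)"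
proof -
  let ?X = "C ^\<^sub>m j"
  have X: "?X \<in> carrier_mat n n" by simp
  have "C ^\<^sub>m Suc j = C * ?X" by (rule pow_mat_Suc_left[OF carriers(4)])
  also have "\<dots> = ?X + (-1) \<cdot>\<^sub>m (P * ?X) + (-1) \<cdot>\<^sub>m (G * ?X) + P * G * ?X + G * P * ?X"
  proof -
    have "Y = 1\<^sub>m n + (-1) \<cdot>\<^sub>m P + (-1) \<cdot>\<^sub>m G + P * G + G * P \<Longrightarrow>
      Y * ?X = ?X + (-1) \<cdot>\<^sub>m (P * ?X) + (-1) \<cdot>\<^sub>m (G * ?X) + P * G * ?X + G * P * ?X" for Y
      using X by (simp add: distr smultl closed ones)
    then show ?thesis using C_def by blast
  qed
  finally have eq: "C ^\<^sub>m Suc j = ?X + (-1) \<cdot>\<^sub>m (P * ?X) + (-1) \<cdot>\<^sub>m (G * ?X) + P * G * ?X + G * P * ?X" .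
  show ?thesis
    unfolding eq using X
    by (simp add: mat_trace_add[of _ n] mat_trace_smult[of _ n] closed trace_PG_C_pow trace_GP_C_pow)
qed

text \<open>\<open>C\<close> acts on both dimensions of a block, whereas \<open>y\<close> counts the
  eigenvalue of the block once. For orthogonal projections the constant is the dimension of the
  common kernel minus that of the common range. Power \<open>0\<close> is left out because it would
  also see the vectors on which \<open>C\<close> vanishes.\<close>

lemma trace_C_pow: "mat_trace (C ^\<^sub>m Suc j) = 2 * y (Suc j) + (of_nat n - mat_trace P - mat_trace G)"
proof (induction j)
  case 0
  show ?case using trace_C_pow_Suc[of 0] carriers(4) by (simp add: mat_trace_one)
next
  case (Suc j)
  show ?case using trace_C_pow_Suc[of "Suc j"] Suc by (simp only: trace_P_C_pow trace_G_C_pow) simp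
qed

lemma trace_M_C_pow:
  "mat_trace (M * C ^\<^sub>m j) = y (Suc j) - b * mat_trace (P * C ^\<^sub>m j) - a * mat_trace (G * C ^\<^sub>m j) + a * b * mat_trace (C ^\<^sub>m j)"
proof -
  let ?X = "C ^\<^sub>m j"
  have X: "?X \<in> carrier_mat n n" by simp
  have "M * ?X = P * G * ?X + (-b) \<cdot>\<^sub>m (P * ?X) + (-a) \<cdot>\<^sub>m (G * ?X) + (a * b) \<cdot>\<^sub>m ?X"
    unfolding M_def centred_product_def affine_mult[OF P G]
    using X by (simp add: distr smultl closed ones)
  then show ?thesis
    using X by (simp add: mat_trace_add[of _ n] mat_trace_smult[of _ n] closed trace_PG_C_pow)
qed

text \<open>Each use of \<open>M_square\<close> trades a power of \<open>M\<close> for a power of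
  \<open>C\<close>, so an induction on \<open>k\<close> alone would not close; this forces the
  family in two indices.\<close>

lemma trace_recursion:
  "mat_trace (M ^\<^sub>m Suc (Suc k) * C ^\<^sub>m j) =
   mat_trace (M ^\<^sub>m Suc k * C ^\<^sub>m Suc j) - c * mat_trace (M ^\<^sub>m Suc k * C ^\<^sub>m j) - D * mat_trace (M ^\<^sub>m k * C ^\<^sub>m j)"
proof -
  let ?X = "C ^\<^sub>m j" and ?Y = "M ^\<^sub>m k"
  have X: "?X \<in> carrier_mat n n" and Y: "?Y \<in> carrier_mat n n" by simp_all
  have l: "?Y * (M * M + D \<cdot>\<^sub>m 1\<^sub>m n) * ?X = M ^\<^sub>m Suc (Suc k) * ?X + D \<cdot>\<^sub>m (?Y * ?X)"
    using X Y by (simp add: distl distr smultl smultr assoc closed ones)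
  have r: "?Y * (M * C + (-c) \<cdot>\<^sub>m M) * ?X = M ^\<^sub>m Suc k * C ^\<^sub>m Suc j + (-c) \<cdot>\<^sub>m (M ^\<^sub>m Suc k * ?X)"
    unfolding pow_mat_Suc_left[OF carriers(4)]
    using X Y by (simp add: distl distr smultl smultr assoc closed ones)
  have "mat_trace (M ^\<^sub>m Suc (Suc k) * ?X + D \<cdot>\<^sub>m (?Y * ?X)) =
    mat_trace (M ^\<^sub>m Suc k * C ^\<^sub>m Suc j + (-c) \<cdot>\<^sub>m (M ^\<^sub>m Suc k * ?X))"
    using l r M_square by simp
  then show ?thesis
    by (simp add: mat_trace_add[of _ n] mat_trace_smult[of _ n] closed del: pow_mat.simps) (simp add: algebra_simps)
qed

text \<open>Every eigenvalue \<open>x\<close> of the compression of \<open>G\<close> to the range of \<open>P\<close> belongs to a two-dimensional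
  block on which \<open>M\<close> has determinant \<open>D\<close> and trace \<open>x - c\<close>; the other three terms come from
  the common eigenvectors of \<open>P\<close> and \<open>G\<close>, counted with sign.\<close>

lemma trace_M_pow_C_pow:
  assumes xs: "\<And>j. y (Suc j) = (\<Sum>x\<leftarrow>xs. x ^ Suc j)"
  shows "mat_trace (M ^\<^sub>m k * C ^\<^sub>m j) = (\<Sum>x\<leftarrow>xs. x ^ j * cheb c D k x)
    + (of_nat n - mat_trace P - mat_trace G) * (a * b) ^ k
    + 0 ^ j * ((mat_trace G - of_nat (length xs)) * (- (a * (1 - b))) ^ k
             + (mat_trace P - of_nat (length xs)) * (- ((1 - a) * b)) ^ k)"
proof (induction k arbitrary: j rule: induct_nat_012)
  case 0
  show ?case
  proof (cases j)
    case 0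
    then show ?thesis by (simp add: mat_trace_one sum_list_triv ones)
  next
    case (Suc i)
    have "M ^\<^sub>m 0 * C ^\<^sub>m j = C ^\<^sub>m Suc i" using Suc carriers(3) by (simp add: left_mult_one_mat[of _ n n])
    then show ?thesis using trace_C_pow[of i] xs[of i]
      by (simp add: Suc sum_list_mult_const mult.commute flip: sum_list_const_mult)
  qed
next
  case 1
  have M1: "M ^\<^sub>m Suc 0 = M" using carriers(3) by simp
  show ?case
  proof (cases j)
    case 0
    have "(\<Sum>x\<leftarrow>xs. x - c) = y (Suc 0) - c * of_nat (length xs)"
      unfolding xs by (induction xs) (simp_all add: algebra_simps)
    then show ?thesis using trace_M_C_pow[of 0] 0
      by (simp add: M1 mat_trace_one c_def right_mult_one_mat[of _ n n] del: pow_mat.simps(2))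
        (simp add: algebra_simps)
  next
    case (Suc i)
    have "(\<Sum>x\<leftarrow>xs. x ^ Suc i * (x - c)) = y (Suc (Suc i)) - c * y (Suc i)"
      unfolding xs by (induction xs) (simp_all add: algebra_simps)
    then show ?thesis
      unfolding M1 Suc cheb.simps trace_M_C_pow trace_P_C_pow trace_G_C_pow trace_C_pow
      by (simp add: c_def algebra_simps)
  qed
next
  case (ge2 k)
  have sumrec: "(\<Sum>x\<leftarrow>xs. x ^ j * cheb c D (Suc (Suc k)) x) = (\<Sum>x\<leftarrow>xs. x ^ Suc j * cheb c D (Suc k) x)
      - c * (\<Sum>x\<leftarrow>xs. x ^ j * cheb c D (Suc k) x) - D * (\<Sum>x\<leftarrow>xs. x ^ j * cheb c D k x)"
    by (induction xs) (simp_all add: algebra_simps)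
  \<comment> \<open>The value of \<open>M\<close> on a common eigenvector solves the same quadratic
    as \<open>M\<close>, with \<open>C\<close> replaced by \<open>1\<close> or \<open>0\<close>. The
    roots are \<open>a * b\<close> and \<open>(1 - a) * (1 - b)\<close> in the first case,
    \<open>- (a * (1 - b))\<close> and \<open>- ((1 - a) * b)\<close> in the second.\<close>
  have pw: "s ^ Suc (Suc k) = e * s ^ Suc k - D * s ^ k" if "s * s = e * s - D" for s e
    using arg_cong[OF that, of "\<lambda>z. z * s ^ k"] by (simp add: algebra_simps)
  have s: "(a * b) ^ Suc (Suc k) = (1 - c) * (a * b) ^ Suc k - D * (a * b) ^ k"
    and u: "(- (a * (1 - b))) ^ Suc (Suc k) = (-c) * (- (a * (1 - b))) ^ Suc k - D * (- (a * (1 - b))) ^ k"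
    and v: "(- ((1 - a) * b)) ^ Suc (Suc k) = (-c) * (- ((1 - a) * b)) ^ Suc k - D * (- ((1 - a) * b)) ^ k"
    by (rule pw, simp add: c_def D_def algebra_simps)+
  show ?case
    unfolding trace_recursion ge2 sumrec s u v
    by (cases j) (simp_all add: algebra_simps del: power_Suc cheb.simps)
qed

end

section \<open>Eigenvalues of the restricted matrix\<close>

lemma bij_betw_pick:
  assumes "finite S"
  shows "bij_betw (pick S) {..<card S} S"
proof -
  have surj: "S \<subseteq> pick S ` {..<card S}"
  proof
    fix i assume i: "i \<in> S"
    have "{a \<in> S. a < i} \<subset> S" using i by auto
    then have "card {a \<in> S. a < i} < card S" by (rule psubset_card_mono[OF assms])
    then have "pick S (card {a \<in> S. a < i}) \<in> pick S ` {..<card S}" by (intro imageI) simp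
    then show "i \<in> pick S ` {..<card S}" unfolding pick_card_in_set[OF i] .
  qed
  moreover have "card (pick S ` {..<card S}) \<le> card S" using card_image_le[of "{..<card S}" "pick S"] by simp
  ultimately have img: "pick S ` {..<card S} = S"
    by (metis card_seteq finite_imageI finite_lessThan)
  then have "inj_on (pick S) {..<card S}" by (intro eq_card_imp_inj_on) auto
  then show ?thesis using img by (simp add: bij_betw_def)
qed

lemma mat_trace_similar:
  fixes A :: "'a :: comm_ring_1 mat"
  assumes "similar_mat_wit A B V W"
  shows "mat_trace A = mat_trace B"
proof -
  obtain n where c: "A \<in> carrier_mat n n" "B \<in> carrier_mat n n" "V \<in> carrier_mat n n" "W \<in> carrier_mat n n"
    "W * V = 1\<^sub>m n" "A = V * B * W"
    using assms unfolding similar_mat_wit_def Let_def by blast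
  have "mat_trace A = mat_trace (W * (V * B))"
    unfolding c(6) using c by (intro mat_trace_mult_commute[of _ n n]) (auto simp: mult_carrier_mat[of _ n n])
  also have "W * (V * B) = W * V * B" by (rule assoc_mult_mat[symmetric, of _ n n _ n _ n]) (use c in auto)
  also have "\<dots> = B" unfolding c(5) using c by simp
  finally show ?thesis .
qed

lemma upper_triangular_pow_diag:
  fixes B :: "'a :: comm_ring_1 mat"
  assumes B: "B \<in> carrier_mat n n" "upper_triangular B"
  shows "upper_triangular (B ^\<^sub>m k) \<and> (\<forall>i<n. (B ^\<^sub>m k) $$ (i, i) = (B $$ (i, i)) ^ k)"
proof (induction k)
  case 0
  then show ?case using B by auto
next
  case (Suc k)
  have Bk: "B ^\<^sub>m k \<in> carrier_mat n n" using B by simp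
  have ix: "(B ^\<^sub>m Suc k) $$ (i, j) = (\<Sum>l<n. (B ^\<^sub>m k) $$ (i, l) * B $$ (l, j))" if "i < n" "j < n" for i j
    using index_mult_mat_sum[OF Bk B(1) that] by simp
  have low: "B $$ (i, j) = 0" "(B ^\<^sub>m k) $$ (i, j) = 0" if "j < i" "i < n" for i j
    using that B Suc Bk upper_triangularD by (metis carrier_matD(1))+
  have "(B ^\<^sub>m Suc k) $$ (i, j) = 0" if "j < i" "i < n" for i j
  proof -
    have "(B ^\<^sub>m k) $$ (i, l) * B $$ (l, j) = 0" if l: "l < n" for l
    proof (cases "l < i")
      case True then show ?thesis using low(2)[OF True \<open>i < n\<close>] by simp
    next
      case False
      then have "j < l" using \<open>j < i\<close> by simp
      then show ?thesis using low(1)[OF _ l] by simp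
    qed
    moreover have "j < n" using that by simp
    ultimately show ?thesis using ix[OF \<open>i < n\<close>] by (simp add: sum.neutral)
  qed
  then have "upper_triangular (B ^\<^sub>m Suc k)" using B by (intro upper_triangularI) simp
  moreover have "(B ^\<^sub>m Suc k) $$ (i, i) = (B $$ (i, i)) ^ Suc k" if i: "i < n" for i
  proof -
    have "(B ^\<^sub>m Suc k) $$ (i, i) = (\<Sum>l<n. if l = i then (B $$ (i, i)) ^ Suc k else 0)"
      unfolding ix[OF i i]
    proof (rule sum.cong[OF refl])
      fix l assume "l \<in> {..<n}"
      then have l: "l < n" by simp
      show "(B ^\<^sub>m k) $$ (i, l) * B $$ (l, i) = (if l = i then (B $$ (i, i)) ^ Suc k else 0)"
        using low(2)[of l i] low(1)[of i l] Suc i l by (cases "l = i"; cases "l < i") (auto simp: mult.commute)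
    qed
    then show ?thesis using i by simp
  qed
  ultimately show ?case by blast
qed

text \<open>A Schur form carries \<open>es\<close> on its diagonal, and powers of a triangular
  matrix have the powers of that diagonal.\<close>

lemma mat_trace_pow_eigenvalues:
  fixes K :: "complex mat"
  assumes K: "K \<in> carrier_mat n n" and es: "char_poly K = (\<Prod>e\<leftarrow>es. [:- e, 1:])"
  shows "mat_trace (K ^\<^sub>m k) = (\<Sum>e\<leftarrow>es. e ^ k)"
proof -
  obtain B V W where sd: "schur_decomposition K es = (B, V, W)" by (metis prod_cases3)
  note S = schur_decomposition[OF K es sd]
  have B: "B \<in> carrier_mat n n" using S K unfolding similar_mat_wit_def Let_def by auto
  have "mat_trace (K ^\<^sub>m k) = mat_trace (B ^\<^sub>m k)"
    using S by (intro mat_trace_similar[OF similar_mat_wit_pow]) blast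
  also have "\<dots> = (\<Sum>i<n. (B $$ (i, i)) ^ k)"
    using upper_triangular_pow_diag[OF B, of k] S B by (simp add: mat_trace_def)
  also have "\<dots> = (\<Sum>e\<leftarrow>diag_mat B. e ^ k)"
    using B by (simp add: diag_mat_def sum_list_sum_nth atLeast0LessThan comp_def)
  finally show ?thesis using S by simp
qed

text \<open>Sylvester's identity. The block matrix \<open>?L\<close> is made triangular in two ways,
  by \<open>?R1\<close> from the right and by \<open>?R2\<close> from the left; its determinant thus
  expresses both characteristic polynomials.\<close>

lemma char_poly_mult_commute:
  fixes A B :: "complex mat"
  assumes A: "A \<in> carrier_mat n m" and B: "B \<in> carrier_mat m n"
  shows "[:0, 1:] ^ m * char_poly (A * B) = [:0, 1:] ^ n * char_poly (B * A)"
proof -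
  interpret h: comm_ring_hom "\<lambda>a :: complex. [:a:]" by standard auto
  let ?X = "\<lambda>k. [:0, 1:] \<cdot>\<^sub>m 1\<^sub>m k :: complex poly mat"
  let ?A = "map_mat (\<lambda>a. [:a:]) A" and ?B = "map_mat (\<lambda>a. [:a:]) B"
  have c: "?A \<in> carrier_mat n m" "?B \<in> carrier_mat m n" "?X k \<in> carrier_mat k k" for k using A B by auto
  have cp: "char_poly_matrix (A' * B') = ?X k + (- (map_mat (\<lambda>a. [:a:]) A' * map_mat (\<lambda>a. [:a:]) B'))"
    if "A' \<in> carrier_mat k l" "B' \<in> carrier_mat l k" for A' B' k l
    unfolding h.mat_hom_mult[OF that, symmetric] char_poly_matrix_def
    using that by (intro eq_matI) auto
  let ?L = "four_block_mat (?X n) ?A ?B (1\<^sub>m m)"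
  let ?R1 = "four_block_mat (1\<^sub>m n) (0\<^sub>m n m) (- ?B) (1\<^sub>m m)"
  let ?R2 = "four_block_mat (1\<^sub>m n) (0\<^sub>m n m) (- ?B) (?X m)"
  have L: "?L \<in> carrier_mat (n + m) (n + m)" and R1: "?R1 \<in> carrier_mat (n + m) (n + m)"
    and R2: "?R2 \<in> carrier_mat (n + m) (n + m)"
    using c by (auto intro!: four_block_carrier_mat)
  have "?L * ?R1 = four_block_mat (?X n * 1\<^sub>m n + ?A * - ?B) (?X n * 0\<^sub>m n m + ?A * 1\<^sub>m m)
      (?B * 1\<^sub>m n + 1\<^sub>m m * - ?B) (?B * 0\<^sub>m n m + 1\<^sub>m m * 1\<^sub>m m)"
    using c by (intro mult_four_block_mat) auto
  also have "?X n * 1\<^sub>m n + ?A * - ?B = char_poly_matrix (A * B)"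
    unfolding cp[OF A B] using c by simp
  also have "?B * 1\<^sub>m n + 1\<^sub>m m * - ?B = 0\<^sub>m m n"
    using c by simp (rule eq_matI, auto)
  finally have LR: "?L * ?R1 = four_block_mat (char_poly_matrix (A * B)) (?X n * 0\<^sub>m n m + ?A * 1\<^sub>m m) (0\<^sub>m m n) (?B * 0\<^sub>m n m + 1\<^sub>m m * 1\<^sub>m m)" .
  have "det (?L * ?R1) = det (char_poly_matrix (A * B)) * det (?B * 0\<^sub>m n m + 1\<^sub>m m * 1\<^sub>m m)"
    unfolding LR using A B c by (intro det_four_block_mat_lower_left_zero[of _ n _ m]) (auto simp: mult_carrier_mat[of _ n m])
  moreover have "det ?R1 = det (1\<^sub>m n) * det (1\<^sub>m m)"
    using c by (intro det_four_block_mat_upper_right_zero) auto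
  ultimately have 1: "det ?L = char_poly (A * B)"
    using c det_mult[OF L R1] by (simp add: char_poly_def)
  have "?R2 * ?L = four_block_mat (1\<^sub>m n * ?X n + 0\<^sub>m n m * ?B) (1\<^sub>m n * ?A + 0\<^sub>m n m * 1\<^sub>m m)
      (- ?B * ?X n + ?X m * ?B) (- ?B * ?A + ?X m * 1\<^sub>m m)"
    using c by (intro mult_four_block_mat) auto
  also have "- ?B * ?X n + ?X m * ?B = 0\<^sub>m m n"
    using c by (simp add: mult_smult_distrib[of _ m n _ n] mult_smult_assoc_mat[of _ m m _ n])
      (rule eq_matI, auto)
  also have "- ?B * ?A + ?X m * 1\<^sub>m m = char_poly_matrix (B * A)"
    unfolding cp[OF B A] using c by (simp add: comm_add_mat[of _ m m])
  finally have RL: "?R2 * ?L = four_block_mat (1\<^sub>m n * ?X n + 0\<^sub>m n m * ?B) (1\<^sub>m n * ?A + 0\<^sub>m n m * 1\<^sub>m m) (0\<^sub>m m n) (char_poly_matrix (B * A))" .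
  have "det (?R2 * ?L) = det (1\<^sub>m n * ?X n + 0\<^sub>m n m * ?B) * det (char_poly_matrix (B * A))"
    unfolding RL using A B c by (intro det_four_block_mat_lower_left_zero[of _ n _ m]) (auto simp: mult_carrier_mat[of _ m n])
  moreover have "det ?R2 = det (1\<^sub>m n) * det (?X m)"
    using c by (intro det_four_block_mat_upper_right_zero) auto
  ultimately have 2: "[:0, 1:] ^ m * det ?L = [:0, 1:] ^ n * char_poly (B * A)"
    using c det_mult[OF R2 L] by (simp add: char_poly_def)
  show ?thesis using 1 2 by simp
qed

text \<open>Compares the orders of vanishing at \<open>0\<close> in
  \<open>char_poly_mult_commute\<close>, so multiplicities are algebraic. These forced zeros account
  for what \<open>largest_eigenvalues\<close> leaves out.\<close>

lemma count_zero_proots_char_poly_mult: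
  fixes A B :: "complex mat"
  assumes A: "A \<in> carrier_mat n m" and B: "B \<in> carrier_mat m n"
  shows "n - m \<le> count (proots (char_poly (A * B))) 0"
proof -
  have deg: "monic (char_poly (A * B))" "monic (char_poly (B * A))"
    using degree_monic_char_poly[of "A * B" n] degree_monic_char_poly[of "B * A" m] A B
    by (auto simp: mult_carrier_mat[of _ n m] mult_carrier_mat[of _ m n])
  then have nz: "char_poly (A * B) \<noteq> 0" "char_poly (B * A) \<noteq> 0" by auto
  have ord: "Polynomial.order 0 ([:0, 1:] ^ k :: complex poly) = k" for k
    using order_power_n_n[of "0 :: complex" k] by simp
  have "m + Polynomial.order 0 (char_poly (A * B)) = Polynomial.order 0 ([:0, 1:] ^ m * char_poly (A * B))"
    using nz by (subst order_mult) (auto simp: ord)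
  also have "\<dots> = Polynomial.order 0 ([:0, 1:] ^ n * char_poly (B * A))"
    unfolding char_poly_mult_commute[OF A B] ..
  also have "\<dots> = n + Polynomial.order 0 (char_poly (B * A))"
    using nz by (subst order_mult) (auto simp: ord)
  finally have "n \<le> m + Polynomial.order 0 (char_poly (A * B))" by simp
  then show ?thesis using nz by simp
qed

text \<open>A nonzero entry beyond the first \<open>m\<close> would, by the ordering, make the first
  \<open>m + 1\<close> entries positive and leave room for fewer than \<open>size X - m\<close>
  zeros. So only zeros are dropped.\<close>

lemma sum_list_take_largest:
  fixes f :: "real \<Rightarrow> 'b :: comm_monoid_add" and X :: "real multiset"
  assumes nonneg: "\<And>x. x \<in># X \<Longrightarrow> 0 \<le> x" and count: "size X - m \<le> count X 0" and f0: "f 0 = 0"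
  shows "(\<Sum>x\<leftarrow>take m (rev (sorted_list_of_multiset X)). f x) = (\<Sum>x\<in>#X. f x)"
proof -
  let ?xs = "rev (sorted_list_of_multiset X)"
  have mset: "mset ?xs = X" by simp
  have sorted: "sorted (rev ?xs)" by simp
  have zero: "x = 0" if x: "x \<in> set (drop m ?xs)" for x
  proof (rule ccontr)
    assume "x \<noteq> 0"
    obtain i where i: "i < length ?xs - m" "x = ?xs ! (m + i)"
      using x by (auto simp: in_set_conv_nth)
    have "x \<in># X" using in_set_dropD[OF x] mset by (metis set_mset_mset)
    then have "0 < x" using nonneg \<open>x \<noteq> 0\<close> by force
    have pos: "0 < y" if y: "y \<in> set (take (Suc m) ?xs)" for y
    proof -
      obtain k where k: "k < Suc m" "k < length ?xs" "y = ?xs ! k"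
        using y by (auto simp: in_set_conv_nth)
      have "?xs ! (m + i) \<le> ?xs ! k" using k i by (intro sorted_rev_nth_mono[OF sorted]) auto
      then show ?thesis using \<open>0 < x\<close> i k by simp
    qed
    have "count X 0 = count (mset (take (Suc m) ?xs @ drop (Suc m) ?xs)) 0"
      by (simp only: append_take_drop_id mset)
    also have "\<dots> = count (mset (take (Suc m) ?xs)) 0 + count (mset (drop (Suc m) ?xs)) 0"
      by (simp only: mset_append count_union)
    also have "count (mset (take (Suc m) ?xs)) 0 = 0"
      using pos by (metis count_eq_zero_iff less_irrefl set_mset_mset)
    also have "count (mset (drop (Suc m) ?xs)) 0 \<le> length (drop (Suc m) ?xs)"
      by (metis count_le_size size_mset)
    finally have "count X 0 \<le> length ?xs - Suc m" by simp
    moreover have "length ?xs = size X" by (metis mset size_mset)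
    ultimately show False using count i by simp
  qed
  have "(\<Sum>x\<in>#X. f x) = (\<Sum>x\<leftarrow>?xs. f x)"
    by (metis mset mset_map sum_mset_sum_list)
  also have "\<dots> = (\<Sum>x\<leftarrow>take m ?xs @ drop m ?xs. f x)" by simp
  also have "\<dots> = (\<Sum>x\<leftarrow>take m ?xs. f x) + (\<Sum>x\<leftarrow>drop m ?xs. f x)"
    by (simp only: map_append sum_list_append)
  also have "(\<Sum>x\<leftarrow>drop m ?xs. f x) = (\<Sum>x\<leftarrow>drop m ?xs. 0)"
  proof (intro arg_cong[where f = sum_list] map_cong refl)
    show "f x = 0" if "x \<in> set (drop m ?xs)" for x using zero[OF that] f0 by simp
  qed
  finally show ?thesis by simp
qed

lemma cheb_of_real: "cheb (of_real u) (of_real w) k (of_real x) = (of_real (cheb u w k x) :: complex)" for u w x :: real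
  by (induction k rule: induct_nat_012) simp_all

section \<open>The restricted matrix as a compression of the rotated projection\<close>

locale restriction =
  fixes n :: nat and A :: "complex mat" and S T :: "nat set"
  assumes A: "A \<in> unitary_group n" and S: "S \<subseteq> {..<n}" and T: "T \<subseteq> {..<n}"
begin

abbreviation "P \<equiv> coord_proj n S"
abbreviation "G \<equiv> rot_proj n A T"

definition "N = submatrix A S T"
definition "K = N * mat_adjoint N"

lemma Ac: "A \<in> carrier_mat n n" using A by (rule unitary_group_carrier)

lemma bij: "bij_betw (pick S) {..<card S} S" "bij_betw (pick T) {..<card T} T"
  using S T finite_subset by (auto intro!: bij_betw_pick)

lemma pick: "i < card S \<Longrightarrow> pick S i \<in> S" "i < card S \<Longrightarrow> pick S i < n"
  "i < card T \<Longrightarrow> pick T i \<in> T" "i < card T \<Longrightarrow> pick T i < n"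
  using bij[THEN bij_betwE] S T by auto

lemma pick_eq: "i < card S \<Longrightarrow> j < card S \<Longrightarrow> pick S i = pick S j \<longleftrightarrow> i = j"
  using bij(1) by (auto simp: bij_betw_def inj_on_def)

lemma cards: "{i. i < dim_row A \<and> i \<in> S} = S" "{j. j < dim_col A \<and> j \<in> T} = T"
  using Ac S T by auto

lemma N_carrier: "N \<in> carrier_mat (card S) (card T)"
  unfolding N_def by (rule carrier_matI) (simp_all add: dim_submatrix cards)

lemma N_index: "i < card S \<Longrightarrow> j < card T \<Longrightarrow> N $$ (i, j) = A $$ (pick S i, pick T j)"
  unfolding N_def by (subst submatrix_index) (simp_all add: cards)

lemma K_carrier: "K \<in> carrier_mat (card S) (card S)"
  using N_carrier mult_carrier_mat[OF N_carrier mat_adjoint_carrier[OF N_carrier]] by (simp add: K_def)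

lemma sum_T: "(\<Sum>t<n. f t * indicator T t * g t) = (\<Sum>j<card T. f (pick T j) * g (pick T j))"
  for f g :: "nat \<Rightarrow> complex"
proof -
  have "(\<Sum>t<n. f t * indicator T t * g t) = (\<Sum>t\<in>T. f t * g t)"
    using T by (intro sum.mono_neutral_cong_right) (auto simp: indicator_def)
  also have "\<dots> = (\<Sum>j<card T. f (pick T j) * g (pick T j))"
    by (rule sum.reindex_bij_betw[OF bij(2), symmetric])
  finally show ?thesis .
qed

lemma K_index:
  assumes "i < card S" "j < card S"
  shows "K $$ (i, j) = G $$ (pick S i, pick S j)"
proof -
  have "K $$ (i, j) = (\<Sum>k<card T. A $$ (pick S i, pick T k) * cnj (A $$ (pick S j, pick T k)))"
    unfolding K_def index_mult_mat_sum[OF N_carrier mat_adjoint_carrier[OF N_carrier] assms]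
    using assms N_carrier by (intro sum.cong) (auto simp: N_index)
  also have "\<dots> = G $$ (pick S i, pick S j)"
    unfolding rot_proj_index[OF Ac pick(2)[OF assms(1)] pick(2)[OF assms(2)]] sum_T ..
  finally show ?thesis .
qed

text \<open>Inclusion of the coordinate subspace of \<open>S\<close> and the projection back onto
  it. As \<open>E * F = P\<close> and \<open>K = F * G * E\<close>, cyclicity of the trace turns
  powers of \<open>K\<close> into alternating words in \<open>P\<close> and
  \<open>G\<close>.\<close>

definition "E = Matrix.mat n (card S) (\<lambda>(i, a). if i = pick S a then 1 else 0 :: complex)"
definition "F = Matrix.mat (card S) n (\<lambda>(a, i). if i = pick S a then 1 else 0 :: complex)"

lemma E_carrier: "E \<in> carrier_mat n (card S)" and F_carrier: "F \<in> carrier_mat (card S) n"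
  by (simp_all add: E_def F_def)

lemma EF: "E * F = P"
proof (rule eq_matI)
  fix i j assume "i < dim_row P" "j < dim_col P"
  then have ij: "i < n" "j < n" by (simp_all add: coord_proj_def)
  have "(E * F) $$ (i, j) = (\<Sum>a<card S. if i = pick S a \<and> j = pick S a then 1 else 0)"
    unfolding index_mult_mat_sum[OF E_carrier F_carrier ij]
    using ij by (intro sum.cong) (auto simp: E_def F_def)
  also have "\<dots> = (\<Sum>s\<in>S. if i = s \<and> j = s then 1 else 0)"
    by (rule sum.reindex_bij_betw[OF bij(1)])
  also have "\<dots> = (\<Sum>s\<in>S. if s = i then (if i = j then 1 else 0) else 0)"
    by (intro sum.cong) auto
  also have "\<dots> = (if i = j \<and> i \<in> S then 1 else 0)"
    using S finite_subset[OF S] by (simp add: sum.delta)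
  finally show "(E * F) $$ (i, j) = P $$ (i, j)" using ij by (simp add: coord_proj_def)
qed (simp_all add: E_def F_def coord_proj_def)

lemma K_eq: "K = F * G * E"
proof (rule eq_matI)
  have Gc: "G \<in> carrier_mat n n" using Ac by simp
  have FG: "F * G \<in> carrier_mat (card S) n" by (rule mult_carrier_mat[OF F_carrier Gc])
  fix i j assume "i < dim_row (F * G * E)" "j < dim_col (F * G * E)"
  then have ij: "i < card S" "j < card S" by (simp_all add: E_def F_def)
  have FGi: "(F * G) $$ (i, k) = G $$ (pick S i, k)" if k: "k < n" for k
  proof -
    have "(F * G) $$ (i, k) = (\<Sum>l<n. if l = pick S i then G $$ (pick S i, k) else 0)"
      unfolding index_mult_mat_sum[OF F_carrier Gc ij(1) k]
      using ij by (intro sum.cong) (auto simp: F_def)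
    then show ?thesis using pick(2)[OF ij(1)] by simp
  qed
  have "(F * G * E) $$ (i, j) = (\<Sum>k<n. if k = pick S j then G $$ (pick S i, pick S j) else 0)"
    unfolding index_mult_mat_sum[OF FG E_carrier ij]
    using ij FGi by (intro sum.cong) (auto simp: E_def)
  also have "\<dots> = K $$ (i, j)" using pick(2)[OF ij(2)] K_index[OF ij] by simp
  finally show "K $$ (i, j) = (F * G * E) $$ (i, j)" ..
qed (use K_carrier in \<open>simp_all add: E_def F_def\<close>)

sublocale tp: two_projections n P G a b for a b
  by unfold_locales (use Ac coord_proj_idem rot_proj_idem[OF A] in auto)

lemma mat_trace_K_pow: "mat_trace (K ^\<^sub>m Suc j) = mat_trace ((P * G) ^\<^sub>m Suc j)"
proof -
  have Gc: "G \<in> carrier_mat n n" and Pc: "P \<in> carrier_mat n n" using Ac by simp_all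
  have GP: "(G * P) ^\<^sub>m j \<in> carrier_mat n n" for j using Gc by (simp add: mult_carrier_mat[of _ n n])
  have eq: "K ^\<^sub>m Suc j = F * (((G * P) ^\<^sub>m j * G) * E)"
  proof (induction j)
    case 0
    have "K ^\<^sub>m Suc 0 = F * G * E" using K_carrier by (simp add: K_eq[symmetric] left_mult_one_mat[of _ "card S" "card S"])
    also have "\<dots> = F * (G * E)" by (rule assoc_mult_mat[OF F_carrier Gc E_carrier])
    finally show ?case using Gc by (simp add: left_mult_one_mat[of _ n n])
  next
    case (Suc j)
    let ?X = "(G * P) ^\<^sub>m j * G"
    have X: "?X \<in> carrier_mat n n" using GP Gc by (simp add: mult_carrier_mat[of _ n n])
    have XE: "?X * E \<in> carrier_mat n (card S)" by (rule mult_carrier_mat[OF X E_carrier])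
    have GE: "G * E \<in> carrier_mat n (card S)" by (rule mult_carrier_mat[OF Gc E_carrier])
    have "K ^\<^sub>m Suc (Suc j) = F * (?X * E) * (F * (G * E))"
      using Suc assoc_mult_mat[OF F_carrier Gc E_carrier] by (simp add: K_eq[symmetric])
    also have "\<dots> = F * (?X * E * (F * (G * E)))"
      by (rule assoc_mult_mat[OF F_carrier XE mult_carrier_mat[OF F_carrier GE]])
    also have "?X * E * (F * (G * E)) = ?X * (E * (F * (G * E)))"
      by (rule assoc_mult_mat[OF X E_carrier mult_carrier_mat[OF F_carrier GE]])
    also have "E * (F * (G * E)) = P * (G * E)"
      unfolding EF[symmetric] by (rule assoc_mult_mat[OF E_carrier F_carrier GE, symmetric])
    also have "\<dots> = P * G * E"
      by (rule assoc_mult_mat[OF Pc Gc E_carrier, symmetric])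
    also have "?X * (P * G * E) = ?X * (P * G) * E"
      by (rule assoc_mult_mat[OF X mult_carrier_mat[OF Pc Gc] E_carrier, symmetric])
    also have "?X * (P * G) = (G * P) ^\<^sub>m Suc j * G"
      using Gc Pc GP by (simp add: assoc_mult_mat[of _ n n _ n _ n] mult_carrier_mat[of _ n n])
    finally show ?case .
  qed
  let ?X = "(G * P) ^\<^sub>m j * G"
  have X: "?X \<in> carrier_mat n n" using GP Gc by (simp add: mult_carrier_mat[of _ n n])
  have "mat_trace (K ^\<^sub>m Suc j) = mat_trace (?X * E * F)"
    unfolding eq by (rule mat_trace_mult_commute[OF F_carrier mult_carrier_mat[OF X E_carrier]])
  also have "?X * E * F = ?X * P"
    using assoc_mult_mat[OF X E_carrier F_carrier] by (simp only: EF)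
  also have "?X * P = (G * P) ^\<^sub>m Suc j"
    using Gc Pc GP by (simp add: assoc_mult_mat[of _ n n _ n _ n] mult_carrier_mat[of _ n n])
  finally show ?thesis using tp.trace_GP_pow[of j] tp.y_def[of "Suc j"] by simp
qed

text \<open>A Rayleigh quotient: \<open>h\<close> is the adjoint of \<open>A\<close> applied to the
  eigenvector extended by zeros. Its squared norm is that of \<open>v\<close> by unitarity, and the
  part of it carried by \<open>T\<close> is \<open>x\<close> times this. So \<open>x\<close> is a
  proportion, which gives reality and both bounds at once.\<close>

lemma K_eigenvalue_bounds:
  assumes ev: "eigenvalue K x"
  shows "x = of_real (Re x) \<and> 0 \<le> Re x \<and> Re x \<le> 1"
proof -
  let ?s = "card S"
  obtain v where v: "v \<in> carrier_vec ?s" "v \<noteq> 0\<^sub>v ?s" "K *\<^sub>v v = x \<cdot>\<^sub>v v"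
    using ev K_carrier by (auto simp: eigenvalue_def eigenvector_def)
  define h where "h t = (\<Sum>i<?s. cnj (A $$ (pick S i, t)) * v $ i)" for t
  define V where "V = (\<Sum>i<?s. (norm (v $ i))\<^sup>2)"
  have hh: "complex_of_real ((norm (h t))\<^sup>2) = (\<Sum>i<?s. \<Sum>j<?s. cnj (v $ i) * v $ j * (A $$ (pick S i, t) * cnj (A $$ (pick S j, t))))" for t
  proof -
    have "complex_of_real ((norm (h t))\<^sup>2) = cnj (h t) * h t"
      unfolding complex_norm_square by (rule mult.commute)
    then show ?thesis unfolding h_def cnj_sum sum_product
      by (simp only: complex_cnj_mult complex_cnj_cnj mult_ac)
  qed
  have Vpos: "0 < V"
  proof -
    obtain i where "i < ?s" "v $ i \<noteq> 0"
      using v(1,2) by (metis carrier_vecD eq_vecI index_zero_vec(1) index_zero_vec(2))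
    then have "0 < (norm (v $ i))\<^sup>2" by simp
    also have "\<dots> \<le> V" unfolding V_def using \<open>i < ?s\<close> by (intro member_le_sum) auto
    finally show ?thesis .
  qed
  have "complex_of_real (\<Sum>t<n. (norm (h t))\<^sup>2) =
     (\<Sum>t<n. \<Sum>i<?s. \<Sum>j<?s. cnj (v $ i) * v $ j * (A $$ (pick S i, t) * cnj (A $$ (pick S j, t))))"
    by (simp only: of_real_sum hh)
  also have "\<dots> = (\<Sum>i<?s. \<Sum>j<?s. \<Sum>t<n. cnj (v $ i) * v $ j * (A $$ (pick S i, t) * cnj (A $$ (pick S j, t))))"
    by (subst sum.swap) (intro sum.cong refl sum.swap)
  also have "\<dots> = (\<Sum>i<?s. \<Sum>j<?s. if j = i then cnj (v $ i) * v $ i else 0)"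
  proof (intro sum.cong refl)
    fix i j assume "i \<in> {..<?s}" "j \<in> {..<?s}"
    then have ij: "i < ?s" "j < ?s" by auto
    show "(\<Sum>t<n. cnj (v $ i) * v $ j * (A $$ (pick S i, t) * cnj (A $$ (pick S j, t)))) = (if j = i then cnj (v $ i) * v $ i else 0)"
      unfolding sum_distrib_left[symmetric] unitary_group_row[OF A pick(2)[OF ij(1)] pick(2)[OF ij(2)]]
      using pick_eq[OF ij] by auto
  qed
  also have "\<dots> = complex_of_real V"
    unfolding V_def of_real_sum complex_norm_square by (simp add: mult.commute)
  finally have total: "(\<Sum>t<n. (norm (h t))\<^sup>2) = V" by (simp only: of_real_eq_iff)
  have "complex_of_real (\<Sum>t\<in>T. (norm (h t))\<^sup>2) =
     (\<Sum>t\<in>T. \<Sum>i<?s. \<Sum>j<?s. cnj (v $ i) * v $ j * (A $$ (pick S i, t) * cnj (A $$ (pick S j, t))))"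
    by (simp only: of_real_sum hh)
  also have "\<dots> = (\<Sum>i<?s. \<Sum>j<?s. \<Sum>t\<in>T. cnj (v $ i) * v $ j * (A $$ (pick S i, t) * cnj (A $$ (pick S j, t))))"
    by (subst sum.swap) (intro sum.cong refl sum.swap)
  also have "\<dots> = (\<Sum>i<?s. \<Sum>j<?s. cnj (v $ i) * (K $$ (i, j) * v $ j))"
  proof (intro sum.cong refl)
    fix i j assume "i \<in> {..<?s}" "j \<in> {..<?s}"
    then have ij: "i < ?s" "j < ?s" by auto
    have "(\<Sum>t\<in>T. A $$ (pick S i, t) * cnj (A $$ (pick S j, t))) = K $$ (i, j)"
      unfolding K_index[OF ij] rot_proj_index[OF Ac pick(2)[OF ij(1)] pick(2)[OF ij(2)]]
      using T by (intro sum.mono_neutral_cong_left) (auto simp: indicator_def)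
    then show "(\<Sum>t\<in>T. cnj (v $ i) * v $ j * (A $$ (pick S i, t) * cnj (A $$ (pick S j, t)))) = cnj (v $ i) * (K $$ (i, j) * v $ j)"
      by (simp add: sum_distrib_left[symmetric])
  qed
  also have "\<dots> = (\<Sum>i<?s. cnj (v $ i) * (x * v $ i))"
  proof (rule sum.cong[OF refl])
    fix i assume "i \<in> {..<?s}"
    then have i: "i < ?s" by simp
    have "(\<Sum>j<?s. K $$ (i, j) * v $ j) = (K *\<^sub>v v) $ i"
      using i K_carrier v(1) by (auto simp: scalar_prod_def atLeast0LessThan)
    also have "\<dots> = x * v $ i" unfolding v(3) using i v(1) by simp
    finally show "(\<Sum>j<?s. cnj (v $ i) * (K $$ (i, j) * v $ j)) = cnj (v $ i) * (x * v $ i)"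
      by (simp add: sum_distrib_left[symmetric])
  qed
  also have "\<dots> = x * complex_of_real V"
    unfolding V_def of_real_sum complex_norm_square sum_distrib_left by (intro sum.cong) (auto simp: mult_ac)
  finally have part: "complex_of_real (\<Sum>t\<in>T. (norm (h t))\<^sup>2) = x * complex_of_real V" .
  have "x = complex_of_real ((\<Sum>t\<in>T. (norm (h t))\<^sup>2) / V)"
    using part Vpos by (simp add: field_simps)
  moreover have "(\<Sum>t\<in>T. (norm (h t))\<^sup>2) \<le> V"
    unfolding total[symmetric] using T by (intro sum_mono2) auto
  moreover have "0 \<le> (\<Sum>t\<in>T. (norm (h t))\<^sup>2)" by (intro sum_nonneg) auto
  ultimately show ?thesis using Vpos by simp
qed

definition "evs = largest_eigenvalues (min (card T) (card S)) K"

lemma restriction_law_eq: "restriction_law A S T = empirical_distribution evs"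
  by (simp add: restriction_law_def evs_def K_def N_def)

lemma evs_properties:
  shows length_evs: "length evs = min (card T) (card S)"
    and evs_bounds: "x \<in> set evs \<Longrightarrow> 0 \<le> x \<and> x \<le> 1"
    and mat_trace_evs: "mat_trace ((P * G) ^\<^sub>m Suc j) = (\<Sum>x\<leftarrow>map complex_of_real evs. x ^ Suc j)"
proof -
  let ?R = "proots (char_poly K)"
  let ?X = "image_mset Re ?R"
  have nz: "char_poly K \<noteq> 0" and deg: "degree (char_poly K) = card S"
    using degree_monic_char_poly[OF K_carrier] by auto
  have size: "size ?X = card S" using deg by (simp add: size_proots_complex)
  show "length evs = min (card T) (card S)"
    using size by (simp add: evs_def largest_eigenvalues_def) (metis size_mset mset_sorted_list_of_multiset size_image_mset min.assoc min.commute min.idem)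
  have root: "x = of_real (Re x) \<and> 0 \<le> Re x \<and> Re x \<le> 1" if "x \<in># ?R" for x
    using that nz eigenvalue_root_char_poly[OF K_carrier] by (intro K_eigenvalue_bounds) simp
  show "0 \<le> x \<and> x \<le> 1" if "x \<in> set evs"
  proof -
    have "x \<in> set (rev (sorted_list_of_multiset ?X))"
      using that unfolding evs_def largest_eigenvalues_def by (rule in_set_takeD)
    then show ?thesis using root by auto
  qed
  obtain es where es: "char_poly K = (\<Prod>e\<leftarrow>es. [:- e, 1:])" using char_poly_factorized[OF K_carrier] by auto
  have "?R = mset es"
  proof -
    have "?R = sum_list (map proots (map (\<lambda>e. [:- e, 1:]) es))"
    proof -
      have "0 \<notin> set (map (\<lambda>e. [:- e, 1:]) es)" by auto
      from proots_prod_list[OF this] show ?thesis unfolding es by (simp add: comp_def)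
    qed
    also have "\<dots> = mset es" by (induction es) auto
    finally show ?thesis .
  qed
  have "mat_trace ((P * G) ^\<^sub>m Suc j) = (\<Sum>e\<leftarrow>es. e ^ Suc j)"
    unfolding mat_trace_K_pow[symmetric] by (rule mat_trace_pow_eigenvalues[OF K_carrier es])
  also have "\<dots> = (\<Sum>e\<in>#?R. e ^ Suc j)"
    unfolding \<open>?R = mset es\<close> by (metis mset_map sum_mset_sum_list)
  also have "\<dots> = (\<Sum>e\<in>#?R. complex_of_real (Re e) ^ Suc j)"
    using root by (intro arg_cong[where f = sum_mset] image_mset_cong) metis
  also have "\<dots> = (\<Sum>x\<in>#?X. complex_of_real x ^ Suc j)"
    by (simp add: image_mset.compositionality comp_def)
  \<comment> \<open>The discarded eigenvalues are zeros forced by the shape of \<open>N\<close>, and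
    positive powers do not see them.\<close>
  also have "\<dots> = (\<Sum>x\<leftarrow>evs. complex_of_real x ^ Suc j)"
    unfolding evs_def largest_eigenvalues_def
  proof (rule sum_list_take_largest[symmetric])
    show "0 \<le> x" if "x \<in># ?X" for x using that root by auto
    have count_le: "count R 0 \<le> count (image_mset Re R) 0" for R
      by (induction R) auto
    have "card S - card T \<le> count ?R 0"
      unfolding K_def by (rule count_zero_proots_char_poly_mult[OF N_carrier mat_adjoint_carrier[OF N_carrier]])
    also have "count ?R 0 \<le> count ?X 0"
      using count_le[of ?R] .
    finally show "size ?X - min (card T) (card S) \<le> count ?X 0"
      using size by (simp add: min_def)
  qed simp
  finally show "mat_trace ((P * G) ^\<^sub>m Suc j) = (\<Sum>x\<leftarrow>map complex_of_real evs. x ^ Suc j)"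
    by (simp add: comp_def)
qed

text \<open>The case \<open>j = 0\<close> of the trace formula, where \<open>0 ^ j = 1\<close> keeps
  all corrections. The number of zeros kept in the list is immaterial: one more zero would add
  \<open>cheb c D k 0\<close>, which is exactly what the two terms with \<open>length evs\<close>
  would lose.\<close>

theorem walk_sum_eq_sum_evs:
  fixes a b :: real
  assumes k: "k \<ge> 1"
  shows "walk_sum n k a b A S T = of_real (
    (\<Sum>x\<leftarrow>evs. cheb (a + b - 2 * a * b) (a * (1 - a) * b * (1 - b)) k x)
    + (real n - real (card S) - real (card T)) * (a * b) ^ k
    + (real (card T) - real (length evs)) * (- (a * (1 - b))) ^ k
    + (real (card S) - real (length evs)) * (- ((1 - a) * b)) ^ k)"
proof -
  let ?c = "a + b - 2 * a * b" and ?D = "a * (1 - a) * b * (1 - b)"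
  have *: "tp.y (Suc j) = (\<Sum>x\<leftarrow>map complex_of_real evs. x ^ Suc j)" for j
    unfolding tp.y_def by (rule mat_trace_evs)
  have cD: "tp.c (complex_of_real a) (complex_of_real b) = of_real ?c"
    "tp.D (complex_of_real a) (complex_of_real b) = of_real ?D"
    by (simp_all add: tp.c_def tp.D_def)
  have sum_cheb: "(\<Sum>x\<leftarrow>map complex_of_real xs. x ^ 0 * cheb (of_real ?c) (of_real ?D) k x) = of_real (\<Sum>x\<leftarrow>xs. cheb ?c ?D k x)" for xs
    by (induction xs) (simp_all only: list.map sum_list.Nil sum_list.Cons power_0 mult_1 cheb_of_real of_real_add of_real_0)
  have M: "tp.M a b \<in> carrier_mat n n" by simp
  have "walk_sum n k a b A S T = mat_trace (tp.M a b ^\<^sub>m k)"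
    unfolding tp.M_def by (rule mat_trace_centred_product_pow[OF A k, symmetric])
  also have "\<dots> = mat_trace (tp.M a b ^\<^sub>m k * tp.C ^\<^sub>m 0)"
    using M by (simp add: right_mult_one_mat[of _ n n])
  also have "\<dots> = (\<Sum>x\<leftarrow>map complex_of_real evs. x ^ 0 * cheb (tp.c a b) (tp.D a b) k x)
    + (of_nat n - mat_trace P - mat_trace G) * (a * b) ^ k
    + 0 ^ 0 * ((mat_trace G - of_nat (length (map complex_of_real evs))) * (- (a * (1 - b))) ^ k
             + (mat_trace P - of_nat (length (map complex_of_real evs))) * (- ((1 - a) * b)) ^ k)"
    by (subst tp.trace_M_pow_C_pow[OF *]) simp
  also have "(\<Sum>x\<leftarrow>map complex_of_real evs. x ^ 0 * cheb (tp.c a b) (tp.D a b) k x) = of_real (\<Sum>x\<leftarrow>evs. cheb ?c ?D k x)"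
    unfolding cD sum_cheb ..
  finally show ?thesis
    by (simp add: mat_trace_coord_proj[OF S] mat_trace_rot_proj[OF A T] algebra_simps)
qed

end

section \<open>The limit law\<close>

text \<open>For \<open>r = 1\<close> the quotient would be \<open>0 / 0\<close>, hence \<open>0\<close>, at \<open>x = 0\<close>; the first branch is its continuous extension.\<close>

definition sin2_poisson :: "real \<Rightarrow> real \<Rightarrow> real" where
  "sin2_poisson r x = (if r = 1 then (1 + cos x) / 2 else (sin x)\<^sup>2 / (1 - 2 * r * cos x + r\<^sup>2))"

lemma sin2_poisson_denominator_pos:
  fixes r x :: real
  assumes "0 \<le> r" "r < 1"
  shows "0 < 1 - 2 * r * cos x + r\<^sup>2"
proof -
  have "1 - 2 * r * cos x + r\<^sup>2 = (1 - r)\<^sup>2 + 2 * r * (1 - cos x)" by (simp add: power2_eq_square algebra_simps)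
  moreover have "0 < (1 - r)\<^sup>2" using assms by simp
  moreover have "0 \<le> 2 * r * (1 - cos x)" using assms by (intro mult_nonneg_nonneg) auto
  ultimately show ?thesis by linarith
qed

text \<open>The form free of division holds at every point, including \<open>x = 0\<close> for
  \<open>r = 1\<close>, where the separate branch of the definition is what makes it true.\<close>

lemma sin2_poisson_mult:
  assumes "0 \<le> r" "r \<le> 1"
  shows "sin2_poisson r x * (1 - 2 * r * cos x + r\<^sup>2) = (sin x)\<^sup>2"
proof (cases "r = 1")
  case True
  have "(1 + cos x) / 2 * (1 - 2 * cos x + 1) = 1 - (cos x)\<^sup>2" by (simp add: power2_eq_square field_simps)
  then show ?thesis using True by (simp add: sin2_poisson_def sin_squared_eq)
next
  case False
  then show ?thesis using sin2_poisson_denominator_pos[of r x] assms by (simp add: sin2_poisson_def)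
qed

lemma sin2_poisson_nonneg: "0 \<le> r \<Longrightarrow> r \<le> 1 \<Longrightarrow> 0 \<le> sin2_poisson r x"
proof (cases "r = 1")
  case True
  have "0 \<le> 1 + cos x" using cos_ge_minus_one[of x] by linarith
  then show ?thesis using True by (simp add: sin2_poisson_def)
next
  case False
  moreover assume "0 \<le> r" "r \<le> 1"
  ultimately show ?thesis using sin2_poisson_denominator_pos[of r x] by (simp add: sin2_poisson_def)
qed

lemma continuous_on_sin2_poisson [continuous_intros]:
  fixes f :: "real \<Rightarrow> real"
  assumes "0 \<le> r" "r \<le> 1" "continuous_on S f"
  shows "continuous_on S (\<lambda>x. sin2_poisson r (f x))"
proof (cases "r = 1")
  case True then show ?thesis using assms unfolding sin2_poisson_def by (auto intro!: continuous_intros)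
next
  case False
  then have "1 - 2 * r * cos (f x) + r\<^sup>2 \<noteq> 0" for x using sin2_poisson_denominator_pos[of r "f x"] assms by simp
  then show ?thesis using False assms unfolding sin2_poisson_def by (auto intro!: continuous_intros)
qed

lemma has_integral_cos_nat:
  "((\<lambda>x. cos (real k * x)) has_integral (if k = 0 then pi else 0)) {0..pi}"
proof (cases "k = 0")
  case True then show ?thesis using has_integral_const_real[of "1 :: real" 0 pi] by simp
next
  case False
  have "((\<lambda>x. cos (real k * x)) has_integral (sin (real k * pi) / real k - sin (real k * 0) / real k)) {0..pi}"
    using False by (intro fundamental_theorem_of_calculus)
      (auto intro!: derivative_eq_intros simp flip: has_real_derivative_iff_has_vector_derivative)
  then show ?thesis using False by (simp add: sin_npi)
qed

definition sin2_poisson_coeff :: "real \<Rightarrow> nat \<Rightarrow> real" where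
  "sin2_poisson_coeff r k = integral {0..pi} (\<lambda>x. cos (real k * x) * sin2_poisson r x)"

lemma sin2_poisson_coeff_integrable:
  assumes "0 \<le> r" "r \<le> 1"
  shows "(\<lambda>x. cos (real k * x) * sin2_poisson r x) integrable_on {0..pi}"
  using assms by (intro integrable_continuous_real continuous_intros)

lemma cos_Suc_plus: "cos (real (Suc (Suc k)) * x) + cos (real k * x) = 2 * cos (real (Suc k) * x) * cos x"
proof -
  have "real (Suc (Suc k)) * x = real (Suc k) * x + x" "real k * x = real (Suc k) * x - x"
    by (simp_all add: algebra_simps)
  then show ?thesis by (simp only: cos_add cos_diff)
qed

lemma has_integral_cos_sin2:
  "((\<lambda>x. cos (real k * x) * (sin x)\<^sup>2) has_integral
     (if k = 0 then pi / 2 else if k = 2 then - pi / 4 else 0)) {0..pi}"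
proof -
  have sin2: "(sin x)\<^sup>2 = (1 - cos (2 * x)) / 2" for x :: real
    by (simp add: cos_double sin_squared_eq)
  show ?thesis
  proof (cases "k \<ge> 2")
    case True
    then obtain l where l: "k = l + 2" using le_Suc_ex by (metis add.commute)
    have eq: "cos (real k * x) * (sin x)\<^sup>2 = cos (real k * x) / 2 - cos (real (k + 2) * x) / 4 - cos (real l * x) / 4" for x
    proof -
      have "real (k + 2) * x = real k * x + 2 * x" "real l * x = real k * x - 2 * x"
        by (simp_all add: l algebra_simps)
      then show ?thesis unfolding sin2 by (simp only: cos_add cos_diff) (simp add: field_simps)
    qed
    show ?thesis unfolding eq
      using has_integral_diff[OF has_integral_diff[OF has_integral_divide[OF has_integral_cos_nat[of k], of 2]
            has_integral_divide[OF has_integral_cos_nat[of "k + 2"], of 4]]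
          has_integral_divide[OF has_integral_cos_nat[of l], of 4]] True l
      by (auto split: if_splits)
  next
    case False
    then consider "k = 0" | "k = 1" by linarith
    then show ?thesis
    proof cases
      case 1
      have eq: "cos (real k * x) * (sin x)\<^sup>2 = cos (real 0 * x) / 2 - cos (real 2 * x) / 2" for x
        unfolding sin2 by (simp add: 1 field_simps)
      show ?thesis unfolding eq
        using has_integral_diff[OF has_integral_divide[OF has_integral_cos_nat[of 0], of 2]
            has_integral_divide[OF has_integral_cos_nat[of 2], of 2]] 1 by simp
    next
      case 2
      have eq: "cos (real k * x) * (sin x)\<^sup>2 = cos (real 1 * x) / 4 - cos (real 3 * x) / 4" for x
      proof -
        have "real 3 * x = 2 * x + x" by simp
        then have "cos (real 3 * x) = cos (2 * x) * cos x - sin (2 * x) * sin x" by (simp only: cos_add)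
        also have "\<dots> = cos (2 * x) * cos x - 2 * (sin x)\<^sup>2 * cos x" by (simp add: sin_double power2_eq_square)
        finally show ?thesis unfolding sin2 by (simp add: 2 field_simps)
      qed
      show ?thesis unfolding eq
        using has_integral_diff[OF has_integral_divide[OF has_integral_cos_nat[of 1], of 4]
            has_integral_divide[OF has_integral_cos_nat[of 3], of 4]] 2 by simp
    qed
  qed
qed

text \<open>Integrates \<open>sin2_poisson_mult\<close> against a cosine: the factor
  \<open>cos x\<close> of the denominator shifts the frequency by one in either direction. At
  frequency \<open>0\<close> both shifts coincide, hence the separate equation.\<close>

lemma sin2_poisson_coeff_recursion:
  assumes r: "0 \<le> r" "r \<le> 1"
  shows "(1 + r\<^sup>2) * sin2_poisson_coeff r (Suc k) - r * sin2_poisson_coeff r (Suc (Suc k)) - r * sin2_poisson_coeff r k =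
     (if Suc k = 2 then - pi / 4 else 0)" (is ?rec)
    and "(1 + r\<^sup>2) * sin2_poisson_coeff r 0 - 2 * r * sin2_poisson_coeff r (Suc 0) = pi / 2" (is ?zero)
proof -
  note hi = integrable_integral[OF sin2_poisson_coeff_integrable[OF r], folded sin2_poisson_coeff_def]
  have "((\<lambda>x. (1 + r\<^sup>2) * (cos (real (Suc k) * x) * sin2_poisson r x) - r * (cos (real (Suc (Suc k)) * x) * sin2_poisson r x) - r * (cos (real k * x) * sin2_poisson r x))
    has_integral ((1 + r\<^sup>2) * sin2_poisson_coeff r (Suc k) - r * sin2_poisson_coeff r (Suc (Suc k)) - r * sin2_poisson_coeff r k)) {0..pi}"
    by (intro has_integral_diff has_integral_mult_right hi)
  moreover have "(1 + r\<^sup>2) * (cos (real (Suc k) * x) * sin2_poisson r x) - r * (cos (real (Suc (Suc k)) * x) * sin2_poisson r x) - r * (cos (real k * x) * sin2_poisson r x)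
     = cos (real (Suc k) * x) * (sin x)\<^sup>2" for x
  proof -
    have "(1 + r\<^sup>2) * (cos (real (Suc k) * x) * sin2_poisson r x) - r * (cos (real (Suc (Suc k)) * x) * sin2_poisson r x) - r * (cos (real k * x) * sin2_poisson r x)
      = (1 + r\<^sup>2) * (cos (real (Suc k) * x) * sin2_poisson r x) - r * sin2_poisson r x * (cos (real (Suc (Suc k)) * x) + cos (real k * x))"
      by (simp only: distrib_left mult_ac diff_diff_eq)
    also have "\<dots> = cos (real (Suc k) * x) * (sin2_poisson r x * (1 - 2 * r * cos x + r\<^sup>2))"
      unfolding cos_Suc_plus by (simp add: algebra_simps del: of_nat_Suc)
    finally show ?thesis unfolding sin2_poisson_mult[OF r] .
  qed
  ultimately have "((\<lambda>x. cos (real (Suc k) * x) * (sin x)\<^sup>2) has_integral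
      ((1 + r\<^sup>2) * sin2_poisson_coeff r (Suc k) - r * sin2_poisson_coeff r (Suc (Suc k)) - r * sin2_poisson_coeff r k)) {0..pi}"
    by (simp only:)
  from has_integral_unique[OF this has_integral_cos_sin2] show ?rec by simp
  have "((\<lambda>x. (1 + r\<^sup>2) * (cos (real 0 * x) * sin2_poisson r x) - 2 * r * (cos (real (Suc 0) * x) * sin2_poisson r x))
    has_integral ((1 + r\<^sup>2) * sin2_poisson_coeff r 0 - 2 * r * sin2_poisson_coeff r (Suc 0))) {0..pi}"
    by (intro has_integral_diff has_integral_mult_right hi)
  moreover have "(1 + r\<^sup>2) * (cos (real 0 * x) * sin2_poisson r x) - 2 * r * (cos (real (Suc 0) * x) * sin2_poisson r x) = cos (real 0 * x) * (sin x)\<^sup>2" for x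
  proof -
    have "(1 + r\<^sup>2) * (cos (real 0 * x) * sin2_poisson r x) - 2 * r * (cos (real (Suc 0) * x) * sin2_poisson r x) = sin2_poisson r x * (1 - 2 * r * cos x + r\<^sup>2)"
      by (simp add: algebra_simps)
    then show ?thesis unfolding sin2_poisson_mult[OF r] by simp
  qed
  ultimately have "((\<lambda>x. cos (real 0 * x) * (sin x)\<^sup>2) has_integral
      ((1 + r\<^sup>2) * sin2_poisson_coeff r 0 - 2 * r * sin2_poisson_coeff r (Suc 0))) {0..pi}"
    by (simp only:)
  from has_integral_unique[OF this has_integral_cos_sin2] show ?zero by simp
qed

text \<open>Selects the right solution of the recursion: for \<open>r < 1\<close> any other one
  grows geometrically.\<close>

lemma sin2_poisson_coeff_bounded:
  assumes r: "0 \<le> r" "r \<le> 1"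
  shows "\<bar>sin2_poisson_coeff r k\<bar> \<le> integral {0..pi} (sin2_poisson r)"
proof -
  have "norm (sin2_poisson_coeff r k) \<le> integral {0..pi} (sin2_poisson r)"
    unfolding sin2_poisson_coeff_def
  proof (rule integral_norm_bound_integral)
    show "(\<lambda>x. cos (real k * x) * sin2_poisson r x) integrable_on {0..pi}" by (rule sin2_poisson_coeff_integrable[OF r])
    show "sin2_poisson r integrable_on {0..pi}"
      using r by (intro integrable_continuous_real continuous_intros)
    show "norm (cos (real k * x) * sin2_poisson r x) \<le> sin2_poisson r x" for x
      using sin2_poisson_nonneg[OF r, of x] abs_cos_le_one[of "real k * x"]
      by (simp add: abs_mult mult_left_le_one_le)
  qed
  then show ?thesis by simp
qed

text \<open>With \<open>E k = J (k + 1) - r J k\<close> the recursion reads \<open>E (k - 1) = r E k\<close> for \<open>k \<ge> 3\<close>; as \<open>J\<close> is bounded,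
  \<open>E\<close> vanishes from index \<open>2\<close> on when \<open>r < 1\<close>.\<close>

lemma sin2_poisson_coeff_eq:
  assumes r: "0 < r" "r \<le> 1"
  shows "sin2_poisson_coeff r 0 = pi / 2" "sin2_poisson_coeff r 1 = pi / 4 * r"
    "sin2_poisson_coeff r (Suc (Suc k)) = pi / 4 * (r ^ Suc (Suc k) - r ^ k)"
proof -
  let ?J = "sin2_poisson_coeff r"
  have r0: "0 \<le> r" using r by simp
  have "?J 0 = pi / 2 \<and> ?J (Suc 0) = pi / 4 * r \<and> (\<forall>k. ?J (Suc (Suc k)) = pi / 4 * (r ^ Suc (Suc k) - r ^ k))"
  proof (cases "r = 1")
    \<comment> \<open>For \<open>r = 1\<close> there is no geometric decay to exploit, so the
      coefficients are read off from \<open>(1 + cos x) / 2\<close>. In the application this case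
      means \<open>p = q\<close> or \<open>p + q = 1\<close>, when an edge of the support is
      \<open>0\<close> or \<open>1\<close>.\<close>
    case True
    have eq: "cos (real (Suc k) * x) * sin2_poisson r x = cos (real (Suc k) * x) / 2 + (cos (real (Suc (Suc k)) * x) + cos (real k * x)) / 4" for k x
      unfolding cos_Suc_plus sin2_poisson_def using True by (simp add: field_simps del: of_nat_Suc)
    have "((\<lambda>x. cos (real (Suc k) * x) * sin2_poisson r x) has_integral
        (if Suc k = 0 then pi else 0) / 2 + ((if Suc (Suc k) = 0 then pi else 0) + (if k = 0 then pi else 0)) / 4) {0..pi}" for k
      unfolding eq by (intro has_integral_add has_integral_divide has_integral_cos_nat)
    note hJ = this
    have J: "?J (Suc k) = (if k = 0 then pi / 4 else 0)" for k
      unfolding sin2_poisson_coeff_def using integral_unique[OF hJ[of k]] by (cases "k = 0") simp_all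
    have "cos (real 0 * x) * sin2_poisson r x = cos (real 0 * x) / 2 + cos (real 1 * x) / 2" for x
      using True by (simp add: sin2_poisson_def field_simps)
    moreover have "((\<lambda>x. cos (real 0 * x) / 2 + cos (real 1 * x) / 2) has_integral
        (if (0::nat) = 0 then pi else 0) / 2 + (if (1::nat) = 0 then pi else 0) / 2) {0..pi}"
      by (intro has_integral_add has_integral_divide has_integral_cos_nat)
    ultimately have "((\<lambda>x. cos (real 0 * x) * sin2_poisson r x) has_integral pi / 2) {0..pi}" by simp
    then have "?J 0 = pi / 2" unfolding sin2_poisson_coeff_def by (rule integral_unique)
    then show ?thesis using J unfolding True by simp
  next
    case False
    then have r1: "r < 1" using r by simp
    define E where "E k = ?J (Suc k) - r * ?J k" for k
    define B where "B = integral {0..pi} (sin2_poisson r)"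
    have rec: "E k = r * E (Suc k) + (if Suc k = 2 then - pi / 4 else 0)" for k
      using sin2_poisson_coeff_recursion(1)[OF r0 r(2), of k]
      by (simp add: E_def algebra_simps power2_eq_square del: One_nat_def)
    have Ebound: "\<bar>E k\<bar> \<le> 2 * B" for k
    proof -
      have "\<bar>E k\<bar> \<le> \<bar>?J (Suc k)\<bar> + \<bar>r * ?J k\<bar>" unfolding E_def by (rule abs_triangle_ineq4)
      also have "\<bar>r * ?J k\<bar> \<le> 1 * \<bar>?J k\<bar>" unfolding abs_mult using r by (intro mult_right_mono) auto
      finally show ?thesis using sin2_poisson_coeff_bounded[OF r0 r(2), of k] sin2_poisson_coeff_bounded[OF r0 r(2), of "Suc k"]
        unfolding B_def by linarith
    qed
    have E2: "E (Suc (Suc k)) = 0" for k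
    proof -
      have pow: "E (Suc (Suc k)) = r ^ N * E (Suc (Suc k) + N)" for N
      proof (induction N)
        case (Suc N)
        have "E (Suc (Suc k) + N) = r * E (Suc (Suc k) + Suc N)" using rec[of "Suc (Suc k) + N"] by simp
        then show ?case using Suc by simp
      qed simp
      have "(\<lambda>N. r ^ N * (2 * B)) \<longlonglongrightarrow> 0 * (2 * B)"
        using r r1 by (intro tendsto_intros LIMSEQ_power_zero) auto
      moreover have "\<bar>E (Suc (Suc k))\<bar> \<le> r ^ N * (2 * B)" for N
        unfolding pow[of N] abs_mult using r Ebound by (auto intro!: mult_left_mono)
      ultimately have "\<bar>E (Suc (Suc k))\<bar> \<le> 0 * (2 * B)"
        by (intro LIMSEQ_le_const) auto
      then show ?thesis by simp
    qed
    have E1: "E 1 = - pi / 4" using rec[of 1] E2[of 0] by (simp add: numeral_2_eq_2)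
    have E0: "E 0 = - r * pi / 4" using rec[of 0] E1 by simp
    have J1: "?J (Suc 0) = r * ?J 0 - r * pi / 4" using E0 by (simp add: E_def)
    have "(1 - r\<^sup>2) * ?J 0 = (1 - r\<^sup>2) * (pi / 2)"
      using sin2_poisson_coeff_recursion(2)[OF r0 r(2)] unfolding J1 by (simp add: algebra_simps power2_eq_square)
    moreover have "1 - r\<^sup>2 \<noteq> 0" using r r1 by (simp add: power2_eq_1_iff)
    ultimately have J0: "?J 0 = pi / 2" by simp
    have J1': "?J (Suc 0) = pi / 4 * r" unfolding J1 J0 by (simp add: algebra_simps)
    have "?J (Suc (Suc k)) = pi / 4 * (r ^ Suc (Suc k) - r ^ k)" for k
    proof (induction k)
      case 0
      show ?case using E1 J1' by (simp add: E_def algebra_simps power2_eq_square)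
    next
      case (Suc k)
      show ?case using E2[of k] Suc by (simp add: E_def algebra_simps)
    qed
    then show ?thesis using J0 J1' by blast
  qed
  then show "?J 0 = pi / 2" "?J 1 = pi / 4 * r" "?J (Suc (Suc k)) = pi / 4 * (r ^ Suc (Suc k) - r ^ k)"
    by auto
qed

text \<open>Reflection of the angle multiplies \<open>cos (k * x)\<close> by
  \<open>(-1) ^ k\<close>; the reflected kernel is the one that belongs to
  \<open>1 - g\<close>.\<close>

lemma sin2_poisson_coeff_reflected:
  assumes r: "0 \<le> r" "r \<le> 1"
  shows "((\<lambda>x. cos (real k * x) * sin2_poisson r (pi - x)) has_integral ((-1) ^ k * sin2_poisson_coeff r k)) {0..pi}"
proof -
  have "((\<lambda>x. (-1) ^ k * (cos (real k * x) * sin2_poisson r x)) has_integral ((-1) ^ k * sin2_poisson_coeff r k)) {0..pi}"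
    unfolding sin2_poisson_coeff_def by (intro has_integral_mult_right integrable_integral sin2_poisson_coeff_integrable r)
  then have "((\<lambda>x. (-1) ^ k * (cos (real k * x) * sin2_poisson r x)) has_integral ((-1) ^ k * sin2_poisson_coeff r k)) (cbox 0 pi)"
    by simp
  from has_integral_affinity[OF this, of "- 1" pi]
  have "((\<lambda>x. (-1) ^ k * (cos (real k * (pi - x)) * sin2_poisson r (pi - x))) has_integral ((-1) ^ k * sin2_poisson_coeff r k)) ((\<lambda>x. pi - x) ` {0..pi})"
    by (simp add: algebra_simps)
  then have "((\<lambda>x. (-1) ^ k * (cos (real k * (pi - x)) * sin2_poisson r (pi - x))) has_integral ((-1) ^ k * sin2_poisson_coeff r k)) {0..pi}"
    by simp
  moreover have "(-1) ^ k * (cos (real k * (pi - x)) * sin2_poisson r (pi - x)) = cos (real k * x) * sin2_poisson r (pi - x)" for x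
  proof -
    have "cos (real k * (pi - x)) = cos (real k * pi) * cos (real k * x) + sin (real k * pi) * sin (real k * x)"
      by (simp only: right_diff_distrib cos_diff)
    then have "cos (real k * (pi - x)) = (-1) ^ k * cos (real k * x)" by (simp add: cos_npi sin_npi)
    then show ?thesis by (simp flip: power_add mult.assoc power_mult_distrib)
  qed
  ultimately show ?thesis by simp
qed

text \<open>The defining property of Chebyshev polynomials on the interval with centre
  \<open>c\<close> and half-width \<open>2 * s\<close>. The minus sign makes the parametrisation
  increasing on \<open>[0, pi]\<close> for positive \<open>s\<close> and is the origin of
  \<open>(- s) ^ k\<close>.\<close>

lemma cheb_cos:
  "cheb c (s * s) k (c - 2 * s * cos x) = 2 * (- s) ^ k * cos (real k * x)"
proof (induction k rule: induct_nat_012)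
  case (ge2 k)
  have "cheb c (s * s) (Suc (Suc k)) (c - 2 * s * cos x) =
    - 2 * s * cos x * (2 * (- s) ^ Suc k * cos (real (Suc k) * x)) - s * s * (2 * (- s) ^ k * cos (real k * x))"
    unfolding cheb.simps ge2 by simp
  also have "\<dots> = 2 * (- s) ^ Suc (Suc k) * (2 * cos (real (Suc k) * x) * cos x - cos (real k * x))"
    by (simp add: algebra_simps del: of_nat_Suc)
  also have "2 * cos (real (Suc k) * x) * cos x - cos (real k * x) = cos (real (Suc (Suc k)) * x)"
    using cos_Suc_plus[of k x] by linarith
  finally show ?case .
qed simp_all

section \<open>The limit law in the angular variable\<close>

locale limit_params =
  fixes p q :: real
  assumes p: "0 < p" "p < 1" and q: "0 < q" "q < 1"
begin

definition "a = 1 - q"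
definition "b = 1 - p"
definition "\<kappa> = 1 - max p q"
definition "atom = max 0 (1 - (p + q))"
definition "c = a + b - 2 * a * b"
definition "s = sqrt (a * (1 - b) * (b * (1 - a)))"
text \<open>Both pairs have product \<open>s * s\<close>, and their sums are \<open>c\<close> and
  \<open>1 - c\<close>. Hence \<open>g\<close> and \<open>1 - g\<close> are \<open>hi\<close> and
  \<open>hi'\<close> times Poisson denominators with ratios \<open>s / hi\<close> and
  \<open>s / hi'\<close>; taking the larger number for \<open>hi\<close> keeps these ratios at most
  \<open>1\<close>.\<close>

definition "hi = max (a * (1 - b)) (b * (1 - a))"
definition "lo = min (a * (1 - b)) (b * (1 - a))"
definition "hi' = max (a * b) ((1 - a) * (1 - b))"
definition "lo' = min (a * b) ((1 - a) * (1 - b))"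

definition "g x = c - 2 * s * cos x"
text \<open>Partial fractions \<open>1 / (y * (1 - y)) = 1 / y + 1 / (1 - y)\<close> at
  \<open>y = g x\<close> split the density times the Jacobian into two Poisson quotients. The second
  one involves \<open>pi - x\<close> because the cosine enters \<open>1 - g x\<close> with the
  opposite sign. The factor \<open>1 / \<kappa>\<close> is left out.\<close>

definition "wt x = 2 * s\<^sup>2 / pi * (sin2_poisson (s / hi) x / hi + sin2_poisson (s / hi') (pi - x) / hi')"

lemma ab: "0 < a" "a < 1" "0 < b" "b < 1" using p q by (auto simp: a_def b_def)

lemma kappa: "\<kappa> = min a b" "0 < \<kappa>" using p q by (auto simp: a_def b_def \<kappa>_def)

lemma s_square: "s\<^sup>2 = lo * hi" "s\<^sup>2 = lo' * hi'" "s * s = a * (1 - a) * b * (1 - b)"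
proof -
  have "s\<^sup>2 = a * (1 - b) * (b * (1 - a))" unfolding s_def using ab by (intro real_sqrt_pow2) auto
  then show "s\<^sup>2 = lo * hi" "s\<^sup>2 = lo' * hi'" "s * s = a * (1 - a) * b * (1 - b)"
    by (auto simp: lo_def hi_def lo'_def hi'_def min_def max_def power2_eq_square mult_ac)
qed

lemma pos: "0 < s" "0 < lo" "0 < hi" "0 < lo'" "0 < hi'" "lo \<le> hi" "lo' \<le> hi'"
  using ab by (auto simp: s_def lo_def hi_def lo'_def hi'_def less_max_iff_disj)

lemma sums: "lo + hi = c" "lo' + hi' = 1 - c"
  by (auto simp: lo_def hi_def lo'_def hi'_def c_def min_def max_def algebra_simps)

lemma ratio: "0 < s / hi" "s / hi \<le> 1" "0 < s / hi'" "s / hi' \<le> 1"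
proof -
  have "s\<^sup>2 \<le> hi\<^sup>2" unfolding s_square(1) power2_eq_square[of hi] using pos by (intro mult_right_mono) auto
  moreover have "s\<^sup>2 \<le> hi'\<^sup>2" unfolding s_square(2) power2_eq_square[of hi'] using pos by (intro mult_right_mono) auto
  ultimately have "s \<le> hi" "s \<le> hi'" using pos by (auto intro: power2_le_imp_le)
  then show "0 < s / hi" "s / hi \<le> 1" "0 < s / hi'" "s / hi' \<le> 1" using pos by auto
qed

lemma s_square_divide: "s\<^sup>2 / hi = lo" "s\<^sup>2 / hi' = lo'"
proof -
  show "s\<^sup>2 / hi = lo" unfolding s_square(1) using pos by simp
  show "s\<^sup>2 / hi' = lo'" unfolding s_square(2) using pos by simp
qed

lemma g_factor: "g x = hi * (1 - 2 * (s / hi) * cos x + (s / hi)\<^sup>2)"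
  "1 - g x = hi' * (1 - 2 * (s / hi') * cos (pi - x) + (s / hi')\<^sup>2)"
proof -
  have "hi * (s / hi)\<^sup>2 = lo" "hi' * (s / hi')\<^sup>2 = lo'"
    unfolding s_square_divide[symmetric] using pos by (simp_all add: power_divide power2_eq_square)
  then show "g x = hi * (1 - 2 * (s / hi) * cos x + (s / hi)\<^sup>2)"
    "1 - g x = hi' * (1 - 2 * (s / hi') * cos (pi - x) + (s / hi')\<^sup>2)"
    using pos sums by (simp_all add: g_def algebra_simps)
qed

lemma sin2_poisson_g: "sin2_poisson (s / hi) x * g x = hi * (sin x)\<^sup>2" "sin2_poisson (s / hi') (pi - x) * (1 - g x) = hi' * (sin x)\<^sup>2"
proof -
  show "sin2_poisson (s / hi) x * g x = hi * (sin x)\<^sup>2"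
    using sin2_poisson_mult[of "s / hi" x] ratio unfolding g_factor(1) by (simp add: mult.left_commute)
  show "sin2_poisson (s / hi') (pi - x) * (1 - g x) = hi' * (sin x)\<^sup>2"
    using sin2_poisson_mult[of "s / hi'" "pi - x"] ratio unfolding g_factor(2) by (simp add: mult.left_commute)
qed

lemma g_bounds: "0 \<le> g x" "g x \<le> 1"
proof -
  have *: "0 \<le> 1 - 2 * r * cos x + r\<^sup>2" for r x :: real
  proof -
    have "1 - 2 * r * cos x + r\<^sup>2 = (r - cos x)\<^sup>2 + (sin x)\<^sup>2"
      by (simp add: power2_eq_square algebra_simps sin_cos_squared_add3)
    then show ?thesis by simp
  qed
  have "0 \<le> g x" unfolding g_factor(1) using pos by (intro mult_nonneg_nonneg *) simp
  moreover have "0 \<le> 1 - g x" unfolding g_factor(2) using pos by (intro mult_nonneg_nonneg *) simp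
  ultimately show "0 \<le> g x" "g x \<le> 1" by auto
qed

text \<open>Inside the interval \<open>sin x\<close> is nonzero, and \<open>sin2_poisson_g\<close>
  then keeps \<open>g x\<close> away from \<open>0\<close> and \<open>1\<close>, even when an edge
  of the support reaches these points.\<close>

lemma g_bounds_strict:
  assumes "0 < x" "x < pi" shows "0 < g x" "g x < 1"
proof -
  have "0 < (sin x)\<^sup>2" using sin_gt_zero[OF assms] by simp
  then have "sin2_poisson (s / hi) x * g x \<noteq> 0" "sin2_poisson (s / hi') (pi - x) * (1 - g x) \<noteq> 0"
    unfolding sin2_poisson_g using pos by auto
  then show "0 < g x" "g x < 1" using g_bounds[of x] by (auto simp: less_le)
qed

lemma r_minus_eq: "r_minus p q = c - 2 * s" and r_plus_eq: "r_plus p q = c + 2 * s"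
proof -
  have "sqrt (p * (1 - q)) * sqrt (q * (1 - p)) = s"
    by (simp add: s_def a_def b_def mult_ac flip: real_sqrt_mult)
  moreover have "(sqrt (p * (1 - q)))\<^sup>2 + (sqrt (q * (1 - p)))\<^sup>2 = c"
    using p q by (simp add: c_def a_def b_def algebra_simps)
  ultimately show "r_minus p q = c - 2 * s" "r_plus p q = c + 2 * s"
    by (simp_all add: r_minus_def r_plus_def power2_sum power2_diff)
qed

text \<open>The root in the density becomes \<open>2 * s * sin x / g x\<close>, and the Jacobian is
  \<open>2 * s * sin x\<close>. The endpoints are excluded: there the left-hand side is
  \<open>0\<close>, while \<open>wt\<close> does not vanish at an endpoint whose ratio is
  \<open>1\<close>.\<close>

lemma limit_density_substitution:
  assumes "x \<in> {0..pi}" "x \<noteq> 0" "x \<noteq> pi"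
  shows "limit_density p q (g x) * (2 * s * sin x) = wt x / \<kappa>"
proof -
  have x: "0 < x" "x < pi" using assms by auto
  have sin: "0 < sin x" using sin_gt_zero[OF x] .
  have "cos x < 1" "-1 < cos x"
    using x cos_monotone_0_pi[of 0 x] cos_monotone_0_pi[of x pi] by auto
  then have "s * cos x < s * 1" "s * (-1) < s * cos x"
    using pos(1) by (simp_all only: mult_strict_left_mono)
  then have in_supp: "g x \<in> {r_minus p q<..<r_plus p q}"
    unfolding greaterThanLessThan_iff r_minus_eq r_plus_eq g_def by linarith
  note gx = g_bounds_strict[OF x]
  have "(1 - r_minus p q / g x) * (r_plus p q / g x - 1) = (2 * s * sin x / g x)\<^sup>2"
  proof -
    have "(1 - r_minus p q / g x) * (r_plus p q / g x - 1) = (g x - r_minus p q) * (r_plus p q - g x) / (g x)\<^sup>2"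
      using gx by (simp add: field_simps power2_eq_square)
    also have "(g x - r_minus p q) * (r_plus p q - g x) = 4 * s\<^sup>2 * (1 - (cos x)\<^sup>2)"
      by (simp add: r_minus_eq r_plus_eq g_def algebra_simps power2_eq_square)
    also have "\<dots> = (2 * s * sin x)\<^sup>2" by (simp add: sin_squared_eq power_mult_distrib)
    finally show ?thesis by (simp add: power_divide)
  qed
  then have "sqrt ((1 - r_minus p q / g x) * (r_plus p q / g x - 1)) = 2 * s * sin x / g x"
    using gx sin pos(1) by simp
  then have "limit_density p q (g x) = 2 * s * sin x / g x / (2 * pi * (1 - g x) * \<kappa>)"
    unfolding limit_density_def using in_supp by (simp add: \<kappa>_def)
  then have "limit_density p q (g x) * (2 * s * sin x) = 2 * s * sin x / g x / (2 * pi * (1 - g x) * \<kappa>) * (2 * s * sin x)"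
    by (simp only:)
  also have "\<dots> = 2 * s\<^sup>2 / pi * ((sin x)\<^sup>2 / g x + (sin x)\<^sup>2 / (1 - g x)) / \<kappa>"
    using gx kappa(2) by (simp add: field_simps power2_eq_square)
  also have "(sin x)\<^sup>2 / g x = sin2_poisson (s / hi) x / hi" using sin2_poisson_g(1)[of x] gx pos by (simp add: field_simps)
  also have "(sin x)\<^sup>2 / (1 - g x) = sin2_poisson (s / hi') (pi - x) / hi'" using sin2_poisson_g(2)[of x] gx pos by (simp add: field_simps)
  finally show ?thesis by (simp add: wt_def)
qed

lemma wt_nonneg: "0 \<le> wt x"
  unfolding wt_def using ratio pos by (intro mult_nonneg_nonneg add_nonneg_nonneg divide_nonneg_nonneg sin2_poisson_nonneg) auto

lemma continuous_on_wt [continuous_intros]: "continuous_on S wt"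
  unfolding wt_def using ratio by (intro continuous_intros) auto

lemma continuous_on_g [continuous_intros]: "continuous_on S g"
  unfolding g_def by (intro continuous_intros)

text \<open>The point mass at \<open>1\<close> is carried by the extra interval \<open>(pi, pi + 1]\<close>.\<close>

definition "W x = indicator {0..pi} x * (wt x / \<kappa>) + indicator {pi<..pi + 1} x * (atom / \<kappa>)"
definition "h x = (if x \<le> pi then g x else 1)"

lemma W_nonneg: "0 \<le> W x"
  unfolding W_def using wt_nonneg kappa by (auto simp: atom_def)

lemma measurable_wt [measurable]: "wt \<in> borel_measurable borel"
  by (intro borel_measurable_continuous_onI continuous_intros)

lemma measurable_g [measurable]: "g \<in> borel_measurable borel"
  by (intro borel_measurable_continuous_onI continuous_intros)

lemma measurable_W [measurable]: "W \<in> borel_measurable borel"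
  unfolding W_def by measurable

lemma measurable_h [measurable]: "h \<in> borel_measurable borel"
  unfolding h_def by measurable

lemma sets_limit_law [simp]: "sets (limit_law p q) = sets borel"
  using sets.sigma_sets_eq[of "borel :: real measure"] by (simp add: limit_law_def)

text \<open>As an image measure the law turns integrals of \<open>f\<close> into integrals of
  \<open>f (g x)\<close> over the angle. The endpoints of the substitution form a null set.\<close>

lemma limit_law_eq_distr: "limit_law p q = distr (density lborel W) borel h"
proof (rule measure_eqI)
  fix A assume "A \<in> sets (limit_law p q)"
  then have A[measurable]: "A \<in> sets borel" by simp
  have [measurable]: "limit_density p q \<in> borel_measurable borel"
    unfolding limit_density_def by measurable
  have "emeasure (distr (density lborel W) borel h) A = (\<integral>\<^sup>+x. ennreal (W x) * indicator (h -` A) x \<partial>lborel)"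
    by (simp add: emeasure_distr emeasure_density measurable_sets_borel[OF measurable_h A])
  also have "\<dots> = (\<integral>\<^sup>+x. ennreal (wt x / \<kappa> * indicator A (g x) * indicator {0..pi} x) +
      ennreal (atom / \<kappa>) * indicator A 1 * indicator {pi<..pi + 1} x \<partial>lborel)"
    by (intro nn_integral_cong) (auto simp: W_def h_def indicator_def)
  also have "\<dots> = (\<integral>\<^sup>+x. ennreal (wt x / \<kappa> * indicator A (g x) * indicator {0..pi} x) \<partial>lborel) +
      (\<integral>\<^sup>+x. ennreal (atom / \<kappa>) * indicator A 1 * indicator {pi<..pi + 1} x \<partial>lborel)"
    by (intro nn_integral_add) auto
  also have "(\<integral>\<^sup>+x. ennreal (atom / \<kappa>) * indicator A 1 * indicator {pi<..pi + 1} x \<partial>lborel) = ennreal (atom / \<kappa>) * indicator A 1"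
    by (subst nn_integral_cmult_indicator) auto
  also have "(\<integral>\<^sup>+x. ennreal (wt x / \<kappa> * indicator A (g x) * indicator {0..pi} x) \<partial>lborel) =
      (\<integral>\<^sup>+x. ennreal (limit_density p q (g x) * indicator A (g x) * (2 * s * sin x) * indicator {0..pi} x) \<partial>lborel)"
  proof (rule nn_integral_cong_AE)
    have "AE x in lborel. x \<noteq> (0::real)" "AE x in lborel. x \<noteq> pi" by (rule AE_lborel_singleton)+
    then show "AE x in lborel. ennreal (wt x / \<kappa> * indicator A (g x) * indicator {0..pi} x) =
        ennreal (limit_density p q (g x) * indicator A (g x) * (2 * s * sin x) * indicator {0..pi} x)"
      by eventually_elim (auto simp: limit_density_substitution[symmetric] indicator_def)
  qed
  also have "\<dots> = (\<integral>\<^sup>+x. ennreal (limit_density p q x * indicator A x * indicator {g 0..g pi} x) \<partial>lborel)"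
  proof (rule nn_integral_substitution[symmetric])
    show "set_borel_measurable borel {g 0..g pi} (\<lambda>x. limit_density p q x * indicator A x)"
      unfolding set_borel_measurable_def by measurable
    show "(g has_real_derivative 2 * s * sin x) (at x)" for x
      unfolding g_def by (auto intro!: derivative_eq_intros)
    show "continuous_on {0..pi} (\<lambda>x. 2 * s * sin x)" by (intro continuous_intros)
    show "0 \<le> 2 * s * sin x" if "x \<in> {0..pi}" for x
      using that pos(1) sin_ge_zero[of x] by simp
  qed simp
  also have "\<dots> = (\<integral>\<^sup>+x\<in>A. ennreal (limit_density p q x) \<partial>lborel)"
    by (intro nn_integral_cong) (auto simp: limit_density_def indicator_def r_minus_eq r_plus_eq g_def)
  finally show "emeasure (limit_law p q) A = emeasure (distr (density lborel W) borel h) A"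
    unfolding emeasure_limit_law[OF A] by (simp add: atom_def \<kappa>_def)
qed simp

lemma AE_limit_law: "AE x in limit_law p q. 0 \<le> x \<and> x \<le> 1"
  unfolding limit_law_eq_distr using g_bounds by (subst AE_distr_iff) (auto simp: h_def)

lemma limit_law_integral:
  fixes f :: "real \<Rightarrow> real"
  assumes f: "continuous_on UNIV f"
  shows "integrable (limit_law p q) f"
    and "integral\<^sup>L (limit_law p q) f = (integral {0..pi} (\<lambda>x. wt x * f (g x)) + atom * f 1) / \<kappa>"
proof -
  have [measurable]: "f \<in> borel_measurable borel" by (rule borel_measurable_continuous_onI[OF f])
  let ?u = "\<lambda>x. wt x / \<kappa> * f (g x)"
  have split: "W x *\<^sub>R f (h x) = indicator {0..pi} x *\<^sub>R ?u x + indicator {pi<..pi + 1} x *\<^sub>R (atom / \<kappa> * f 1)" for x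
    by (auto simp: W_def h_def indicator_def)
  have cont: "continuous_on {0..pi} ?u"
    using kappa by (intro continuous_intros continuous_on_compose2[OF f]) auto
  have i1: "integrable lborel (\<lambda>x. indicator {0..pi} x *\<^sub>R ?u x)"
    using borel_integrable_atLeastAtMost'[OF cont] by (simp add: set_integrable_def)
  have i2: "integrable lborel (\<lambda>x. indicator {pi<..pi + 1} x *\<^sub>R (atom / \<kappa> * f 1))"
    by (intro integrable_scaleR_left integrable_real_indicator) auto
  have "integrable (density lborel W) (\<lambda>x. f (h x))"
    using i1 i2 W_nonneg by (subst integrable_density) (auto simp: split[abs_def] simp del: real_scaleR_def)
  then show "integrable (limit_law p q) f"
    unfolding limit_law_eq_distr by (subst integrable_distr_eq) auto
  have "integral\<^sup>L (limit_law p q) f = (\<integral>x. W x *\<^sub>R f (h x) \<partial>lborel)"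
    unfolding limit_law_eq_distr using W_nonneg by (subst integral_distr, simp, simp, subst integral_density) auto
  also have "\<dots> = (\<integral>x. indicator {0..pi} x *\<^sub>R ?u x \<partial>lborel) + (\<integral>x. indicator {pi<..pi + 1} x *\<^sub>R (atom / \<kappa> * f 1) \<partial>lborel)"
    unfolding split by (rule Bochner_Integration.integral_add[OF i1 i2])
  also have "(\<integral>x. indicator {0..pi} x *\<^sub>R ?u x \<partial>lborel) = integral {0..pi} ?u"
    using set_borel_integral_eq_integral(2)[OF borel_integrable_atLeastAtMost'[OF cont]]
    by (simp add: set_lebesgue_integral_def)
  also have "integral {0..pi} ?u = integral {0..pi} (\<lambda>x. wt x * f (g x)) / \<kappa>"
    using Henstock_Kurzweil_Integration.integral_divide[of "{0..pi}" "\<lambda>x. wt x * f (g x)" \<kappa>] by simp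
  also have "(\<integral>x. indicator {pi<..pi + 1} x *\<^sub>R (atom / \<kappa> * f 1) \<partial>lborel) = atom * f 1 / \<kappa>"
    by simp
  finally show "integral\<^sup>L (limit_law p q) f = (integral {0..pi} (\<lambda>x. wt x * f (g x)) + atom * f 1) / \<kappa>"
    by (simp add: add_divide_distrib)
qed

lemma integral_wt_cheb:
  "integral {0..pi} (\<lambda>x. wt x * cheb c (s * s) k (g x)) =
    4 * s\<^sup>2 / pi * (- s) ^ k * (sin2_poisson_coeff (s / hi) k / hi + (-1) ^ k * sin2_poisson_coeff (s / hi') k / hi')"
proof -
  have r: "0 \<le> s / hi" "s / hi \<le> 1" "0 \<le> s / hi'" "s / hi' \<le> 1" using ratio by auto
  have "((\<lambda>x. 4 * s\<^sup>2 / pi * (- s) ^ k * (cos (real k * x) * sin2_poisson (s / hi) x / hi + cos (real k * x) * sin2_poisson (s / hi') (pi - x) / hi'))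
    has_integral 4 * s\<^sup>2 / pi * (- s) ^ k * (sin2_poisson_coeff (s / hi) k / hi + (-1) ^ k * sin2_poisson_coeff (s / hi') k / hi')) {0..pi}"
    by (intro has_integral_mult_right has_integral_add has_integral_divide sin2_poisson_coeff_reflected r
        integrable_integral[OF sin2_poisson_coeff_integrable[OF r(1,2)], folded sin2_poisson_coeff_def])
  moreover have "4 * s\<^sup>2 / pi * (- s) ^ k * (cos (real k * x) * sin2_poisson (s / hi) x / hi + cos (real k * x) * sin2_poisson (s / hi') (pi - x) / hi')
    = wt x * cheb c (s * s) k (g x)" for x
    unfolding g_def cheb_cos wt_def by (simp add: algebra_simps)
  ultimately show ?thesis by (simp add: integral_unique)
qed

lemma integral_wt: "integral {0..pi} wt = lo + lo'"
proof -
  have "integral {0..pi} (\<lambda>x. wt x * 2) = 2 * (lo + lo')"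
  proof -
    have "integral {0..pi} (\<lambda>x. wt x * 2) = 4 * s\<^sup>2 / pi * (- s) ^ 0 * (pi / 2 / hi + (-1) ^ 0 * (pi / 2) / hi')"
      using integral_wt_cheb[of 0] unfolding sin2_poisson_coeff_eq(1)[OF ratio(1,2)] sin2_poisson_coeff_eq(1)[OF ratio(3,4)] by simp
    also have "\<dots> = 2 * (s\<^sup>2 / hi) + 2 * (s\<^sup>2 / hi')" by (simp add: distrib_left)
    finally show ?thesis unfolding s_square_divide by simp
  qed
  then show ?thesis by simp
qed

lemma integral_wt_cheb_eq:
  assumes "k \<ge> 1"
  shows "integral {0..pi} (\<lambda>x. wt x * cheb c (s * s) k (g x)) = (- lo) ^ k * (lo - hi) + lo' ^ k * (lo' - hi')"
proof (cases "k = 1")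
  case True
  have eq: "4 * s\<^sup>2 / pi * (- s) ^ 1 * (pi / 4 * (s / t) / t) = - ((s\<^sup>2 / t)\<^sup>2)" for t
    by (simp add: power2_eq_square)
  have "integral {0..pi} (\<lambda>x. wt x * cheb c (s * s) k (g x)) =
     4 * s\<^sup>2 / pi * (- s) ^ 1 * (pi / 4 * (s / hi) / hi) - 4 * s\<^sup>2 / pi * (- s) ^ 1 * (pi / 4 * (s / hi') / hi')"
    unfolding integral_wt_cheb True
    using sin2_poisson_coeff_eq(2)[OF ratio(1,2)] sin2_poisson_coeff_eq(2)[OF ratio(3,4)] by (simp add: algebra_simps)
  also have "\<dots> = - (lo\<^sup>2) + lo'\<^sup>2"
    unfolding eq s_square_divide by simp
  \<comment> \<open>\<open>lo * hi\<close> and \<open>lo' * hi'\<close> are both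
    \<open>s * s\<close>, so the extra terms of the general form cancel.\<close>
  also have "\<dots> = (- lo) ^ k * (lo - hi) + lo' ^ k * (lo' - hi')"
    using True s_square by (simp add: power2_eq_square algebra_simps)
  finally show ?thesis .
next
  case False
  then obtain l where k: "k = Suc (Suc l)" using assms by (metis One_nat_def Suc_le_D le_neq_implies_less Suc_le_eq not0_implies_Suc)
  \<comment> \<open>The sign \<open>e\<close> lets one identity serve both summands:
    \<open>-1\<close> for the pair \<open>lo\<close>, \<open>hi\<close>, and \<open>1\<close> for
    \<open>lo'\<close>, \<open>hi'\<close>, where the reflection contributes a second
    \<open>(-1) ^ k\<close>.\<close>
  have eq: "4 * s\<^sup>2 / pi * (e * s) ^ Suc (Suc l) * (pi / 4 * ((s / t) ^ Suc (Suc l) - (s / t) ^ l) / t) = (e * y) ^ Suc (Suc l) * (y - t)"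
    if sy: "s\<^sup>2 = y * t" and t: "t \<noteq> 0" and e: "e * e = 1" for y t e
  proof -
    have st: "s * (s / t) = y" "s\<^sup>2 / t = y" using sy t by (simp_all add: power2_eq_square)
    have 1: "(e * s) ^ j * (s / t) ^ j = (e * y) ^ j" for j
      by (simp only: power_mult_distrib[symmetric] mult.assoc st)
    have "4 * s\<^sup>2 / pi * (e * s) ^ Suc (Suc l) * (pi / 4 * ((s / t) ^ Suc (Suc l) - (s / t) ^ l) / t)
      = s\<^sup>2 / t * ((e * s) ^ Suc (Suc l) * (s / t) ^ Suc (Suc l) - (e * e) * (s * s) * ((e * s) ^ l * (s / t) ^ l))"
    proof -
      have 2: "4 * s\<^sup>2 / pi * X * (pi / 4 * (Y - Z) / t) = s\<^sup>2 / t * (X * Y - X * Z)" for X Y Z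
        by (simp add: right_diff_distrib[of X, symmetric])
      have 3: "(e * s) ^ Suc (Suc l) * Z = (e * e) * (s * s) * ((e * s) ^ l * Z)" for Z by simp
      show ?thesis unfolding 2 3[of "(s / t) ^ l"] ..
    qed
    also have "\<dots> = y * ((e * y) ^ Suc (Suc l) - (e * e) * (y * t) * (e * y) ^ l)"
      unfolding 1 st using sy by (simp add: power2_eq_square)
    also have "\<dots> = (e * y) ^ Suc (Suc l) * (y - t)" by (simp add: algebra_simps)
    finally show ?thesis .
  qed
  have "integral {0..pi} (\<lambda>x. wt x * cheb c (s * s) k (g x)) =
     4 * s\<^sup>2 / pi * ((-1) * s) ^ Suc (Suc l) * (pi / 4 * ((s / hi) ^ Suc (Suc l) - (s / hi) ^ l) / hi) +
     4 * s\<^sup>2 / pi * (1 * s) ^ Suc (Suc l) * (pi / 4 * ((s / hi') ^ Suc (Suc l) - (s / hi') ^ l) / hi')"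
    unfolding integral_wt_cheb k sin2_poisson_coeff_eq(3)[OF ratio(1,2)] sin2_poisson_coeff_eq(3)[OF ratio(3,4)]
    using power_minus[of s "Suc (Suc l)"] by (simp add: distrib_left distrib_right)
      (metis (no_types) left_minus_one_mult_self mult.assoc mult.commute)
  also have "\<dots> = ((-1) * lo) ^ Suc (Suc l) * (lo - hi) + (1 * lo') ^ Suc (Suc l) * (lo' - hi')"
    by (intro arg_cong2[where f = "(+)"] eq s_square) (use pos in auto)
  finally show ?thesis by (simp add: k)
qed

text \<open>\<open>1 - c\<close> and \<open>s * s\<close> are the sum and the product of
  \<open>a * b\<close> and \<open>(1 - a) * (1 - b)\<close>, so at \<open>1\<close> the recursion is
  that of their power sums.\<close>

lemma cheb_1: "cheb c (s * s) k 1 = (a * b) ^ k + ((1 - a) * (1 - b)) ^ k"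
proof -
  have cheb_eq: "cheb e (A * B) k 1 = A ^ k + B ^ k" if "1 - e = A + B" for e A B :: real
    by (induction k rule: induct_nat_012) (simp_all add: that algebra_simps)
  have "s * s = (a * b) * ((1 - a) * (1 - b))" using s_square(3) by simp
  then show ?thesis by (simp only:) (rule cheb_eq, simp add: c_def algebra_simps)
qed

text \<open>The right-hand side is minus the limit of the corrections in
  \<open>walk_sum_eq_sum_evs\<close> divided by \<open>n\<close>, with \<open>a\<close>,
  \<open>b\<close> and \<open>\<kappa>\<close> the limiting proportions of rows, columns and
  eigenvalues. As the walk sums disappear in the limit, this identifies the limits of the Chebyshev
  averages.\<close>

theorem limit_law_cheb:
  assumes k: "k \<ge> 1"
  shows "\<kappa> * integral\<^sup>L (limit_law p q) (cheb c (s * s) k) =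
    - ((1 - a - b) * (a * b) ^ k + (b - \<kappa>) * (- (a * (1 - b))) ^ k + (a - \<kappa>) * (- ((1 - a) * b)) ^ k)"
proof -
  have cont: "continuous_on UNIV (cheb c (s * s) k)"
    by (induction k rule: induct_nat_012) (auto intro!: continuous_intros)
  have "\<kappa> * integral\<^sup>L (limit_law p q) (cheb c (s * s) k) = (- lo) ^ k * (lo - hi) + (lo' ^ k * (lo' - hi') + atom * cheb c (s * s) k 1)"
    unfolding limit_law_integral(2)[OF cont] integral_wt_cheb_eq[OF k] using kappa(2) by simp
  \<comment> \<open>At most one of \<open>a - \<kappa>\<close> and \<open>b - \<kappa>\<close> is
    nonzero, since \<open>\<kappa>\<close> is the smaller of \<open>a\<close> and \<open>b\<close>;
    the case distinction matches the remaining term with \<open>lo\<close>.\<close>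
  also have "(- lo) ^ k * (lo - hi) = - ((b - \<kappa>) * (- (a * (1 - b))) ^ k + (a - \<kappa>) * (- ((1 - a) * b)) ^ k)"
  proof (cases "a \<le> b")
    case True
    then have "a * (1 - b) \<le> b * (1 - a)" by (simp add: algebra_simps)
    then have lo: "lo = a * (1 - b)" and hi: "hi = b * (1 - a)" and \<kappa>: "\<kappa> = a"
      using True by (auto simp: lo_def hi_def kappa)
    have *: "X * (a - b) = - ((b - a) * X + (a - a) * Y)" for X Y :: real by (simp add: algebra_simps)
    have "lo - hi = a - b" by (simp add: lo hi algebra_simps)
    then show ?thesis unfolding \<kappa> using * by (simp only: lo)
  next
    case False
    then have "b * (1 - a) \<le> a * (1 - b)" by (simp add: algebra_simps)
    then have lo: "lo = (1 - a) * b" and hi: "hi = a * (1 - b)" and \<kappa>: "\<kappa> = b"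
      using False by (auto simp: lo_def hi_def kappa mult.commute)
    have *: "X * (b - a) = - ((b - b) * Y + (a - b) * X)" for X Y :: real by (simp add: algebra_simps)
    have "lo - hi = b - a" by (simp add: lo hi algebra_simps)
    then show ?thesis unfolding \<kappa> using * by (simp only: lo)
  qed
  \<comment> \<open>For \<open>a + b \<le> 1\<close> there is no atom and
    \<open>lo' = a * b\<close>. Otherwise \<open>lo'\<close> is the other product, and one of the
    two powers contributed by the atom cancels the continuous part.\<close>
  also have "lo' ^ k * (lo' - hi') + atom * cheb c (s * s) k 1 = - ((1 - a - b) * (a * b) ^ k)"
  proof (cases "a + b \<le> 1")
    case True
    then have "a * b \<le> (1 - a) * (1 - b)" by (simp add: algebra_simps)
    then have lo': "lo' = a * b" and hi': "hi' = (1 - a) * (1 - b)" by (auto simp: lo'_def hi'_def)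
    have "atom = 0" using True by (simp add: atom_def a_def b_def)
    moreover have "lo' - hi' = - (1 - a - b)" by (simp add: lo' hi' algebra_simps)
    moreover have "X * (- Y) + 0 * Z = - (Y * X)" for X Y Z :: real by simp
    ultimately show ?thesis by (simp only: lo')
  next
    case False
    then have "(1 - a) * (1 - b) \<le> a * b" by (simp add: algebra_simps)
    then have "lo' = (1 - a) * (1 - b)" "hi' = a * b" by (auto simp: lo'_def hi'_def)
    moreover have "atom = - (1 - a - b)" using False by (simp add: atom_def a_def b_def)
    moreover have "(1 - a) * (1 - b) - a * b = 1 - a - b" by (simp add: algebra_simps)
    ultimately show ?thesis by (simp only: cheb_1) (simp only: distrib_left mult_minus_left, simp)
  qed
  finally show ?thesis by simp
qed

lemma prob_space_limit_law: "prob_space (limit_law p q)"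
proof -
  \<comment> \<open>The continuous part has mass \<open>lo + lo'\<close>; for
    \<open>a + b > 1\<close> the atom supplies what is missing to \<open>min a b\<close>.\<close>
  have *: "integral {0..pi} (\<lambda>x. wt x * 1) + atom * 1 = \<kappa>"
    using integral_wt sums ab
    by (auto simp: lo_def lo'_def atom_def kappa a_def b_def min_def max_def algebra_simps)
  have "integral\<^sup>L (limit_law p q) (\<lambda>_. 1 :: real) = 1"
  proof -
    have "integral\<^sup>L (limit_law p q) (\<lambda>_. 1) = (integral {0..pi} (\<lambda>x. wt x * 1) + atom * 1) / \<kappa>"
      by (rule limit_law_integral(2)) simp
    then show ?thesis unfolding * using kappa(2) by simp
  qed
  then have "measure (limit_law p q) (space (limit_law p q)) = 1" by simp
  then show ?thesis
    by (intro prob_spaceI) (metis emeasure_eq_ennreal_measure ennreal_1 enn2real_top measure_def zero_neq_one)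
qed

lemma real_distribution_limit_law: "real_distribution (limit_law p q)"
  using prob_space_limit_law by (simp add: real_distribution_def real_distribution_axioms_def)

end

section \<open>Weak convergence\<close>

text \<open>On \<open>[0, 1]\<close> the continuous step functions that test weak convergence are
  uniform limits of polynomials. The support condition on \<open>N n\<close> is eventual, as early
  lists of eigenvalues may be empty.\<close>

lemma weak_conv_m_if_moments_tendsto:
  fixes N :: "nat \<Rightarrow> real measure"
  assumes N: "\<And>n. real_distribution (N n)" and M: "real_distribution M"
    and N01: "eventually (\<lambda>n. AE x in N n. 0 \<le> x \<and> x \<le> 1) sequentially"
    and M01: "AE x in M. 0 \<le> x \<and> x \<le> 1"
    and moments: "\<And>j. (\<lambda>n. \<integral>x. x ^ j \<partial>N n) \<longlonglongrightarrow> (\<integral>x. x ^ j \<partial>M)"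
  shows "weak_conv_m N M"
proof (rule integral_cts_step_conv_imp_weak_conv[OF N M])
  fix x y :: real assume xy: "x < y"
  let ?f = "cts_step x y"
  have f_cont: "continuous_on UNIV ?f" using xy by (intro uniformly_continuous_imp_continuous cts_step_uniformly_continuous)
  have f1: "\<bar>?f z\<bar> \<le> 1" for z using xy by (auto simp: cts_step_def)
  have int: "integrable L h"
    if L: "real_distribution L" and AE: "AE x in L. 0 \<le> x \<and> x \<le> 1" and h: "continuous_on UNIV h"
    for L and h :: "real \<Rightarrow> real"
  proof -
    interpret L: real_distribution L by fact
    have "compact (h ` {0..1})" by (intro compact_continuous_image continuous_on_subset[OF h]) auto
    then have "bounded (h ` {0..1})" by (rule compact_imp_bounded)
    then obtain B where B: "\<forall>y\<in>h ` {0..1}. norm y \<le> B" unfolding bounded_iff by blast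
    have "h \<in> borel_measurable L" using borel_measurable_continuous_onI[OF h] by simp
    then show ?thesis using AE B by (intro L.integrable_const_bound[where B = B]) auto
  qed
  show "(\<lambda>n. integral\<^sup>L (N n) ?f) \<longlonglongrightarrow> integral\<^sup>L M ?f"
  proof (rule LIMSEQ_I)
    fix e :: real assume e: "0 < e"
    obtain g where g: "real_polynomial_function g" "\<And>z. z \<in> {0..1} \<Longrightarrow> \<bar>?f z - g z\<bar> < e / 3"
      by (rule Stone_Weierstrass_real_polynomial_function[of "{0..1}" ?f "e / 3"])
        (use e f_cont in \<open>auto intro: continuous_on_subset\<close>)
    obtain u d where gu: "g = (\<lambda>x. \<Sum>i\<le>d. u i * x ^ i)"
      using g(1) unfolding real_polynomial_function_iff_sum by blast
    have g_cont: "continuous_on UNIV g" unfolding gu by (intro continuous_intros)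
    have close: "\<bar>integral\<^sup>L L ?f - integral\<^sup>L L g\<bar> \<le> e / 3"
      and gint: "integral\<^sup>L L g = (\<Sum>i\<le>d. u i * (\<integral>x. x ^ i \<partial>L))"
      if L: "real_distribution L" and AE: "AE x in L. 0 \<le> x \<and> x \<le> 1" for L
    proof -
      interpret L: real_distribution L by fact
      note i = int[OF L AE f_cont] int[OF L AE g_cont]
      have "\<bar>integral\<^sup>L L ?f - integral\<^sup>L L g\<bar> = \<bar>\<integral>x. ?f x - g x \<partial>L\<bar>" using i by simp
      also have "\<dots> \<le> (\<integral>x. \<bar>?f x - g x\<bar> \<partial>L)" using integral_norm_bound[of L "\<lambda>x. ?f x - g x"] by simp
      also have "\<dots> \<le> (\<integral>x. e / 3 \<partial>L)"
        using AE i g(2) by (intro integral_mono_AE) (auto intro: less_imp_le)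
      finally show "\<bar>integral\<^sup>L L ?f - integral\<^sup>L L g\<bar> \<le> e / 3" using L.prob_space by simp
      have "integrable L (\<lambda>x. x ^ i)" for i by (rule int[OF L AE]) (intro continuous_intros)
      then show "integral\<^sup>L L g = (\<Sum>i\<le>d. u i * (\<integral>x. x ^ i \<partial>L))"
        unfolding gu by simp
    qed
    have "(\<lambda>n. \<Sum>i\<le>d. u i * (\<integral>x. x ^ i \<partial>N n)) \<longlonglongrightarrow> (\<Sum>i\<le>d. u i * (\<integral>x. x ^ i \<partial>M))"
      by (intro tendsto_intros moments)
    from tendstoD[OF this, of "e / 3"]
    have "eventually (\<lambda>n. \<bar>(\<Sum>i\<le>d. u i * (\<integral>x. x ^ i \<partial>N n)) - (\<Sum>i\<le>d. u i * (\<integral>x. x ^ i \<partial>M))\<bar> < e / 3) sequentially"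
      using e unfolding dist_real_def by simp
    then have "eventually (\<lambda>n. norm (integral\<^sup>L (N n) ?f - integral\<^sup>L M ?f) < e) sequentially"
      using N01
    proof eventually_elim
      case (elim n)
      have "\<bar>integral\<^sup>L (N n) g - integral\<^sup>L M g\<bar> < e / 3"
        using elim(1) gint[OF N elim(2)] gint[OF M M01] by simp
      then show ?case using close[OF N elim(2)] close[OF M M01] by (simp add: abs_if split: if_splits)
    qed
    then show "\<exists>n0. \<forall>n\<ge>n0. norm (integral\<^sup>L (N n) ?f - integral\<^sup>L M ?f) < e"
      by (simp add: eventually_sequentially)
  qed
qed

lemma real_distribution_empirical: "real_distribution (empirical_distribution xs)"
  unfolding empirical_distribution_def
  by (intro prob_space.real_distribution_distr measure_pmf.prob_space_axioms) simp

lemma empirical_distribution_integral: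
  fixes f :: "real \<Rightarrow> real"
  assumes xs: "xs \<noteq> []" and f: "f \<in> borel_measurable borel"
  shows "integral\<^sup>L (empirical_distribution xs) f = (\<Sum>x\<leftarrow>xs. f x) / real (length xs)"
proof -
  have xs': "mset xs \<noteq> {#}" using xs by simp
  have "integral\<^sup>L (empirical_distribution xs) f = measure_pmf.expectation (pmf_of_multiset (mset xs)) f"
    unfolding empirical_distribution_def by (subst integral_distr) (auto simp: f)
  also have "\<dots> = (\<Sum>x\<in>set xs. pmf (pmf_of_multiset (mset xs)) x * f x)"
    using xs' by (subst integral_measure_pmf[of "set xs"]) auto
  also have "\<dots> = (\<Sum>x\<in>set xs. real (count (mset xs) x) * f x) / real (length xs)"
    using xs' by (simp add: sum_divide_distrib)
  also have "(\<Sum>x\<in>set xs. real (count (mset xs) x) * f x) = (\<Sum>x\<leftarrow>xs. f x)"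
  proof -
    \<comment> \<open>The sum runs over a fixed finite set \<open>A\<close>, as the set of entries
      would change along the induction on the list.\<close>
    have "(\<Sum>x\<in>A. real (count (mset l) x) * f x) = (\<Sum>x\<leftarrow>l. f x)" if "finite A" "set l \<subseteq> A" for A l
      using that(2)
    proof (induction l)
      case (Cons y l)
      have "(\<Sum>x\<in>A. real (count (mset (y # l)) x) * f x) =
        (\<Sum>x\<in>A. (if x = y then f y else 0) + real (count (mset l) x) * f x)"
        by (intro sum.cong) (auto simp: algebra_simps)
      also have "\<dots> = f y + (\<Sum>x\<in>A. real (count (mset l) x) * f x)"
        using Cons.prems that(1) by (simp add: sum.distrib)
      finally show ?case using Cons by simp
    qed simp
    then show ?thesis by blast
  qed
  finally show ?thesis .
qed

lemma AE_empirical_distribution: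
  assumes "xs \<noteq> []" "\<And>x. x \<in> set xs \<Longrightarrow> 0 \<le> x \<and> x \<le> 1"
  shows "AE x in empirical_distribution xs. 0 \<le> x \<and> x \<le> 1"
  unfolding empirical_distribution_def
  using assms by (subst AE_distr_iff) (auto simp: AE_measure_pmf_iff)

context limit_params
begin

text \<open>The recursion of \<open>cheb\<close> trades a factor \<open>x\<close> for shifts of the index, so convergence for all \<open>cheb k\<close>
  gives convergence of all moments.\<close>

lemma moments_tendsto_if_cheb_tendsto:
  fixes xs :: "nat \<Rightarrow> real list"
  defines "mean \<equiv> \<lambda>n f. (\<Sum>x\<leftarrow>xs n. f x) / real (length (xs n))"
  assumes cheb: "\<And>k. (\<lambda>n. mean n (cheb c (s * s) k)) \<longlonglongrightarrow> integral\<^sup>L (limit_law p q) (cheb c (s * s) k)"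
  shows "(\<lambda>n. mean n (\<lambda>x. x ^ j)) \<longlonglongrightarrow> integral\<^sup>L (limit_law p q) (\<lambda>x. x ^ j)"
proof -
  let ?I = "integral\<^sup>L (limit_law p q)"
  let ?t = "cheb c (s * s)"
  have lin: "mean n (\<lambda>x. \<alpha> * f x + \<beta> * h x + \<gamma> * k x) = \<alpha> * mean n f + \<beta> * mean n h + \<gamma> * mean n k"
    for n \<alpha> \<beta> \<gamma> and f h k :: "real \<Rightarrow> real"
  proof -
    have "(\<Sum>x\<leftarrow>l. \<alpha> * f x + \<beta> * h x + \<gamma> * k x) = \<alpha> * (\<Sum>x\<leftarrow>l. f x) + \<beta> * (\<Sum>x\<leftarrow>l. h x) + \<gamma> * (\<Sum>x\<leftarrow>l. k x)" for l
      by (induction l) (simp_all add: algebra_simps)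
    then show ?thesis by (simp add: mean_def add_divide_distrib)
  qed
  have cont: "continuous_on UNIV (?t k)" for k
    by (induction k rule: induct_nat_012) (auto intro!: continuous_intros)
  have int: "integrable (limit_law p q) (\<lambda>x. x ^ j * ?t k x)" for j k
    by (intro limit_law_integral continuous_intros cont)
  have step: "(\<lambda>n. mean n (\<lambda>x. x ^ Suc j * ?t k x)) \<longlonglongrightarrow> ?I (\<lambda>x. x ^ Suc j * ?t k x)"
    if IH: "\<And>k. (\<lambda>n. mean n (\<lambda>x. x ^ j * ?t k x)) \<longlonglongrightarrow> ?I (\<lambda>x. x ^ j * ?t k x)"
      and eq: "\<And>x. x ^ Suc j * ?t k x = \<alpha> * (x ^ j * ?t ka x) + \<beta> * (x ^ j * ?t kb x) + \<gamma> * (x ^ j * ?t kc x)"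
    for j k ka kb kc \<alpha> \<beta> \<gamma>
  proof -
    have "?I (\<lambda>x. x ^ Suc j * ?t k x) = \<alpha> * ?I (\<lambda>x. x ^ j * ?t ka x) + \<beta> * ?I (\<lambda>x. x ^ j * ?t kb x) + \<gamma> * ?I (\<lambda>x. x ^ j * ?t kc x)"
      unfolding eq using int by simp
    then show ?thesis unfolding eq lin by (auto intro!: tendsto_intros IH)
  qed
  have all: "(\<lambda>n. mean n (\<lambda>x. x ^ j * ?t k x)) \<longlonglongrightarrow> ?I (\<lambda>x. x ^ j * ?t k x)" for j k
  proof (induction j arbitrary: k)
    case 0
    then show ?case using cheb[of k] by simp
  next
    case (Suc j)
    show ?case
    proof (cases k)
      case 0
      show ?thesis
      proof (rule step[OF Suc])
        show "x ^ Suc j * ?t k x = 2 * (x ^ j * ?t 1 x) + c * (x ^ j * ?t 0 x) + 0 * (x ^ j * ?t 0 x)" for x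
          by (simp add: 0 algebra_simps)
      qed
    next
      case (Suc l)
      show ?thesis
      proof (rule step[OF Suc.IH])
        show "x ^ Suc j * ?t k x = 1 * (x ^ j * ?t (Suc (Suc l)) x) + c * (x ^ j * ?t (Suc l) x) + (s * s) * (x ^ j * ?t l x)" for x
          by (simp add: Suc algebra_simps)
      qed
    qed
  qed
  have "mean n (\<lambda>x. x ^ j) = mean n (\<lambda>x. 1 / 2 * (x ^ j * ?t 0 x) + 0 * (x ^ j * ?t 0 x) + 0 * (x ^ j * ?t 0 x))" for n
    by simp
  then have eq1: "mean n (\<lambda>x. x ^ j) = 1 / 2 * mean n (\<lambda>x. x ^ j * ?t 0 x)" for n
    unfolding lin by simp
  have eq2: "?I (\<lambda>x. x ^ j) = 1 / 2 * ?I (\<lambda>x. x ^ j * ?t 0 x)" by simp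
  show ?thesis unfolding eq1 eq2 by (intro tendsto_intros all)
qed

text \<open>The deterministic part of the argument, applied at a single sample point. Solving the
  trace formula for the sum over the eigenvalues and dividing by their number, which is of order
  \<open>\<kappa> * n\<close>, gives the Chebyshev averages.\<close>

theorem restriction_law_weak_conv:
  fixes A :: "nat \<Rightarrow> complex mat" and S T :: "nat \<Rightarrow> nat set"
  assumes A: "\<And>n. n \<ge> 1 \<Longrightarrow> A n \<in> unitary_group n"
    and S: "\<And>n. n \<ge> 1 \<Longrightarrow> S n \<subseteq> {..<n}" and T: "\<And>n. n \<ge> 1 \<Longrightarrow> T n \<subseteq> {..<n}"
    and cS: "(\<lambda>n. real (card (S n)) / real n) \<longlonglongrightarrow> a" and cT: "(\<lambda>n. real (card (T n)) / real n) \<longlonglongrightarrow> b"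
    and walk: "\<And>k. k \<ge> 1 \<Longrightarrow> (\<lambda>n. walk_sum n k a b (A n) (S n) (T n) / of_nat n) \<longlonglongrightarrow> 0"
  shows "weak_conv_m (\<lambda>n. restriction_law (A n) (S n) (T n)) (limit_law p q)"
proof -
  define xs where "xs n = restriction.evs (A n) (S n) (T n)" for n
  have loc: "restriction n (A n) (S n) (T n)" if "n \<ge> 1" for n
    using A[OF that] S[OF that] T[OF that] by (rule restriction.intro)
  have law: "restriction_law (A n) (S n) (T n) = empirical_distribution (xs n)" if "n \<ge> 1" for n
    unfolding xs_def by (rule restriction.restriction_law_eq[OF loc[OF that]])
  have len: "length (xs n) = min (card (T n)) (card (S n))" if "n \<ge> 1" for n
    unfolding xs_def by (rule restriction.length_evs[OF loc[OF that]])
  have "(\<lambda>n. min (real (card (T n)) / real n) (real (card (S n)) / real n)) \<longlonglongrightarrow> min b a"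
    by (intro tendsto_intros cS cT)
  moreover have "eventually (\<lambda>n. min (real (card (T n)) / real n) (real (card (S n)) / real n) = real (length (xs n)) / real n) sequentially"
    using eventually_ge_at_top[of 1] by eventually_elim (auto simp: len min_def divide_le_cancel)
  ultimately have ratio: "(\<lambda>n. real (length (xs n)) / real n) \<longlonglongrightarrow> \<kappa>"
    unfolding kappa(1) min.commute[of a] by (rule Lim_transform_eventually)
  \<comment> \<open>Positivity of \<open>\<kappa>\<close> confines empty lists, whose empirical
    distribution is unspecified, to finitely many \<open>n\<close>.\<close>
  have pos: "eventually (\<lambda>n. n \<ge> 1 \<and> xs n \<noteq> []) sequentially"
    using order_tendstoD(1)[OF ratio kappa(2)] eventually_ge_at_top[of 1] by eventually_elim auto
  let ?mean = "\<lambda>n f. (\<Sum>x\<leftarrow>xs n. f x) / real (length (xs n))"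
  let ?I = "integral\<^sup>L (limit_law p q)"
  have cheb: "(\<lambda>n. ?mean n (cheb c (s * s) k)) \<longlonglongrightarrow> ?I (cheb c (s * s) k)" for k
  proof (cases "k = 0")
    \<comment> \<open>The trace formula starts at \<open>k = 1\<close>; for \<open>k = 0\<close> the
      polynomial is the constant \<open>2\<close>, and the claim is that the limit law has mass
      one.\<close>
    case True
    have "?I (\<lambda>_. 2 :: real) = 2" using prob_space.prob_space[OF prob_space_limit_law] by simp
    moreover have "eventually (\<lambda>n. 2 = ?mean n (\<lambda>_. 2)) sequentially"
      using pos by eventually_elim (simp add: sum_list_triv)
    then have "(\<lambda>n. ?mean n (\<lambda>_. 2)) \<longlonglongrightarrow> 2"
      by (rule Lim_transform_eventually[OF tendsto_const])
    ultimately show ?thesis using True by (simp add: cheb.simps(1)[abs_def])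
  next
    case False
    then have k: "k \<ge> 1" by simp
    let ?R = "\<lambda>n. (1 - real (card (S n)) / real n - real (card (T n)) / real n) * (a * b) ^ k
      + (real (card (T n)) / real n - real (length (xs n)) / real n) * (- (a * (1 - b))) ^ k
      + (real (card (S n)) / real n - real (length (xs n)) / real n) * (- ((1 - a) * b)) ^ k"
    let ?w = "\<lambda>n. walk_sum n k a b (A n) (S n) (T n) / of_nat n"
    have "(\<lambda>n. (Re (?w n) - ?R n) / (real (length (xs n)) / real n)) \<longlonglongrightarrow>
      (Re 0 - ((1 - a - b) * (a * b) ^ k + (b - \<kappa>) * (- (a * (1 - b))) ^ k + (a - \<kappa>) * (- ((1 - a) * b)) ^ k)) / \<kappa>"
      using kappa(2) by (intro tendsto_intros walk k cS cT ratio) auto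
    also have "(Re 0 - ((1 - a - b) * (a * b) ^ k + (b - \<kappa>) * (- (a * (1 - b))) ^ k + (a - \<kappa>) * (- ((1 - a) * b)) ^ k)) / \<kappa>
      = ?I (cheb c (s * s) k)"
      using limit_law_cheb[OF k] kappa(2) by (simp add: field_simps)
    finally have lim: "(\<lambda>n. (Re (?w n) - ?R n) / (real (length (xs n)) / real n)) \<longlonglongrightarrow> ?I (cheb c (s * s) k)" .
    have "eventually (\<lambda>n. (Re (?w n) - ?R n) / (real (length (xs n)) / real n) = ?mean n (cheb c (s * s) k)) sequentially"
      using pos
    proof eventually_elim
      case (elim n)
      then have n: "n \<ge> 1" and l: "length (xs n) \<noteq> 0" by auto
      let ?Q = "\<Sum>x\<leftarrow>xs n. cheb c (s * s) k x"
      have "Re (?w n) = (?Q + (real n - real (card (S n)) - real (card (T n))) * (a * b) ^ k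
        + (real (card (T n)) - real (length (xs n))) * (- (a * (1 - b))) ^ k
        + (real (card (S n)) - real (length (xs n))) * (- ((1 - a) * b)) ^ k) / real n"
        unfolding restriction.walk_sum_eq_sum_evs[OF loc[OF n] k, folded xs_def] s_square(3) c_def
        by (simp only: Re_divide_of_nat Re_complex_of_real)
      also have "\<dots> = ?Q / real n + ?R n" using n by (simp add: add_divide_distrib diff_divide_distrib left_diff_distrib)
      finally show ?case using n l by simp
    qed
    then show ?thesis by (rule Lim_transform_eventually[OF lim])
  qed
  show ?thesis
  proof (rule weak_conv_m_if_moments_tendsto)
    show "real_distribution (restriction_law (A n) (S n) (T n))" for n
      unfolding restriction_law_def by (rule real_distribution_empirical)
    show "real_distribution (limit_law p q)" by (rule real_distribution_limit_law)
    show "AE x in limit_law p q. 0 \<le> x \<and> x \<le> 1" by (rule AE_limit_law)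
    show "eventually (\<lambda>n. AE x in restriction_law (A n) (S n) (T n). 0 \<le> x \<and> x \<le> 1) sequentially"
      using pos
    proof eventually_elim
      case (elim n)
      show ?case unfolding law[OF conjunct1[OF elim]]
        using elim restriction.evs_bounds[OF loc[of n]] by (intro AE_empirical_distribution) (auto simp: xs_def)
    qed
    fix j
    have "eventually (\<lambda>n. ?mean n (\<lambda>x. x ^ j) = (\<integral>x. x ^ j \<partial>restriction_law (A n) (S n) (T n))) sequentially"
      using pos
    proof eventually_elim
      case (elim n)
      then show ?case using law[of n] by (simp add: empirical_distribution_integral)
    qed
    then show "(\<lambda>n. \<integral>x. x ^ j \<partial>restriction_law (A n) (S n) (T n)) \<longlonglongrightarrow> ?I (\<lambda>x. x ^ j)"
      by (rule Lim_transform_eventually[OF moments_tendsto_if_cheb_tendsto[OF cheb]])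
  qed
qed

end

context prob_space
begin

text \<open>The form common to both matrices: the law of \<open>U n\<close> enters only through the
  moments of single entries, which are to have the size of those of a flat unitary matrix.\<close>

lemma AE_restriction_law_weak_conv:
  assumes pq: "0 < p" "p < 1" "0 < q" "q < 1"
    and ris: "\<And>n. n \<ge> 1 \<Longrightarrow> random_index_sets n (1 - q) (1 - p) (\<Omega> n) (T n)"
    and ind: "\<And>n. n \<ge> 1 \<Longrightarrow> indep_of (count_space (Pow {..<n} \<times> Pow {..<n}))
       (\<lambda>\<omega>. (\<Omega> n \<omega>, T n \<omega>)) (unitary_space n) (U n)"
    and C: "\<And>m. \<exists>C. \<forall>n i j. i < n \<longrightarrow> j < n \<longrightarrow>
       expectation (\<lambda>\<omega>. norm (U n \<omega> $$ (i, j)) ^ (2 * m)) \<le> C / real n ^ m"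
  shows "AE \<omega> in M. weak_conv_m (\<lambda>n. restriction_law (U n \<omega>) (\<Omega> n \<omega>) (T n \<omega>)) (limit_law p q)"
proof -
  interpret lp: limit_params p q using pq by unfold_locales
  have "AE \<omega> in M. \<forall>k\<ge>1. (\<lambda>n. walk_sum n k (1 - q) (1 - p) (U n \<omega>) (\<Omega> n \<omega>) (T n \<omega>) / of_nat n) \<longlonglongrightarrow> 0"
    using pq by (intro AE_walk_sum_tendsto_0 ris ind C) auto
  moreover have "AE \<omega> in M. (\<lambda>n. real (card (\<Omega> n \<omega>)) / real n) \<longlonglongrightarrow> 1 - q"
    by (rule random_index_sets_AE_card(1)) (rule ris)
  moreover have "AE \<omega> in M. (\<lambda>n. real (card (T n \<omega>)) / real n) \<longlonglongrightarrow> 1 - p"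
    by (rule random_index_sets_AE_card(2)) (rule ris)
  ultimately show ?thesis
    using AE_space
  proof eventually_elim
    case (elim \<omega>)
    have U: "U n \<omega> \<in> unitary_group n" if "n \<ge> 1" for n
      using ind[OF that] measurable_space[of "U n" M "unitary_space n" \<omega>] elim(4) by (simp add: indep_of_def)
    have sub: "\<Omega> n \<omega> \<subseteq> {..<n}" "T n \<omega> \<subseteq> {..<n}" if "n \<ge> 1" for n
      using ris[OF that] elim(4) by (auto simp: random_index_sets_def)
    show ?case
      using elim(1-3) U sub by (intro lp.restriction_law_weak_conv) (auto simp: lp.a_def lp.b_def)
  qed
qed

end

theorem theorem3p1:
  fixes p q :: real
    and M :: "'a measure"
    and \<Omega> T :: "nat \<Rightarrow> 'a \<Rightarrow> nat set"
    and U :: "nat \<Rightarrow> 'a \<Rightarrow> complex mat"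
  assumes "0 < p" "p < 1" "0 < q" "q < 1"
    and "prob_space M"
    and "\<And>n. n \<ge> 1 \<Longrightarrow> prob_space.random_index_sets M n (1 - q) (1 - p) (\<Omega> n) (T n)"
    and "\<And>n. n \<ge> 1 \<Longrightarrow> prob_space.haar_unitary M n (U n)"
    and "\<And>n. n \<ge> 1 \<Longrightarrow> prob_space.indep_of M
           (count_space (Pow {..<n} \<times> Pow {..<n})) (\<lambda>\<omega>. (\<Omega> n \<omega>, T n \<omega>))
           (unitary_space n) (U n)"
  shows "(AE \<omega> in M. weak_conv_m (\<lambda>n. restriction_law (dft_matrix n) (\<Omega> n \<omega>) (T n \<omega>))
            (limit_law p q)) \<and>
         (AE \<omega> in M. weak_conv_m (\<lambda>n. restriction_law (U n \<omega>) (\<Omega> n \<omega>) (T n \<omega>))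
            (limit_law p q))"
proof
  interpret prob_space M by fact
  note pq = assms(1-4) and ris = assms(6) and haar = assms(7) and ind = assms(8)
  have XY: "(\<lambda>\<omega>. (\<Omega> n \<omega>, T n \<omega>)) \<in> measurable M (count_space (Pow {..<n} \<times> Pow {..<n}))" if "n \<ge> 1" for n
    using ind[OF that] by (simp add: indep_of_def)
  \<comment> \<open>The DFT matrix is taken as a constant random matrix; its entries have modulus
    exactly \<open>1 / sqrt n\<close>, so the moment bound holds with constant
    \<open>1\<close>.\<close>
  show "AE \<omega> in M. weak_conv_m (\<lambda>n. restriction_law (dft_matrix n) (\<Omega> n \<omega>) (T n \<omega>)) (limit_law p q)"
  proof (rule AE_restriction_law_weak_conv[OF pq ris])
    show "indep_of (count_space (Pow {..<n} \<times> Pow {..<n})) (\<lambda>\<omega>. (\<Omega> n \<omega>, T n \<omega>)) (unitary_space n) (\<lambda>_. dft_matrix n)"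
      if "n \<ge> 1" for n
      using XY[OF that] by (intro indep_of_const) (simp_all add: dft_matrix_unitary)
    show "\<exists>C. \<forall>n i j. i < n \<longrightarrow> j < n \<longrightarrow> expectation (\<lambda>\<omega>. norm (dft_matrix n $$ (i, j)) ^ (2 * m)) \<le> C / real n ^ m" for m
      by (rule exI[of _ 1]) (simp add: norm_dft_matrix prob_space power_mult power_divide)
  qed
  show "AE \<omega> in M. weak_conv_m (\<lambda>n. restriction_law (U n \<omega>) (\<Omega> n \<omega>) (T n \<omega>)) (limit_law p q)"
  proof (rule AE_restriction_law_weak_conv[OF pq ris ind])
    show "\<exists>C. \<forall>n i j. i < n \<longrightarrow> j < n \<longrightarrow> expectation (\<lambda>\<omega>. norm (U n \<omega> $$ (i, j)) ^ (2 * m)) \<le> C / real n ^ m" for m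
    proof (intro exI allI impI)
      fix n i j :: nat assume ij: "i < n" "j < n"
      then have "n \<ge> 1" by simp
      from haar_unitary_entry_moment[OF haar[OF this] ij]
      show "expectation (\<lambda>\<omega>. norm (U n \<omega> $$ (i, j)) ^ (2 * m)) \<le> khintchine_const m / real n ^ m" .
    qed
  qed
qed

end
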